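(* Let $H$ be a semisimple Hopf algebra over an algebraically closed field $k$ of characteristic $0$ and let $N$ be a left coideal subalgebra of $H$. Let $B=(H^* )^N$ with integral $\lambda_B=\Lambda_N\rightharpoonup\lambda$, and let $\gamma:N^*\to H^*$ be defined by $\langle\gamma(p),h\rangle=\langle p,\lambda_B\rightharpoonup h\rangle$ for all $p\in N^*$, $h\in H$. Then $$\mathrm{Im}(\gamma)=H^*\lambda_B=\{x\in H^*\,|\,s(x)\rightharpoonup H\subset N\}.$$
   Context: $s$ denotes the antipode of $H^*$. A left coideal subalgebra of $H$ is a unital subalgebra $N$ with $\Delta(N)\subset H\otimes N$; it has a unique idempotent two-sided integral $\Lambda_N$ ($n\Lambda_N=\Lambda_Nn=\langle\varepsilon,n\rangle\Lambda_N$ for $n\in N$, $\langle\varepsilon,\Lambda_N\rangle=1$). Hit actions: for $a\in H$, $p\in H^*$, $\langle a\rightharpoonup p,a'\rangle=\langle p,a'a\rangle$ and $p\rightharpoonup a=\sum a_1\langle p,a_2\rangle$. $(H^* )^N=\{p\in H^*: n\rightharpoonup p=\langle\varepsilon,n\rangle p\ \forall n\in N\}$. $\lambda=\sum_i d_i\chi_i\in H^*$ is the character of the regular representation of $H$ ($\chi_i$ the irreducible characters of $H$, $d_i=\langle\chi_i,1\rangle$). It is known that $\lambda_B\rightharpoonup H=N$, so $\gamma$ is well defined. *)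

theory Defs
  imports
    "HOL-Library.FuncSet"
    "HOL-Computational_Algebra.Polynomial"
    "Jordan_Normal_Form.Matrix"
begin

text \<open>
  The underlying ring of a Hopf algebra is a whole type \<open>'h :: ring_1\<close>, with scalar multiplication
  \<open>scale :: 'k \<Rightarrow> 'h \<Rightarrow> 'h\<close> over a field \<open>'k\<close>.  The list \<open>[(a\<^sub>1, b\<^sub>1), \<dots>]\<close> stands for
  \<open>a\<^sub>1 \<otimes> b\<^sub>1 + \<dots>\<close>; \<open>H \<otimes> H\<close> is the quotient of the type of such lists (formal sums) by the
  congruence \<open>tensor2_eq scale\<close>, and \<open>H \<otimes> H \<otimes> H\<close> is the analogous quotient by
  \<open>tensor3_eq scale\<close>.  Scalars are absorbed in the tensor factors.
\<close>

inductive tensor2_eq ::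
    "('k::field \<Rightarrow> 'h::ring_1 \<Rightarrow> 'h) \<Rightarrow> ('h \<times> 'h) list \<Rightarrow> ('h \<times> 'h) list \<Rightarrow> bool"
  for scale :: "'k::field \<Rightarrow> 'h::ring_1 \<Rightarrow> 'h"
where
  refl: "tensor2_eq scale t t"
| sym: "tensor2_eq scale t u \<Longrightarrow> tensor2_eq scale u t"
| trans: "tensor2_eq scale t u \<Longrightarrow> tensor2_eq scale u v \<Longrightarrow> tensor2_eq scale t v"
| append: "tensor2_eq scale t t' \<Longrightarrow> tensor2_eq scale u u' \<Longrightarrow> tensor2_eq scale (t @ u) (t' @ u')"
| comm: "tensor2_eq scale (t @ u) (u @ t)"
| zero: "tensor2_eq scale [(0, b)] []"
| add1: "tensor2_eq scale [(a + a', b)] [(a, b), (a', b)]"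
| add2: "tensor2_eq scale [(a, b + b')] [(a, b), (a, b')]"
| bal: "tensor2_eq scale [(scale r a, b)] [(a, scale r b)]"

inductive tensor3_eq ::
    "('k::field \<Rightarrow> 'h::ring_1 \<Rightarrow> 'h) \<Rightarrow> ('h \<times> 'h \<times> 'h) list \<Rightarrow> ('h \<times> 'h \<times> 'h) list \<Rightarrow> bool"
  for scale :: "'k::field \<Rightarrow> 'h::ring_1 \<Rightarrow> 'h"
where
  refl: "tensor3_eq scale t t"
| sym: "tensor3_eq scale t u \<Longrightarrow> tensor3_eq scale u t"
| trans: "tensor3_eq scale t u \<Longrightarrow> tensor3_eq scale u v \<Longrightarrow> tensor3_eq scale t v"
| append: "tensor3_eq scale t t' \<Longrightarrow> tensor3_eq scale u u' \<Longrightarrow> tensor3_eq scale (t @ u) (t' @ u')"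
| comm: "tensor3_eq scale (t @ u) (u @ t)"
| zero: "tensor3_eq scale [(0, b, c)] []"
| add1: "tensor3_eq scale [(a + a', b, c)] [(a, b, c), (a', b, c)]"
| add2: "tensor3_eq scale [(a, b + b', c)] [(a, b, c), (a, b', c)]"
| add3: "tensor3_eq scale [(a, b, c + c')] [(a, b, c), (a, b, c')]"
| bal12: "tensor3_eq scale [(scale r a, b, c)] [(a, scale r b, c)]"
| bal23: "tensor3_eq scale [(a, scale r b, c)] [(a, b, scale r c)]"

text \<open>
  \<open>\<Delta> h\<close> is a chosen representative \<open>[(h\<^sub>1, h\<^sub>2), \<dots>]\<close> of the comultiplication of \<open>h\<close>, so
  \<open>\<Sum>(a, b)\<leftarrow>\<Delta> h. f a b\<close> is the Sweedler sum \<open>\<Sum> f h\<^sub>1 h\<^sub>2\<close>.  Only the class of \<open>\<Delta> h\<close>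
  in \<open>H \<otimes> H\<close> is constrained.  Finite dimensionality is not assumed.
\<close>

locale hopf_algebra = vector_space scale
  for scale :: "'k::field \<Rightarrow> 'h::ring_1 \<Rightarrow> 'h" +
  fixes \<Delta> :: "'h \<Rightarrow> ('h \<times> 'h) list"
    and \<epsilon> :: "'h \<Rightarrow> 'k"
    and S :: "'h \<Rightarrow> 'h"
  assumes scale_mult_left: "scale r a * b = scale r (a * b)"
    and scale_mult_right: "a * scale r b = scale r (a * b)"
    and comult_add: "tensor2_eq scale (\<Delta> (a + b)) (\<Delta> a @ \<Delta> b)"
    and comult_scale: "tensor2_eq scale (\<Delta> (scale r a)) (map (\<lambda>(x, y). (scale r x, y)) (\<Delta> a))"
    and comult_mult:
      "tensor2_eq scale (\<Delta> (a * b)) [(x * u, y * v). (x, y) \<leftarrow> \<Delta> a, (u, v) \<leftarrow> \<Delta> b]"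
    and comult_one: "tensor2_eq scale (\<Delta> 1) [(1, 1)]"
    and coassoc:
      "tensor3_eq scale [(u, v, y). (x, y) \<leftarrow> \<Delta> a, (u, v) \<leftarrow> \<Delta> x]
                        [(x, u, v). (x, y) \<leftarrow> \<Delta> a, (u, v) \<leftarrow> \<Delta> y]"
    and counit_linear: "Vector_Spaces.linear scale (*) \<epsilon>"
    and counit_mult: "\<epsilon> (a * b) = \<epsilon> a * \<epsilon> b"
    and counit_one: "\<epsilon> 1 = 1"
    and counit_left: "(\<Sum>(x, y)\<leftarrow>\<Delta> a. scale (\<epsilon> x) y) = a"
    and counit_right: "(\<Sum>(x, y)\<leftarrow>\<Delta> a. scale (\<epsilon> y) x) = a"
    and antipode_linear: "Vector_Spaces.linear scale scale S"
    and antipode_left: "(\<Sum>(x, y)\<leftarrow>\<Delta> a. S x * y) = scale (\<epsilon> a) 1"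
    and antipode_right: "(\<Sum>(x, y)\<leftarrow>\<Delta> a. x * S y) = scale (\<epsilon> a) 1"

definition left_ideal :: "'h::ring_1 set \<Rightarrow> bool" where
  "left_ideal I \<longleftrightarrow>
    0 \<in> I \<and> (\<forall>x\<in>I. \<forall>y\<in>I. x + y \<in> I) \<and> (\<forall>h. \<forall>x\<in>I. h * x \<in> I)"

text \<open>The left regular module is completely reducible.\<close>

definition semisimple_ring :: "'h::ring_1 itself \<Rightarrow> bool" where
  "semisimple_ring _ \<longleftrightarrow>
    (\<forall>I :: 'h set. left_ideal I \<longrightarrow>
      (\<exists>J. left_ideal J \<and> I \<inter> J = {0} \<and> {x + y | x y. x \<in> I \<and> y \<in> J} = UNIV))"

definition dual :: "('k::field \<Rightarrow> 'h::ring_1 \<Rightarrow> 'h) \<Rightarrow> ('h \<Rightarrow> 'k) set" where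
  "dual scale = {p. Vector_Spaces.linear scale (*) p}"

definition dual_mult ::
    "('h \<Rightarrow> ('h \<times> 'h) list) \<Rightarrow> ('h \<Rightarrow> 'k::field) \<Rightarrow> ('h \<Rightarrow> 'k) \<Rightarrow> 'h \<Rightarrow> 'k" where
  "dual_mult \<Delta> p q = (\<lambda>h. \<Sum>(x, y)\<leftarrow>\<Delta> h. p x * q y)"

definition dual_antipode :: "('h \<Rightarrow> 'h) \<Rightarrow> ('h \<Rightarrow> 'k::field) \<Rightarrow> 'h \<Rightarrow> 'k" where
  "dual_antipode S p = (\<lambda>h. p (S h))"

text \<open>\<open>hit_dual a p\<close> is \<open>a \<rightharpoonup> p\<close> in \<open>H\<^sup>*\<close>, and \<open>hit scale \<Delta> p a\<close> is \<open>p \<rightharpoonup> a\<close> in \<open>H\<close>.\<close>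

definition hit_dual :: "'h::ring_1 \<Rightarrow> ('h \<Rightarrow> 'k::field) \<Rightarrow> 'h \<Rightarrow> 'k" where
  "hit_dual a p = (\<lambda>a'. p (a' * a))"

definition hit ::
    "('k::field \<Rightarrow> 'h::ring_1 \<Rightarrow> 'h) \<Rightarrow> ('h \<Rightarrow> ('h \<times> 'h) list) \<Rightarrow> ('h \<Rightarrow> 'k) \<Rightarrow> 'h \<Rightarrow> 'h" where
  "hit scale \<Delta> p a = (\<Sum>(x, y)\<leftarrow>\<Delta> a. scale (p y) x)"

text \<open>
  Since \<open>'k\<close> is a field, \<open>H \<otimes> N\<close> embeds in \<open>H \<otimes> H\<close>; its elements are the classes of formal
  sums whose second tensor factors lie in \<open>N\<close>.
\<close>

definition left_coideal_subalgebra ::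
    "('k::field \<Rightarrow> 'h::ring_1 \<Rightarrow> 'h) \<Rightarrow> ('h \<Rightarrow> ('h \<times> 'h) list) \<Rightarrow> 'h set \<Rightarrow> bool" where
  "left_coideal_subalgebra scale \<Delta> N \<longleftrightarrow>
    Modules.module.subspace scale N \<and> 1 \<in> N \<and> (\<forall>x\<in>N. \<forall>y\<in>N. x * y \<in> N) \<and>
    (\<forall>n\<in>N. \<exists>t. tensor2_eq scale (\<Delta> n) t \<and> snd ` set t \<subseteq> N)"

text \<open>The integral \<open>\<Lambda>\<^sub>N\<close>; idempotence is the special case \<open>n = \<Lambda>\<close>.\<close>

definition integral_of ::
    "('k::field \<Rightarrow> 'h::ring_1 \<Rightarrow> 'h) \<Rightarrow> ('h \<Rightarrow> 'k) \<Rightarrow> 'h set \<Rightarrow> 'h" where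
  "integral_of scale \<epsilon> N =
    (THE \<Lambda>. \<Lambda> \<in> N \<and> (\<forall>n\<in>N. n * \<Lambda> = scale (\<epsilon> n) \<Lambda> \<and> \<Lambda> * n = scale (\<epsilon> n) \<Lambda>) \<and> \<epsilon> \<Lambda> = 1)"

definition dual_invariants ::
    "('k::field \<Rightarrow> 'h::ring_1 \<Rightarrow> 'h) \<Rightarrow> ('h \<Rightarrow> 'k) \<Rightarrow> 'h set \<Rightarrow> ('h \<Rightarrow> 'k) set" where
  "dual_invariants scale \<epsilon> N =
    {p \<in> dual scale. \<forall>n\<in>N. hit_dual n p = (\<lambda>a. \<epsilon> n * p a)}"

text \<open>
  The linear functionals on the subspace \<open>N\<close>; \<open>extensional N\<close> makes each of them a unique
  HOL function.
\<close>

definition subspace_dual ::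
    "('k::field \<Rightarrow> 'h::ring_1 \<Rightarrow> 'h) \<Rightarrow> 'h set \<Rightarrow> ('h \<Rightarrow> 'k) set" where
  "subspace_dual scale N =
    {p \<in> extensional N. (\<forall>x\<in>N. \<forall>y\<in>N. p (x + y) = p x + p y) \<and>
                        (\<forall>r. \<forall>x\<in>N. p (scale r x) = r * p x)}"

definition matrix_rep ::
    "('k::field \<Rightarrow> 'h::ring_1 \<Rightarrow> 'h) \<Rightarrow> nat \<Rightarrow> ('h \<Rightarrow> 'k mat) \<Rightarrow> bool" where
  "matrix_rep scale n \<rho> \<longleftrightarrow>
    (\<forall>a. \<rho> a \<in> carrier_mat n n) \<and> \<rho> 1 = 1\<^sub>m n \<and>
    (\<forall>a b. \<rho> (a * b) = \<rho> a * \<rho> b) \<and> (\<forall>a b. \<rho> (a + b) = \<rho> a + \<rho> b) \<and>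
    (\<forall>r a. \<rho> (scale r a) = r \<cdot>\<^sub>m \<rho> a)"

definition invariant_subspace :: "nat \<Rightarrow> ('h \<Rightarrow> 'k::field mat) \<Rightarrow> 'k vec set \<Rightarrow> bool" where
  "invariant_subspace n \<rho> W \<longleftrightarrow>
    W \<subseteq> carrier_vec n \<and> 0\<^sub>v n \<in> W \<and> (\<forall>v\<in>W. \<forall>w\<in>W. v + w \<in> W) \<and>
    (\<forall>r. \<forall>v\<in>W. r \<cdot>\<^sub>v v \<in> W) \<and> (\<forall>h. \<forall>v\<in>W. \<rho> h *\<^sub>v v \<in> W)"

definition irreducible_rep ::
    "('k::field \<Rightarrow> 'h::ring_1 \<Rightarrow> 'h) \<Rightarrow> nat \<Rightarrow> ('h \<Rightarrow> 'k mat) \<Rightarrow> bool" where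
  "irreducible_rep scale n \<rho> \<longleftrightarrow>
    n > 0 \<and> matrix_rep scale n \<rho> \<and>
    (\<forall>W. invariant_subspace n \<rho> W \<longrightarrow> W = {0\<^sub>v n} \<or> W = carrier_vec n)"

definition irreducible_characters ::
    "('k::field \<Rightarrow> 'h::ring_1 \<Rightarrow> 'h) \<Rightarrow> ('h \<Rightarrow> 'k) set" where
  "irreducible_characters scale =
    {\<chi>. \<exists>n \<rho>. irreducible_rep scale n \<rho> \<and> \<chi> = (\<lambda>h. \<Sum>i<n. \<rho> h $$ (i, i))}"

text \<open>
  For a finite-dimensional semisimple algebra over an algebraically closed field of
  characteristic 0 the index set is finite, and this is the character of the regular
  representation.
\<close>

definition regular_character :: "('k::field \<Rightarrow> 'h::ring_1 \<Rightarrow> 'h) \<Rightarrow> 'h \<Rightarrow> 'k" where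
  "regular_character scale = (\<lambda>h. \<Sum>\<chi>\<in>irreducible_characters scale. \<chi> 1 * \<chi> h)"

end

theory Submission
  imports Defs "HOL-Computational_Algebra.Computational_Algebra"
begin

text \<open>
Let \<open>\<chi>\<close> be the regular character of \<open>H\<close>.  Suppose that \<open>\<chi>\<close> is an integral of \<open>H\<^sup>*\<close> on both sides, is
symmetric and invariant under the antipode, and that \<open>\<Lambda>\<^sub>N\<close> exists.  Then \<open>h \<mapsto> \<lambda>\<^sub>B \<rightharpoonup> h\<close> is a
nonzero multiple \<open>c F\<close> of a linear projection \<open>F\<close> of \<open>H\<close> onto \<open>N\<close>, and \<open>x \<lambda>\<^sub>B = x \<circ> c F\<close> for every
functional \<open>x\<close>.  So \<open>H\<^sup>*\<lambda>\<^sub>B\<close> consists of the functionals that factor through \<open>F\<close>, and these are also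
the values of \<open>\<gamma>\<close>, because functionals on \<open>N\<close> extend to \<open>H\<close> along \<open>F\<close>.  For the third description,
coassociativity and \<open>\<lambda>\<^sub>B \<circ> S = \<lambda>\<^sub>B\<close> give
\<open>\<Sum> h\<^sub>1 y (F (S h\<^sub>2)) = \<Sum> F h\<^sub>1 y (S h\<^sub>2) \<in> N\<close>; conversely, if \<open>\<Sum> h\<^sub>1 x (S h\<^sub>2)\<close> lies in \<open>N\<close>, then \<open>F\<close>
fixes it, and applying \<open>\<epsilon>\<close> yields \<open>x = x \<circ> F\<close>
(\<open>antipode_hit_proj\<close>, \<open>proj_of_antipode_hit\<close>).

The substance lies in the two suppositions.  For \<open>N = k 1\<close> the statement entails that the
regular character is an integral of \<open>H\<^sup>*\<close>, so it contains the theorems of Larson and Radford: over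
a field of characteristic \<open>0\<close>, a semisimple Hopf algebra is cosemisimple and \<open>S\<^sup>2 = id\<close>.

A complement of the left ideal \<open>ker \<epsilon>\<close> is spanned by an integral \<open>\<Lambda>\<close> with \<open>\<epsilon> \<Lambda> = 1\<close>.  The identity
\<open>S h \<Lambda>\<^sub>1 \<otimes> \<Lambda>\<^sub>2 = \<Lambda>\<^sub>1 \<otimes> h \<Lambda>\<^sub>2\<close> shows that the second legs of \<open>\<Delta> \<Lambda>\<close> span \<open>H\<close>, so \<open>H\<close> is finite
dimensional, and that \<open>\<lambda>\<^sub>0 x = tr (y \<mapsto> S (S y) x)\<close> satisfies \<open>\<Sum> \<lambda>\<^sub>0 (\<Lambda>\<^sub>1) \<Lambda>\<^sub>2 = 1\<close>.  Hence \<open>\<lambda>\<^sub>0\<close> is a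
nondegenerate right integral of \<open>H\<^sup>*\<close>, its Nakayama automorphism is \<open>S\<^sup>2\<close>, and \<open>S\<^sup>4\<close> is conjugation
by the modular grouplike element, which has finite order.

The regular character is a second nondegenerate form, and a symmetric one; comparing it with \<open>\<lambda>\<^sub>0\<close>
makes \<open>S\<^sup>2\<close> inner, \<open>S\<^sup>2 = Ad v\<close>.  Choose a complete set of primitive idempotents that are
eigenvectors of \<open>v\<close>, with eigenvalues \<open>w\<^sub>i\<close>, and the corresponding matrix units.  Then
\<open>\<lambda>\<^sub>0 1 = tr S\<^sup>2 = \<Sum> w\<^sub>i / w\<^sub>j\<close>, summed over all pairs \<open>(i, j)\<close> in a common block, where the ratios are
roots of unity.  If the sum vanished, then so would the same sum for some complex roots of unity,
which however is \<open>\<Sum> |\<Sum> u\<^sub>i|\<^sup>2\<close> with one summand equal to \<open>1\<close> for the trivial representation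
(\<open>sum_ratios_nonzero\<close>).  So \<open>\<lambda>\<^sub>0 1 \<noteq> 0\<close>, the left and the right integrals of \<open>H\<^sup>*\<close> agree, and
\<open>S\<^sup>4 = id\<close>.

Finally \<open>e = \<chi> / dim H\<close> is an idempotent of \<open>H\<^sup>*\<close>, and the involution \<open>S\<^sup>2\<close>, restricted to the image of
the idempotent operator given by \<open>e \<circ> S\<close>, has trace \<open>\<lambda>\<^sub>0 1 / dim H = tr S\<^sup>2 / dim H\<close>.  This is a
nonzero integer of absolute value at most \<open>1\<close>, and \<open>S\<^sup>2\<close> fixes \<open>1\<close>, so \<open>S\<^sup>2 = id\<close>
(\<open>S2_id\<close>) and \<open>\<lambda>\<^sub>0 = \<chi>\<close>.

For a left coideal subalgebra \<open>N\<close>, the form \<open>\<chi> (m n)\<close> is nondegenerate on \<open>N\<close>: its radical would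
otherwise contain an idempotent of nonzero trace (\<open>N_nondegenerate\<close>).  The element of \<open>N\<close> that
represents \<open>\<epsilon>\<close> is a multiple of \<open>\<Lambda>\<^sub>N\<close>.
\<close>

section \<open>Sweedler calculus\<close>

context hopf_algebra
begin

text \<open>The Sweedler sum \<open>\<Sum> f a\<^sub>1 a\<^sub>2\<close>.  It depends only on the class of \<open>\<Delta> a\<close> in \<open>H \<otimes> H\<close> as soon as \<open>f\<close> is
balanced in the following sense.\<close>

definition sw :: "('h \<Rightarrow> 'h \<Rightarrow> 'b::comm_monoid_add) \<Rightarrow> 'h \<Rightarrow> 'b" where
  "sw f a = (\<Sum>(x, y)\<leftarrow>\<Delta> a. f x y)"

definition additive :: "('h \<Rightarrow> 'b::ab_group_add) \<Rightarrow> bool" where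
  "additive F \<longleftrightarrow> (\<forall>a b. F (a + b) = F a + F b)"

text \<open>The maps that descend to \<open>H \<otimes> H\<close> and to \<open>H \<otimes> H \<otimes> H\<close>.  Homogeneity is expressed by moving a scalar
between the arguments, so that the values may lie in any abelian group and one set of rules
serves the sums with values in \<open>H\<close> and those with values in the field.\<close>

definition bal2 :: "('h \<Rightarrow> 'h \<Rightarrow> 'b::ab_group_add) \<Rightarrow> bool" where
  "bal2 f \<longleftrightarrow> (\<forall>a a' b. f (a + a') b = f a b + f a' b) \<and>
     (\<forall>a b b'. f a (b + b') = f a b + f a b') \<and>
     (\<forall>r a b. f (scale r a) b = f a (scale r b))"

definition bal3 :: "('h \<Rightarrow> 'h \<Rightarrow> 'h \<Rightarrow> 'b::ab_group_add) \<Rightarrow> bool" where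
  "bal3 f \<longleftrightarrow> (\<forall>c. bal2 (\<lambda>a b. f a b c)) \<and> (\<forall>a. bal2 (f a))"

text \<open>The first argument is simplified with the second one abstracted, because the simplifier
  presents \<open>\<lambda>y. f x y\<close> as \<open>f x\<close>.\<close>

lemma bal2_simps:
  assumes "bal2 f"
  shows "f (a + a') = (\<lambda>b. f a b + f a' b)" "f a (b + b') = f a b + f a b'"
    "f (scale r a) = (\<lambda>b. f a (scale r b))"
  using assms by (auto simp: bal2_def)

lemma bal2_zero_left: "bal2 f \<Longrightarrow> f 0 b = 0"
  by (metis add_cancel_right_right add.right_neutral bal2_def)

lemma tensor2_eval:
  assumes "tensor2_eq scale t u" "bal2 f"
  shows "(\<Sum>(x, y)\<leftarrow>t. f x y) = (\<Sum>(x, y)\<leftarrow>u. f x y)"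
  using assms
  by (induction rule: tensor2_eq.induct) (auto simp: bal2_zero_left add.commute, auto simp: bal2_def)

lemma tensor3_eval:
  assumes "tensor3_eq scale t u" "bal3 f"
  shows "(\<Sum>(x, y, z)\<leftarrow>t. f x y z) = (\<Sum>(x, y, z)\<leftarrow>u. f x y z)"
proof -
  have "f 0 b c = 0" for b c
    using bal2_zero_left[of "\<lambda>a b. f a b c"] assms(2) by (simp add: bal3_def)
  with assms show ?thesis
    by (induction rule: tensor3_eq.induct) (auto simp: add.commute, auto simp: bal3_def bal2_def)
qed

lemma sum_list_concat_map:
  "sum_list (map g (concat (map f xs))) = (\<Sum>x\<leftarrow>xs. sum_list (map g (f x)))"
  for g :: "'x \<Rightarrow> 'b::comm_monoid_add"
  by (induction xs) auto

lemma sw_add: "bal2 f \<Longrightarrow> sw f (a + b) = sw f a + sw f b"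
  unfolding sw_def using tensor2_eval[OF comult_add] by simp

lemma sw_scale: "bal2 f \<Longrightarrow> sw f (scale r a) = sw (\<lambda>x y. f (scale r x) y) a"
  unfolding sw_def using tensor2_eval[OF comult_scale, of f]
  by (simp add: comp_def case_prod_unfold)

lemma sw_mult: "bal2 f \<Longrightarrow> sw f (a * b) = sw (\<lambda>x y. sw (\<lambda>u v. f (x * u) (y * v)) b) a"
  unfolding sw_def using tensor2_eval[OF comult_mult, of f a b]
  by (simp add: comp_def case_prod_unfold sum_list_concat_map)

lemma sw_one: "bal2 f \<Longrightarrow> sw f 1 = f 1 1"
  unfolding sw_def using tensor2_eval[OF comult_one, of f] by simp

lemma sw_coassoc:
  "bal3 f \<Longrightarrow> sw (\<lambda>x y. sw (\<lambda>u v. f u v y) x) a = sw (\<lambda>x y. sw (\<lambda>u v. f x u v) y) a"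
  unfolding sw_def using tensor3_eval[OF coassoc, of f a]
  by (simp add: comp_def case_prod_unfold sum_list_concat_map)

lemma sw_swap:
  fixes f :: "'h \<Rightarrow> 'h \<Rightarrow> 'h \<Rightarrow> 'h \<Rightarrow> 'b::comm_monoid_add"
  shows "sw (\<lambda>x y. sw (\<lambda>u v. f x y u v) b) a = sw (\<lambda>u v. sw (\<lambda>x y. f x y u v) a) b"
proof -
  have "(\<Sum>x\<leftarrow>xs. \<Sum>y\<leftarrow>ys. g x y) = (\<Sum>y\<leftarrow>ys. \<Sum>x\<leftarrow>xs. g x y)"
    for g :: "_ \<Rightarrow> _ \<Rightarrow> 'b" and xs ys
    by (induction xs) (auto simp: sum_list_addf)
  then show ?thesis by (simp add: sw_def case_prod_unfold)
qed

lemma sw_addf: "sw (\<lambda>x y. f x y + g x y) a = sw f a + sw g a"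
  by (simp add: sw_def case_prod_unfold sum_list_addf)

lemma sw_comp: "additive F \<Longrightarrow> F (sw f a) = sw (\<lambda>x y. F (f x y)) a"
proof -
  assume F: "additive F"
  then have "F 0 = 0" by (metis additive_def add_cancel_right_right add.right_neutral)
  with F have "F (sum_list (map g xs)) = (\<Sum>x\<leftarrow>xs. F (g x))" for g :: "('h \<times> 'h) \<Rightarrow> 'h" and xs
    by (induction xs) (auto simp: additive_def)
  then show ?thesis by (simp add: sw_def case_prod_unfold)
qed

lemma sw_scalef: "sw (\<lambda>x y. scale r (f x y)) a = scale r (sw f a)"
  by (rule sw_comp[symmetric]) (simp add: additive_def scale_right_distrib)

lemma sw_mult_leftf: "sw (\<lambda>x y. c * f x y) a = c * sw f a" for c :: "'c::ring"
  by (simp add: sw_def case_prod_unfold sum_list_const_mult)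

lemma sw_mult_rightf: "sw (\<lambda>x y. f x y * c) a = sw f a * c" for c :: "'c::ring"
  by (simp add: sw_def case_prod_unfold sum_list_mult_const)

lemma sw_scale_leftf: "sw (\<lambda>x y. scale (f x y) b) a = scale (sw f a) b"
proof -
  have "(\<Sum>x\<leftarrow>xs. scale (g x) b) = scale (sum_list (map g xs)) b" for g :: "'h \<times> 'h \<Rightarrow> 'k" and xs
    by (induction xs) (auto simp: scale_left_distrib)
  then show ?thesis by (simp add: sw_def case_prod_unfold)
qed

lemma hit_eq: "hit scale \<Delta> p h = sw (\<lambda>x y. scale (p y) x) h"
  by (simp add: hit_def sw_def)

lemma sw_cong: "(\<And>x y. f x y = g x y) \<Longrightarrow> sw f a = sw g a"
  by presburger

lemma S_add: "S (a + b) = S a + S b"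
  using antipode_linear by (simp add: Vector_Spaces.linear_iff)

lemma S_scale: "S (scale r a) = scale r (S a)"
  using antipode_linear by (simp add: Vector_Spaces.linear_iff)

lemma eps_add: "\<epsilon> (a + b) = \<epsilon> a + \<epsilon> b"
  using counit_linear by (simp add: Vector_Spaces.linear_iff)

lemma eps_scale: "\<epsilon> (scale r a) = r * \<epsilon> a"
  using counit_linear by (simp add: Vector_Spaces.linear_iff)

text \<open>Normal form: scalars are moved outwards and collected in front of each term.\<close>

lemmas lin_simps = S_add S_scale eps_add eps_scale scale_mult_left scale_mult_right scale_right_distrib
  scale_left_distrib distrib_left distrib_right counit_mult counit_one
  mult.left_commute[where ?'a='k] mult.commute[where ?'a='k] mult.assoc[where ?'a='k]

lemmas sw_simps = additive_def bal3_def bal2_def sw_add sw_scale sw_addf sw_scalef sw_mult_leftf sw_mult_rightf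
   sw_scale_leftf lin_simps

lemma sw_counit_left: "additive F \<Longrightarrow> sw (\<lambda>x y. F (scale (\<epsilon> x) y)) a = F a"
  using counit_left[of a] sw_comp[of F "\<lambda>x y. scale (\<epsilon> x) y" a] by (simp add: sw_def)

lemma sw_counit_right: "additive F \<Longrightarrow> sw (\<lambda>x y. F (scale (\<epsilon> y) x)) a = F a"
  using counit_right[of a] sw_comp[of F "\<lambda>x y. scale (\<epsilon> y) x" a] by (simp add: sw_def)

lemma sw_antipode_left: "additive F \<Longrightarrow> sw (\<lambda>x y. F (S x * y)) a = F (scale (\<epsilon> a) 1)"
  using antipode_left[of a] sw_comp[of F "\<lambda>x y. S x * y" a] by (simp add: sw_def)

lemma sw_antipode_right: "additive F \<Longrightarrow> sw (\<lambda>x y. F (x * S y)) a = F (scale (\<epsilon> a) 1)"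
  using antipode_right[of a] sw_comp[of F "\<lambda>x y. x * S y" a] by (simp add: sw_def)

text \<open>Both sides are convolution inverses of the multiplication \<open>H \<otimes> H \<rightarrow> H\<close>; the two ways of
evaluating \<open>\<Sum> S (a\<^sub>1 b\<^sub>1) a\<^sub>2 b\<^sub>2 S b\<^sub>3 S a\<^sub>3\<close> connect them.\<close>

lemma S_mult: "S (a * b) = S b * S a"
proof -
  have "S b * S a = sw (\<lambda>x y. S b * S (scale (\<epsilon> x) y)) a"
    by (rule sw_counit_left[symmetric]) (simp add: sw_simps)
  also have "\<dots> = sw (\<lambda>x y. sw (\<lambda>u v. S (scale (\<epsilon> u) v) * S (scale (\<epsilon> x) y)) b) a"
    by (intro sw_cong sw_counit_left[symmetric]) (simp add: sw_simps)
  also have "\<dots> = sw (\<lambda>x y. sw (\<lambda>u v. scale (\<epsilon> (x * u)) 1 * S v * S y) b) a"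
    by (simp add: sw_simps)
  also have "\<dots> = sw (\<lambda>x y. sw (\<lambda>u v. sw (\<lambda>p q. S p * q * S v * S y) (x * u)) b) a"
    by (intro sw_cong sw_antipode_left[symmetric]) (simp add: sw_simps)
  also have "\<dots> = sw (\<lambda>x y. sw (\<lambda>u v. sw (\<lambda>x1 x2. sw (\<lambda>u1 u2. S (x1 * u1) * (x2 * u2) * S v * S y) u) x) b) a"
    by (intro sw_cong sw_mult) (simp add: sw_simps)
  also have "\<dots> = sw (\<lambda>x y. sw (\<lambda>x1 x2. sw (\<lambda>u v. sw (\<lambda>u1 u2. S (x1 * u1) * (x2 * u2) * S v * S y) u) b) x) a"
    by (intro sw_cong sw_swap)
  also have "\<dots> = sw (\<lambda>x y. sw (\<lambda>x1 x2. sw (\<lambda>u v. sw (\<lambda>u1 u2. S (x1 * u) * (x2 * u1) * S u2 * S y) v) b) x) a"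
    by (intro sw_cong sw_coassoc) (simp add: sw_simps)
  also have "\<dots> = sw (\<lambda>x y. sw (\<lambda>x1 x2. sw (\<lambda>u v. sw (\<lambda>u1 u2. S (x1 * u) * x2 * (u1 * S u2) * S y) v) b) x) a"
    by (simp add: mult.assoc)
  also have "\<dots> = sw (\<lambda>x y. sw (\<lambda>x1 x2. sw (\<lambda>u v. S (x1 * u) * x2 * scale (\<epsilon> v) 1 * S y) b) x) a"
    by (intro sw_cong sw_antipode_right) (simp add: sw_simps)
  also have "\<dots> = sw (\<lambda>x y. sw (\<lambda>x1 x2. sw (\<lambda>u v. S (x1 * scale (\<epsilon> v) u) * x2 * S y) b) x) a"
    by (simp add: sw_simps)
  also have "\<dots> = sw (\<lambda>x y. sw (\<lambda>x1 x2. S (x1 * b) * x2 * S y) x) a"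
    by (intro sw_cong sw_counit_right) (simp add: sw_simps)
  also have "\<dots> = sw (\<lambda>x y. sw (\<lambda>x1 x2. S (x * b) * x1 * S x2) y) a"
    by (intro sw_cong sw_coassoc) (simp add: sw_simps)
  also have "\<dots> = sw (\<lambda>x y. S (x * b) * scale (\<epsilon> y) 1) a"
    unfolding mult.assoc[of "S _"] by (intro sw_cong sw_antipode_right) (simp add: sw_simps)
  also have "\<dots> = sw (\<lambda>x y. S (scale (\<epsilon> y) x * b)) a"
    by (simp add: sw_simps)
  also have "\<dots> = S (a * b)"
    by (rule sw_counit_right) (simp add: sw_simps)
  finally show ?thesis by simp
qed

lemma S_one: "S 1 = 1"
proof -
  have "sw (\<lambda>x y. S x * y) 1 = S 1 * 1"
    by (rule sw_one) (simp add: sw_simps)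
  then show ?thesis using sw_antipode_left[of "\<lambda>x. x" 1] by (simp add: sw_simps)
qed

lemma eps_S: "\<epsilon> (S a) = \<epsilon> a"
proof -
  have "\<epsilon> (S a) = sw (\<lambda>x y. \<epsilon> (S (scale (\<epsilon> y) x))) a"
    by (rule sw_counit_right[symmetric]) (simp add: sw_simps)
  also have "\<dots> = sw (\<lambda>x y. \<epsilon> (S x * y)) a"
    by (simp add: sw_simps mult.commute)
  also have "\<dots> = \<epsilon> (scale (\<epsilon> a) 1)"
    by (rule sw_antipode_left) (simp add: sw_simps)
  finally show ?thesis by (simp add: sw_simps)
qed

text \<open>The collapse of \<open>a\<^sub>1 S a\<^sub>4 \<otimes> a\<^sub>2 S a\<^sub>3\<close>, used in the proof that the antipode reverses \<open>\<Delta>\<close>.\<close>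

lemma sw_nested_antipode:
  fixes f :: "'h \<Rightarrow> 'h \<Rightarrow> 'b::ab_group_add"
  assumes f: "bal2 f"
  shows "sw (\<lambda>x y. sw (\<lambda>r s. sw (\<lambda>u v. f (r * S v) (s * S u)) y) x) a = f 1 (scale (\<epsilon> a) 1)"
proof -
  note fl = bal2_simps[OF f]
  have "sw (\<lambda>x y. sw (\<lambda>r s. sw (\<lambda>u v. f (r * S v) (s * S u)) y) x) a
      = sw (\<lambda>r t. sw (\<lambda>s y. sw (\<lambda>u v. f (r * S v) (s * S u)) y) t) a"
    by (intro sw_coassoc) (simp add: sw_simps fl)
  also have "\<dots> = sw (\<lambda>r t. sw (\<lambda>x v. sw (\<lambda>s u. f (r * S v) (s * S u)) x) t) a"
    by (intro sw_cong sw_coassoc[symmetric]) (simp add: sw_simps fl)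
  also have "\<dots> = sw (\<lambda>r t. sw (\<lambda>x v. f (r * S v) (scale (\<epsilon> x) 1)) t) a"
    by (intro sw_cong sw_antipode_right) (simp add: sw_simps fl)
  also have "\<dots> = sw (\<lambda>r t. sw (\<lambda>x v. f (r * S (scale (\<epsilon> x) v)) 1) t) a"
    by (simp add: sw_simps fl)
  also have "\<dots> = sw (\<lambda>r t. f (r * S t) 1) a"
    by (intro sw_cong sw_counit_left) (simp add: sw_simps fl)
  also have "\<dots> = f (scale (\<epsilon> a) 1) 1"
    by (intro sw_antipode_right) (simp add: sw_simps fl)
  finally show ?thesis by (simp add: fl)
qed

text \<open>\<open>\<Delta> (S a)\<close> and \<open>S a\<^sub>2 \<otimes> S a\<^sub>1\<close> are both convolution inverses
of \<open>\<Delta>\<close>, and \<open>\<Delta> (S a\<^sub>1) \<Delta> a\<^sub>2 (S a\<^sub>4 \<otimes> S a\<^sub>3)\<close> reduces to either of them.\<close>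

lemma sw_S:
  fixes f :: "'h \<Rightarrow> 'h \<Rightarrow> 'b::ab_group_add"
  assumes f: "bal2 f"
  shows "sw f (S a) = sw (\<lambda>x y. f (S y) (S x)) a"
proof -
  note fl = bal2_simps[OF f]
  have "sw (\<lambda>x y. f (S y) (S x)) a
      = sw (\<lambda>x y. sw (\<lambda>u v. f (S v) (S u)) (scale (\<epsilon> x) y)) a"
    by (rule sw_counit_left[symmetric]) (simp add: sw_simps fl)
  also have "\<dots> = sw (\<lambda>x y. sw (\<lambda>u v. sw (\<lambda>p q. f (p * S v) (q * S u)) (scale (\<epsilon> x) 1)) y) a"
  proof -
    have "sw (\<lambda>p q. f (p * c) (q * d)) (scale r 1) = f c (scale r d)" for r c d
    proof -
      have "sw (\<lambda>p q. f (p * c) (q * d)) (scale r 1) = sw (\<lambda>p q. f (p * c) (q * scale r d)) 1"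
        by (simp add: sw_simps fl)
      also have "\<dots> = f (1 * c) (1 * scale r d)"
        by (rule sw_one) (simp add: sw_simps fl)
      finally show ?thesis by simp
    qed
    moreover have "sw (\<lambda>u v. f (S v) (S u)) (scale r y) = sw (\<lambda>u v. f (S v) (scale r (S u))) y" for r y
      by (simp add: sw_simps fl)
    ultimately show ?thesis by (simp only:)
  qed
  also have "\<dots> = sw (\<lambda>x y. sw (\<lambda>u v. sw (\<lambda>x1 x2. sw (\<lambda>p q. f (p * S v) (q * S u)) (S x1 * x2)) x) y) a"
    by (intro sw_cong sw_antipode_left[symmetric]) (simp add: sw_simps fl)
  also have "\<dots> = sw (\<lambda>x y. sw (\<lambda>x1 x2. sw (\<lambda>u v. sw (\<lambda>p q. f (p * S v) (q * S u)) (S x1 * x2)) y) x) a"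
    by (intro sw_cong sw_swap)
  also have "\<dots> = sw (\<lambda>x y. sw (\<lambda>y1 y2. sw (\<lambda>u v. sw (\<lambda>p q. f (p * S v) (q * S u)) (S x * y1)) y2) y) a"
    by (intro sw_coassoc) (simp add: sw_simps fl)
  also have "\<dots> = sw (\<lambda>x y. sw (\<lambda>y1 y2. sw (\<lambda>u v. sw (\<lambda>p q. sw (\<lambda>r s. f (p * r * S v) (q * s * S u)) y1) (S x)) y2) y) a"
    by (intro sw_cong sw_mult) (simp add: sw_simps fl)
  also have "\<dots> = sw (\<lambda>x y. sw (\<lambda>y1 y2. sw (\<lambda>p q. sw (\<lambda>u v. sw (\<lambda>r s. f (p * (r * S v)) (q * (s * S u))) y1) y2) (S x)) y) a"
    unfolding mult.assoc by (intro sw_cong sw_swap)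
  also have "\<dots> = sw (\<lambda>x y. sw (\<lambda>p q. sw (\<lambda>y1 y2. sw (\<lambda>u v. sw (\<lambda>r s. f (p * (r * S v)) (q * (s * S u))) y1) y2) y) (S x)) a"
    by (intro sw_cong sw_swap)
  also have "\<dots> = sw (\<lambda>x y. sw (\<lambda>p q. sw (\<lambda>y1 y2. sw (\<lambda>r s. sw (\<lambda>u v. f (p * (r * S v)) (q * (s * S u))) y2) y1) y) (S x)) a"
    by (intro sw_cong sw_swap)
  also have "\<dots> = sw (\<lambda>x y. sw (\<lambda>p q. f (p * 1) (q * scale (\<epsilon> y) 1)) (S x)) a"
    by (intro sw_cong sw_nested_antipode) (simp add: sw_simps fl)
  also have "\<dots> = sw (\<lambda>x y. sw f (S (scale (\<epsilon> y) x))) a"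
    by (simp add: sw_simps fl f)
  also have "\<dots> = sw f (S a)"
    by (intro sw_counit_right) (simp add: sw_simps fl f)
  finally show ?thesis by simp
qed

end

section \<open>Integrals and finite dimension\<close>

context hopf_algebra
begin

definition functional :: "('h \<Rightarrow> 'k) \<Rightarrow> bool" where
  "functional p \<longleftrightarrow> (\<forall>x y. p (x + y) = p x + p y) \<and> (\<forall>r x. p (scale r x) = r * p x)"

definition endo :: "('h \<Rightarrow> 'h) \<Rightarrow> bool" where
  "endo F \<longleftrightarrow> (\<forall>x y. F (x + y) = F x + F y) \<and> (\<forall>r x. F (scale r x) = scale r (F x))"

lemma functional_add: "functional p \<Longrightarrow> p (x + y) = p x + p y"
  and functional_scale: "functional p \<Longrightarrow> p (scale r x) = r * p x"
  by (auto simp: functional_def)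

lemmas functional_simps = functional_add functional_scale

lemma endo_add: "endo F \<Longrightarrow> F (x + y) = F x + F y"
  and endo_scale: "endo F \<Longrightarrow> F (scale r x) = scale r (F x)"
  by (auto simp: endo_def)

lemma functional_zero: "functional p \<Longrightarrow> p 0 = 0"
  using functional_scale[of p 0 0] by simp

lemma endo_zero: "endo F \<Longrightarrow> F 0 = 0"
  using endo_scale[of F 0 0] by simp

lemma functional_diff: "functional p \<Longrightarrow> p (x - y) = p x - p y"
  using functional_add[of p "x - y" y] by (simp add: algebra_simps)

lemma endo_diff: "endo F \<Longrightarrow> F (x - y) = F x - F y"
  using endo_add[of F "x - y" y] by (simp add: algebra_simps)

lemma functional_sum: "functional p \<Longrightarrow> p (sum g A) = (\<Sum>x\<in>A. p (g x))"
  by (induction A rule: infinite_finite_induct) (auto simp: functional_zero functional_add)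

lemma endo_sum: "endo F \<Longrightarrow> F (sum g A) = (\<Sum>x\<in>A. F (g x))"
  by (induction A rule: infinite_finite_induct) (auto simp: endo_zero endo_add)

lemma dual_eq: "dual scale = {p. functional p}"
proof -
  have "vector_space ((*) :: 'k \<Rightarrow> 'k \<Rightarrow> 'k)"
    by unfold_locales (auto simp: algebra_simps)
  then show ?thesis
    using vector_space_axioms by (auto simp: dual_def Vector_Spaces.linear_iff functional_def)
qed

lemma endo_iff_linear: "endo F \<longleftrightarrow> Vector_Spaces.linear scale scale F"
  using vector_space_axioms by (auto simp: endo_def Vector_Spaces.linear_iff)

lemma functional_eps: "functional \<epsilon>" and endo_S: "endo S"
  by (auto simp: functional_def endo_def sw_simps)

lemma eps_zero: "\<epsilon> 0 = 0" and S_zero: "S 0 = 0"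
  using functional_zero[OF functional_eps] endo_zero[OF endo_S] by auto

lemma scale_one_mult: "scale r 1 * a = scale r a"
  by (simp add: scale_mult_left)

lemma left_ideal_scale: "left_ideal I \<Longrightarrow> x \<in> I \<Longrightarrow> scale r x \<in> I"
  using scale_one_mult[of r x] by (metis left_ideal_def)

lemma left_ideal_minus: "left_ideal I \<Longrightarrow> x \<in> I \<Longrightarrow> y \<in> I \<Longrightarrow> x - y \<in> I" for x y :: 'h
  using left_ideal_scale[of I y "- 1"] unfolding left_ideal_def
  by (metis (no_types) add_uminus_conv_diff scale_minus_left scale_one)

lemma left_ideal_subspace: "left_ideal I \<Longrightarrow> subspace I"
  using left_ideal_scale[of I] by (auto simp: subspace_def left_ideal_def)

lemma sw_cong_set: "(\<And>x y. (x, y) \<in> set (\<Delta> a) \<Longrightarrow> f x y = g x y) \<Longrightarrow> sw f a = sw g a"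
  unfolding sw_def by (rule arg_cong[of _ _ sum_list], rule map_cong) auto

lemma sw_sum:
  fixes g :: "'i \<Rightarrow> 'h \<Rightarrow> 'h \<Rightarrow> 'd::comm_monoid_add"
  shows "sw (\<lambda>x y. \<Sum>i\<in>A. g i x y) a = (\<Sum>i\<in>A. sw (g i) a)"
proof -
  have "(\<Sum>z\<leftarrow>zs. \<Sum>i\<in>A. h i z) = (\<Sum>i\<in>A. sum_list (map (h i) zs))" for h :: "_ \<Rightarrow> _ \<Rightarrow> 'd" and zs
    by (induction zs) (auto simp: sum.distrib)
  then show ?thesis by (simp add: sw_def case_prod_unfold)
qed

lemma sw_zero: "sw (\<lambda>x y. 0) a = 0"
  by (simp add: sw_def case_prod_unfold)

end

locale semisimple_hopf_algebra = hopf_algebra scale \<Delta> \<epsilon> S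
  for scale :: "'k::{alg_closed_field, field_char_0} \<Rightarrow> 'h::ring_1 \<Rightarrow> 'h"
    and \<Delta> \<epsilon> S +
  assumes semisimple: "semisimple_ring TYPE('h)"
begin

text \<open>The component \<open>e\<close> of \<open>1\<close> in \<open>I\<close> is an idempotent generator, since \<open>x - x e\<close> lies in the complement.\<close>

lemma left_ideal_complement:
  fixes I :: "'h set"
  assumes "left_ideal I"
  obtains e where "e \<in> I" "\<And>x. x \<in> I \<Longrightarrow> x * e = x"
proof -
  obtain J where J: "left_ideal J" "I \<inter> J = {0}" "{x + y | x y. x \<in> I \<and> y \<in> J} = UNIV"
    using semisimple[unfolded semisimple_ring_def, rule_format, OF assms] by (elim exE conjE) (rule that)
  have "1 \<in> {x + y | x y. x \<in> I \<and> y \<in> J}"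
    using J(3) by simp
  then obtain e j where e: "e \<in> I" "j \<in> J" "1 = e + j" by blast
  have "x * e = x" if x: "x \<in> I" for x
  proof -
    have "x * j = x - x * e"
      using distrib_left[of x e j, folded e(3)] by (simp add: algebra_simps)
    also have "\<dots> \<in> I"
      using x e assms by (intro left_ideal_minus) (auto simp: left_ideal_def)
    finally have "x * j \<in> I \<inter> J"
      using e(2) J(1) by (auto simp: left_ideal_def)
    then have "x * j = 0" using J by auto
    then show ?thesis using distrib_left[of x e j, folded e(3)] by simp
  qed
  with e show ?thesis using that by blast
qed

text \<open>The component \<open>L\<close> of \<open>1\<close> in a complement \<open>J\<close> of \<open>ker \<epsilon>\<close>: the element \<open>h L - \<epsilon> h L\<close> lies in both.\<close>

lemma ex_left_integral: "\<exists>L. \<epsilon> L = 1 \<and> (\<forall>h. h * L = scale (\<epsilon> h) L)"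
proof -
  have I: "left_ideal {x. \<epsilon> x = 0}"
    by (auto simp: left_ideal_def eps_zero lin_simps)
  obtain J where J: "left_ideal J" "{x. \<epsilon> x = 0} \<inter> J = {0}"
      "{x + y | x y. x \<in> {x. \<epsilon> x = 0} \<and> y \<in> J} = UNIV"
    using semisimple[unfolded semisimple_ring_def, rule_format, OF I] by (elim exE conjE) (rule that)
  have "1 \<in> {x + y | x y. x \<in> {x. \<epsilon> x = 0} \<and> y \<in> J}"
    unfolding J(3) by simp
  then obtain x L where x: "\<epsilon> x = 0" "L \<in> J" "1 = x + L" by blast
  have eL: "\<epsilon> L = 1"
    using counit_one eps_add[of x L] x by simp
  have "h * L = scale (\<epsilon> h) L" for h
  proof -
    have "h * L - scale (\<epsilon> h) L \<in> J"
      using x(2) J(1) by (intro left_ideal_minus left_ideal_scale) (auto simp: left_ideal_def)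
    moreover have "\<epsilon> (h * L - scale (\<epsilon> h) L) = 0"
      by (simp add: functional_diff[OF functional_eps] lin_simps eL)
    ultimately have "h * L - scale (\<epsilon> h) L = 0" using J(2) by blast
    then show ?thesis by simp
  qed
  with eL show ?thesis by blast
qed

definition Lam :: 'h where
  "Lam = (SOME L. \<epsilon> L = 1 \<and> (\<forall>h. h * L = scale (\<epsilon> h) L))"

lemma eps_Lam: "\<epsilon> Lam = 1" and left_Lam: "h * Lam = scale (\<epsilon> h) Lam"
  using someI_ex[OF ex_left_integral, folded Lam_def] by auto

text \<open>The left integrals with \<open>\<epsilon> = 0\<close> form a left ideal \<open>T\<close> with \<open>T T = 0\<close>, so \<open>T = 0\<close> by semisimplicity,
and \<open>\<Lambda> h - \<epsilon> h \<Lambda>\<close> belongs to \<open>T\<close>.\<close>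

lemma right_Lam: "Lam * h = scale (\<epsilon> h) Lam"
proof -
  define T where "T = {t. \<epsilon> t = 0 \<and> (\<forall>h. h * t = scale (\<epsilon> h) t)}"
  have T: "left_ideal T"
    by (auto simp: left_ideal_def T_def eps_zero lin_simps) (simp add: mult.assoc[symmetric] lin_simps)?
  then obtain e where e: "e \<in> T" "\<And>x. x \<in> T \<Longrightarrow> x * e = x" by (rule left_ideal_complement) blast
  have T0: "x = 0" if "x \<in> T" for x
    using e(2)[OF that] e(1) that by (auto simp: T_def)
  have "Lam * h - scale (\<epsilon> h) Lam \<in> T"
    by (auto simp: T_def functional_diff[OF functional_eps] lin_simps eps_Lam right_diff_distrib left_Lam
        mult.assoc[symmetric] scale_right_diff_distrib)
  then show ?thesis using T0 by fastforce
qed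

text \<open>The identity \<open>S h \<Lambda>\<^sub>1 \<otimes> \<Lambda>\<^sub>2 = \<Lambda>\<^sub>1 \<otimes> h \<Lambda>\<^sub>2\<close>: both sides are \<open>\<Sum> S h\<^sub>1 h\<^sub>2 \<Lambda>\<^sub>1 \<otimes> h\<^sub>3 \<Lambda>\<^sub>2\<close>, where \<open>h\<^sub>2 \<otimes> h\<^sub>3\<close>
multiplies \<open>\<Delta> \<Lambda>\<close> as \<open>\<Delta>\<close> of a single factor.\<close>

lemma Lam_move_left:
  fixes f :: "'h \<Rightarrow> 'h \<Rightarrow> 'b::ab_group_add"
  assumes f: "bal2 f"
  shows "sw (\<lambda>x y. f (S h * x) y) Lam = sw (\<lambda>x y. f x (h * y)) Lam"
proof -
  note fl = bal2_simps[OF f]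
  have "sw (\<lambda>x y. f x (h * y)) Lam = sw (\<lambda>u v. sw (\<lambda>x y. f x (scale (\<epsilon> u) v * y)) Lam) h"
    by (rule sw_counit_left[symmetric]) (simp add: sw_simps fl)
  also have "\<dots> = sw (\<lambda>u v. sw (\<lambda>x y. f (scale (\<epsilon> u) 1 * x) (v * y)) Lam) h"
    by (simp add: sw_simps fl)
  also have "\<dots> = sw (\<lambda>u v. sw (\<lambda>a b. sw (\<lambda>x y. f (S a * b * x) (v * y)) Lam) u) h"
    by (intro sw_cong sw_antipode_left[symmetric]) (simp add: sw_simps fl)
  also have "\<dots> = sw (\<lambda>a u. sw (\<lambda>b v. sw (\<lambda>x y. f (S a * b * x) (v * y)) Lam) u) h"
    by (intro sw_coassoc) (simp add: sw_simps fl)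
  also have "\<dots> = sw (\<lambda>a u. sw (\<lambda>x y. f (S a * x) y) (u * Lam)) h"
    unfolding mult.assoc by (intro sw_cong sw_mult[symmetric]) (simp add: sw_simps fl)
  also have "\<dots> = sw (\<lambda>a u. sw (\<lambda>x y. f (S (scale (\<epsilon> u) a) * x) y) Lam) h"
    by (simp add: left_Lam sw_simps fl)
  also have "\<dots> = sw (\<lambda>x y. f (S h * x) y) Lam"
    by (intro sw_counit_right) (simp add: sw_simps fl)
  finally show ?thesis by simp
qed

text \<open>The right-handed counterpart \<open>\<Lambda>\<^sub>1 h \<otimes> \<Lambda>\<^sub>2 = \<Lambda>\<^sub>1 \<otimes> \<Lambda>\<^sub>2 S h\<close>.\<close>

lemma Lam_move_right:
  fixes f :: "'h \<Rightarrow> 'h \<Rightarrow> 'b::ab_group_add"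
  assumes f: "bal2 f"
  shows "sw (\<lambda>x y. f (x * h) y) Lam = sw (\<lambda>x y. f x (y * S h)) Lam"
proof -
  note fl = bal2_simps[OF f]
  have "sw (\<lambda>x y. f (x * h) y) Lam = sw (\<lambda>u v. sw (\<lambda>x y. f (x * scale (\<epsilon> v) u) y) Lam) h"
    by (rule sw_counit_right[symmetric]) (simp add: sw_simps fl)
  also have "\<dots> = sw (\<lambda>u v. sw (\<lambda>x y. f (x * u) (y * scale (\<epsilon> v) 1)) Lam) h"
    by (simp add: sw_simps fl)
  also have "\<dots> = sw (\<lambda>u v. sw (\<lambda>a b. sw (\<lambda>x y. f (x * u) (y * (a * S b))) Lam) v) h"
    by (intro sw_cong sw_antipode_right[symmetric]) (simp add: sw_simps fl)
  also have "\<dots> = sw (\<lambda>u b. sw (\<lambda>a v. sw (\<lambda>x y. f (x * a) (y * (v * S b))) Lam) u) h"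
    by (intro sw_coassoc[symmetric]) (simp add: sw_simps fl)
  also have "\<dots> = sw (\<lambda>u b. sw (\<lambda>x y. sw (\<lambda>a v. f (x * a) (y * v * S b)) u) Lam) h"
    unfolding mult.assoc by (intro sw_cong sw_swap)
  also have "\<dots> = sw (\<lambda>u b. sw (\<lambda>x y. f x (y * S b)) (Lam * u)) h"
    by (intro sw_cong sw_mult[symmetric]) (simp add: sw_simps fl)
  also have "\<dots> = sw (\<lambda>u b. sw (\<lambda>x y. f x (y * S (scale (\<epsilon> u) b))) Lam) h"
    by (simp add: right_Lam sw_simps fl)
  also have "\<dots> = sw (\<lambda>x y. f x (y * S h)) Lam"
    by (intro sw_counit_left) (simp add: sw_simps fl)
  finally show ?thesis by simp
qed

text \<open>Expand the first legs of \<open>\<Delta> \<Lambda>\<close> in a Hamel basis;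
the finitely many second legs \<open>y c\<close> that occur span a left ideal by \<open>Lam_move_left\<close>, and this
ideal contains \<open>\<Sum> S \<Lambda>\<^sub>1 \<Lambda>\<^sub>2 = 1\<close>.\<close>

lemma ex_finite_basis: "\<exists>B. finite B \<and> independent B \<and> span B = UNIV"
proof -
  define BB where "BB = extend_basis {}"
  have BB: "independent BB" "span BB = UNIV"
    unfolding BB_def using independent_empty by (auto simp: independent_extend_basis span_extend_basis)
  define cc where "cc v c = representation BB v c" for v c
  have cc_functional: "functional (\<lambda>v. cc v c)" for c
    unfolding cc_def functional_def using BB by (simp add: representation_add representation_scale)
  note ccl = functional_simps[OF cc_functional]
  define C where "C = (\<Union>z\<in>set (\<Delta> Lam). {c. cc (fst z) c \<noteq> 0})"
  have C: "finite C" unfolding C_def cc_def using finite_representation by auto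
  have expand: "a = (\<Sum>c\<in>C. scale (cc a c) c)" if "(a, b) \<in> set (\<Delta> Lam)" for a b
  proof -
    have "a = (\<Sum>c | cc a c \<noteq> 0. scale (cc a c) c)"
      unfolding cc_def using sum_nonzero_representation_eq[OF BB(1), of a] BB(2) by simp
    also have "\<dots> = (\<Sum>c\<in>C. scale (cc a c) c)"
      using C that by (intro sum.mono_neutral_left) (auto simp: C_def)
    finally show ?thesis .
  qed
  define y where "y c = sw (\<lambda>a b. scale (cc a c) b) Lam" for c
  have mul: "h * y c = (\<Sum>c'\<in>C. scale (cc (S h * c') c) (y c'))" for h c
  proof -
    have "h * y c = sw (\<lambda>a b. scale (cc a c) (h * b)) Lam"
      unfolding y_def sw_mult_leftf[symmetric] by (simp add: scale_mult_right)
    also have "\<dots> = sw (\<lambda>a b. scale (cc (S h * a) c) b) Lam"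
      by (rule Lam_move_left[symmetric]) (simp add: sw_simps ccl)
    also have "\<dots> = sw (\<lambda>a b. \<Sum>c'\<in>C. scale (cc (S h * c') c) (scale (cc a c') b)) Lam"
    proof (rule sw_cong_set)
      fix a b assume ab: "(a, b) \<in> set (\<Delta> Lam)"
      have "cc (S h * a) c = cc (\<Sum>c'\<in>C. scale (cc a c') (S h * c')) c"
        by (subst expand[OF ab]) (simp add: sum_distrib_left scale_mult_right)
      also have "\<dots> = (\<Sum>c'\<in>C. cc (S h * c') c * cc a c')"
        by (simp add: functional_sum[OF cc_functional] ccl mult.commute)
      finally show "scale (cc (S h * a) c) b = (\<Sum>c'\<in>C. scale (cc (S h * c') c) (scale (cc a c') b))"
        by (simp add: scale_sum_left)
    qed
    finally show ?thesis by (simp only: sw_sum sw_scalef y_def)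
  qed
  define V where "V = span (y ` C)"
  have V: "h * v \<in> V" if "v \<in> V" for h v
    using that unfolding V_def
  proof (induction rule: span_induct_alt)
    case base then show ?case by (simp add: span_zero)
  next
    case (step r x v)
    then obtain c where "x = y c" by auto
    then have "h * x \<in> span (y ` C)"
      using mul by (auto intro!: span_sum span_scale intro: span_base)
    then show ?case using step by (simp add: lin_simps span_add span_scale)
  qed
  have "scale (\<epsilon> Lam) 1 = sw (\<lambda>a b. S a * b) Lam"
    using sw_antipode_left[of "\<lambda>x. x" Lam] by (simp add: sw_simps)
  also have "\<dots> = sw (\<lambda>a b. \<Sum>c\<in>C. S c * scale (cc a c) b) Lam"
  proof (rule sw_cong_set)
    fix a b assume ab: "(a, b) \<in> set (\<Delta> Lam)"
    have "S a = (\<Sum>c\<in>C. scale (cc a c) (S c))"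
      by (subst expand[OF ab]) (simp add: endo_sum[OF endo_S] S_scale)
    then show "S a * b = (\<Sum>c\<in>C. S c * scale (cc a c) b)"
      by (simp add: sum_distrib_right lin_simps)
  qed
  also have "\<dots> = (\<Sum>c\<in>C. S c * y c)"
    by (simp add: sw_sum sw_mult_leftf y_def)
  also have "\<dots> \<in> V"
    unfolding V_def by (intro span_sum V[unfolded V_def]) (auto intro: span_base)
  finally have "1 \<in> V" by (simp add: eps_Lam)
  then have VU: "V = UNIV" using V[of 1] by auto
  obtain B where B: "B \<subseteq> y ` C" "independent B" "y ` C \<subseteq> span B"
    using maximal_independent_subset[of "y ` C"] by blast
  have "finite B" using B(1) C finite_subset by blast
  moreover have "span B = UNIV"
    using VU span_mono[OF B(3)] unfolding V_def span_span by auto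
  ultimately show ?thesis using B(2) by blast
qed

definition Bas :: "'h set" where
  "Bas = (SOME B. finite B \<and> independent B \<and> span B = UNIV)"

lemma Bas: "finite Bas" "independent Bas" "span Bas = UNIV"
  using someI_ex[OF ex_finite_basis, folded Bas_def] by auto

sublocale finite_dimensional_vector_space scale Bas
  by unfold_locales (auto simp: Bas)

end

section \<open>Traces and the integral of the dual\<close>

context semisimple_hopf_algebra
begin

definition coord :: "'h \<Rightarrow> 'h \<Rightarrow> 'k" where
  "coord c v = representation Bas v c"

lemma functional_coord: "functional (coord c)"
  unfolding coord_def functional_def using Bas by (simp add: representation_add representation_scale)

lemma coord_expand: "(\<Sum>c\<in>Bas. scale (coord c v) c) = v"
  unfolding coord_def using sum_representation_eq[OF Bas(2) _ Bas(1) subset_refl, of v] Bas(3) by simp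

lemma functional_separate: "(\<And>p. functional p \<Longrightarrow> p a = p b) \<Longrightarrow> a = b"
  using functional_coord by (metis (no_types, lifting) coord_expand sum.cong)

definition tr :: "('h \<Rightarrow> 'h) \<Rightarrow> 'k" where
  "tr F = (\<Sum>c\<in>Bas. coord c (F c))"

text \<open>For operators presented as sums of operators of rank one; this lets matrix units and the dual
bases of a Frobenius form compute traces.\<close>

lemma tr_expand:
  assumes "\<And>h. F h = (\<Sum>i\<in>I. scale (\<phi> i h) (x i))" "\<And>i. i \<in> I \<Longrightarrow> functional (\<phi> i)"
  shows "tr F = (\<Sum>i\<in>I. \<phi> i (x i))"
proof -
  have "tr F = (\<Sum>c\<in>Bas. \<Sum>i\<in>I. \<phi> i c * coord c (x i))"
    unfolding tr_def assms(1) by (simp add: functional_sum[OF functional_coord] functional_scale[OF functional_coord])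
  also have "\<dots> = (\<Sum>i\<in>I. \<Sum>c\<in>Bas. \<phi> i c * coord c (x i))"
    by (rule sum.swap)
  also have "\<dots> = (\<Sum>i\<in>I. \<phi> i (\<Sum>c\<in>Bas. scale (coord c (x i)) c))"
  proof (rule sum.cong[OF HOL.refl])
    fix i assume "i \<in> I"
    then have f: "functional (\<phi> i)" by (rule assms(2))
    show "(\<Sum>c\<in>Bas. \<phi> i c * coord c (x i)) = \<phi> i (\<Sum>c\<in>Bas. scale (coord c (x i)) c)"
      by (simp add: functional_sum[OF f] functional_scale[OF f] mult.commute)
  qed
  finally show ?thesis by (simp add: coord_expand)
qed

lemma tr_sw:
  assumes F: "\<And>h. F h = sw (\<lambda>x y. scale (\<phi> x y h) (g x y)) a" and \<phi>: "\<And>x y. functional (\<phi> x y)"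
  shows "tr F = sw (\<lambda>x y. \<phi> x y (g x y)) a"
proof -
  have "coord c (F h) = sw (\<lambda>x y. \<phi> x y h * coord c (g x y)) a" for c h
    unfolding F by (subst sw_comp) (auto simp: additive_def functional_simps[OF functional_coord])
  then have "tr F = sw (\<lambda>x y. \<Sum>c\<in>Bas. \<phi> x y c * coord c (g x y)) a"
    unfolding tr_def by (simp add: sw_sum)
  also have "\<dots> = sw (\<lambda>x y. \<phi> x y (\<Sum>c\<in>Bas. scale (coord c (g x y)) c)) a"
    by (simp add: functional_sum[OF \<phi>] functional_scale[OF \<phi>] mult.commute)
  finally show ?thesis by (simp add: coord_expand)
qed

lemma tr_commute:
  assumes "endo F" "endo G"
  shows "tr (\<lambda>x. F (G x)) = tr (\<lambda>x. G (F x))"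
proof -
  have "tr (\<lambda>x. F (G x)) = (\<Sum>c\<in>Bas. coord c (G (F c)))"
  proof (rule tr_expand[where \<phi> = "\<lambda>c h. coord c (G h)" and x = F])
    show "F (G h) = (\<Sum>i\<in>Bas. scale (coord i (G h)) (F i))" for h
      using arg_cong[of _ _ F, OF coord_expand[of "G h"]]
      by (simp add: endo_sum[OF assms(1)] endo_scale[OF assms(1)])
    show "functional (\<lambda>h. coord i (G h))" for i
      using assms(2) functional_coord[of i] by (auto simp: functional_def endo_def)
  qed
  then show ?thesis by (simp add: tr_def)
qed

lemma tr_add: "tr (\<lambda>x. F x + G x) = tr F + tr G"
  by (simp add: tr_def functional_add[OF functional_coord] sum.distrib)

lemma tr_diff: "tr (\<lambda>x. F x - G x) = tr F - tr G"
  by (simp add: tr_def functional_diff[OF functional_coord] sum_subtractf)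

lemma tr_scale: "tr (\<lambda>x. scale r (F x)) = r * tr F"
  by (simp add: tr_def functional_scale[OF functional_coord] sum_distrib_left)

text \<open>In terms of a basis of the range, \<open>Q\<close> is a sum of operators of rank one with trace \<open>1\<close>.\<close>

lemma tr_idempotent:
  assumes Q: "endo Q" and idem: "\<And>x. Q (Q x) = Q x"
  shows "tr Q = of_nat (dim (range Q))"
proof -
  have "subspace (range Q)"
    unfolding subspace_def using endo_zero[OF Q] endo_add[OF Q] endo_scale[OF Q]
    by (auto intro: range_eqI[of _ _ "_ + _"] range_eqI[of _ _ 0]) (metis rangeI)+
  obtain B where B: "B \<subseteq> range Q" "independent B" "range Q \<subseteq> span B" "card B = dim (range Q)"
    using basis_exists[of "range Q"] by blast
  have fB: "finite B" using B(2) by (rule finiteI_independent)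
  have QB: "Q b = b" if "b \<in> B" for b using that B(1) idem by auto
  have "tr Q = (\<Sum>b\<in>B. representation B (Q b) b)"
  proof (rule tr_expand[where \<phi> = "\<lambda>b h. representation B (Q h) b" and x = "\<lambda>b. b"])
    show "Q h = (\<Sum>b\<in>B. scale (representation B (Q h) b) b)" for h
    proof -
      have "Q h \<in> span B" using B(3) by auto
      then show ?thesis using sum_representation_eq[OF B(2) _ fB subset_refl] by simp
    qed
    show "functional (\<lambda>h. representation B (Q h) b)" for b
      using B(3) by (simp add: functional_def endo_add[OF Q] endo_scale[OF Q] image_subset_iff
          representation_add[OF B(2)] representation_scale[OF B(2)])
  qed
  also have "\<dots> = (\<Sum>b\<in>B. 1)"
    using B(2) by (intro sum.cong HOL.refl) (simp add: QB representation_basis)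
  finally show ?thesis using B(4) by simp
qed

lemma tr_idempotent_eq_0:
  assumes "endo Q" "\<And>x. Q (Q x) = Q x" "tr Q = 0"
  shows "Q x = 0"
proof -
  have "range Q \<subseteq> {0}"
    using assms tr_idempotent[OF assms(1,2)] by (simp add: dim_eq_0)
  then show ?thesis by auto
qed

lemma tr_id: "tr (\<lambda>x. x) = of_nat dimension"
  using tr_idempotent[of "\<lambda>x. x"] by (simp add: endo_def dimension_def)

text \<open>A right integral of \<open>H\<^sup>*\<close>, in closed form.\<close>

definition lam0 :: "'h \<Rightarrow> 'k" where
  "lam0 x = tr (\<lambda>y. S (S y) * x)"

lemma functional_lam0: "functional lam0"
  by (auto simp: functional_def lam0_def lin_simps tr_add tr_scale)

lemmas lam0_simps = functional_simps[OF functional_lam0]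
lemmas coord_simps = functional_simps[OF functional_coord]

text \<open>In the trace, \<open>Lam_move_left\<close> turns \<open>S\<^sup>2\<close> into the factor \<open>S c\<close> on the second leg, and the dual bases
collapse to \<open>\<Sum> S \<Lambda>\<^sub>1 \<Lambda>\<^sub>2 = 1\<close>.\<close>

lemma lam0_Lam_left: "sw (\<lambda>x y. scale (lam0 x) y) Lam = 1"
proof -
  have "sw (\<lambda>x y. scale (lam0 x) y) Lam = (\<Sum>c\<in>Bas. sw (\<lambda>x y. scale (coord c (S (S c) * x)) y) Lam)"
    by (simp only: lam0_def tr_def scale_sum_left sw_sum)
  also have "\<dots> = (\<Sum>c\<in>Bas. sw (\<lambda>x y. scale (coord c x) (S c * y)) Lam)"
  proof (rule sum.cong[OF HOL.refl])
    show "sw (\<lambda>x y. scale (coord c (S (S c) * x)) y) Lam = sw (\<lambda>x y. scale (coord c x) (S c * y)) Lam" for c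
      by (rule Lam_move_left) (simp add: sw_simps coord_simps)
  qed
  also have "\<dots> = sw (\<lambda>x y. (\<Sum>c\<in>Bas. S (scale (coord c x) c)) * y) Lam"
    by (simp only: sw_sum[symmetric] sum_distrib_right lin_simps)
  also have "\<dots> = sw (\<lambda>x y. S x * y) Lam"
    by (simp only: endo_sum[OF endo_S, symmetric] coord_expand)
  also have "\<dots> = scale (\<epsilon> Lam) 1"
    by (rule sw_antipode_left) (simp add: additive_def)
  finally show ?thesis by (simp add: eps_Lam)
qed

text \<open>Injectivity of \<open>f \<mapsto> \<Sum> f \<Lambda>\<^sub>1 \<Lambda>\<^sub>2\<close>.  With \<open>Lam_move_right\<close> the hypothesis gives
\<open>\<Sum> f (\<Lambda>\<^sub>1 k) \<Lambda>\<^sub>2 = 0\<close> for all \<open>k\<close>, and \<open>f h = \<Sum> f (\<Lambda>\<^sub>1 S \<Lambda>\<^sub>2 h)\<close> is a combination of coordinates of such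
sums.  Identities between functionals will be checked on \<open>\<Lambda>\<close> in this way.\<close>

lemma Lam_left_inj:
  assumes f: "functional f" and 0: "sw (\<lambda>x y. scale (f x) y) Lam = 0"
  shows "f h = 0"
proof -
  note fl = functional_simps[OF f]
  have *: "sw (\<lambda>x y. coord c y * f (x * k)) Lam = 0" for c k
  proof -
    have "sw (\<lambda>x y. coord c y * f (x * k)) Lam = sw (\<lambda>x y. coord c (scale (f (x * k)) y)) Lam"
      by (simp add: coord_simps mult.commute)
    also have "\<dots> = coord c (sw (\<lambda>x y. scale (f (x * k)) y) Lam)"
      by (rule sw_comp[symmetric]) (simp add: additive_def coord_simps)
    also have "sw (\<lambda>x y. scale (f (x * k)) y) Lam = sw (\<lambda>x y. scale (f x) (y * S k)) Lam"
      by (rule Lam_move_right) (simp add: sw_simps fl)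
    also have "\<dots> = sw (\<lambda>x y. scale (f x) y * S k) Lam"
      by (simp add: lin_simps)
    also have "\<dots> = 0" by (simp only: sw_mult_rightf 0) simp
    finally show ?thesis by (simp add: functional_zero[OF functional_coord])
  qed
  have "f h = f (scale (\<epsilon> Lam) 1 * h)" by (simp add: eps_Lam)
  also have "\<dots> = sw (\<lambda>x y. f (x * S y * h)) Lam"
    by (rule sw_antipode_right[symmetric]) (simp add: sw_simps fl)
  also have "\<dots> = sw (\<lambda>x y. \<Sum>c\<in>Bas. coord c y * f (x * (S c * h))) Lam"
  proof (rule sw_cong)
    fix x y
    have "f (x * S y * h) = f (x * S (\<Sum>c\<in>Bas. scale (coord c y) c) * h)"
      by (simp add: coord_expand)
    also have "\<dots> = (\<Sum>c\<in>Bas. coord c y * f (x * (S c * h)))"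
      by (simp add: endo_sum[OF endo_S] sum_distrib_left sum_distrib_right functional_sum[OF f] fl lin_simps mult.assoc)
    finally show "f (x * S y * h) = (\<Sum>c\<in>Bas. coord c y * f (x * (S c * h)))" .
  qed
  also have "\<dots> = 0" by (simp only: sw_sum *) simp
  finally show ?thesis .
qed

lemma Lam_left_eqI:
  assumes "functional f" "functional g" "sw (\<lambda>x y. scale (f x) y) Lam = sw (\<lambda>x y. scale (g x) y) Lam"
  shows "f h = g h"
proof -
  have "(\<lambda>x. f x - g x) h = 0"
  proof (rule Lam_left_inj)
    show "functional (\<lambda>x. f x - g x)"
      using assms(1,2) by (auto simp: functional_def algebra_simps)
    have "sw (\<lambda>x y. scale (f x - g x) y) Lam + sw (\<lambda>x y. scale (g x) y) Lam = sw (\<lambda>x y. scale (f x) y) Lam"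
      by (subst sw_addf[symmetric]) (simp add: scale_left_distrib[symmetric])
    then show "sw (\<lambda>x y. scale (f x - g x) y) Lam = 0" using assms(3) by simp
  qed
  then show ?thesis by simp
qed

text \<open>This inverts \<open>f \<mapsto> \<Sum> f \<Lambda>\<^sub>1 \<Lambda>\<^sub>2\<close> and gives a pair of dual bases for the form \<open>\<lambda>\<^sub>0\<close>.\<close>

lemma lam0_recover: "sw (\<lambda>x y. scale (lam0 (S h * x)) y) Lam = h"
proof -
  have "sw (\<lambda>x y. scale (lam0 (S h * x)) y) Lam = sw (\<lambda>x y. scale (lam0 x) (h * y)) Lam"
    by (rule Lam_move_left) (simp add: sw_simps lam0_simps)
  also have "\<dots> = h * sw (\<lambda>x y. scale (lam0 x) y) Lam"
    by (simp only: sw_mult_leftf[symmetric] lin_simps)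
  finally show ?thesis by (simp add: lam0_Lam_left)
qed

lemma lam0_recover_S: "sw (\<lambda>x y. scale (lam0 (x * h)) y) Lam = S h"
proof -
  have "sw (\<lambda>x y. scale (lam0 (x * h)) y) Lam = sw (\<lambda>x y. scale (lam0 x) (y * S h)) Lam"
    by (rule Lam_move_right) (simp add: sw_simps lam0_simps)
  also have "\<dots> = sw (\<lambda>x y. scale (lam0 x) y) Lam * S h"
    by (simp only: sw_mult_rightf[symmetric] lin_simps)
  finally show ?thesis by (simp add: lam0_Lam_left)
qed

lemma S_eq_0: "S h = 0 \<Longrightarrow> h = 0"
  using lam0_recover[of h] by (simp add: functional_zero[OF functional_lam0] sw_zero)

lemma inj_S: "inj S"
  by (rule injI) (metis S_eq_0 eq_iff_diff_eq_0 endo_S endo_diff)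

lemma surj_S: "surj S"
  using linear_inj_imp_surj inj_S endo_S endo_iff_linear by blast

text \<open>\<open>S\<^sup>2\<close> is the Nakayama automorphism of the Frobenius form \<open>\<lambda>\<^sub>0\<close>: as functionals of \<open>x\<close>, both sides are sent to
\<open>S h\<close> by \<open>f \<mapsto> \<Sum> f \<Lambda>\<^sub>1 \<Lambda>\<^sub>2\<close>.\<close>

lemma lam0_nakayama: "lam0 (x * h) = lam0 (S (S h) * x)"
proof (rule Lam_left_eqI[of "\<lambda>x. lam0 (x * h)" "\<lambda>x. lam0 (S (S h) * x)"])
  show "sw (\<lambda>x y. scale (lam0 (x * h)) y) Lam = sw (\<lambda>x y. scale (lam0 (S (S h) * x)) y) Lam"
    by (simp only: lam0_recover lam0_recover_S)
qed (auto simp: functional_def lin_simps lam0_simps)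

lemma lam0_right_integral: "sw (\<lambda>x y. scale (lam0 x) y) h = scale (lam0 h) 1"
proof (rule functional_separate)
  fix p assume p: "functional p"
  note pl = functional_simps[OF p]
  have "p (sw (\<lambda>x y. scale (lam0 x) y) h) = sw (\<lambda>x y. lam0 x * p y) h" for h
    by (subst sw_comp) (simp_all add: additive_def pl)
  moreover have "sw (\<lambda>x y. lam0 x * p y) h = lam0 h * p 1"
  proof (rule Lam_left_eqI[of "sw (\<lambda>x y. lam0 x * p y)" "\<lambda>h. lam0 h * p 1"])
    have "sw (\<lambda>z y. scale (sw (\<lambda>u v. lam0 u * p v) z) y) Lam
        = sw (\<lambda>z y. sw (\<lambda>u v. scale (lam0 u * p v) y) z) Lam"
      by (simp only: sw_scale_leftf)
    also have "\<dots> = sw (\<lambda>u z. sw (\<lambda>v y. scale (lam0 u * p v) y) z) Lam"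
      by (rule sw_coassoc) (simp add: sw_simps lam0_simps pl)
    also have "\<dots> = sw (\<lambda>u z. sw (\<lambda>v y. scale (p v) y) (scale (lam0 u) z)) Lam"
      by (simp add: sw_simps pl)
    also have "\<dots> = sw (\<lambda>v y. scale (p v) y) (sw (\<lambda>u z. scale (lam0 u) z) Lam)"
      by (rule sw_comp[symmetric]) (simp add: sw_simps pl)
    also have "\<dots> = scale (p 1) 1"
      unfolding lam0_Lam_left by (rule sw_one) (simp add: sw_simps pl)
    also have "\<dots> = sw (\<lambda>x y. scale (p 1) (scale (lam0 x) y)) Lam"
      by (simp only: sw_scalef lam0_Lam_left)
    finally show "sw (\<lambda>z y. scale (sw (\<lambda>u v. lam0 u * p v) z) y) Lam = sw (\<lambda>x y. scale (lam0 x * p 1) y) Lam"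
      by (simp add: mult.commute)
  qed (auto simp: functional_def sw_simps lam0_simps pl)
  ultimately show "p (sw (\<lambda>x y. scale (lam0 x) y) h) = p (scale (lam0 h) 1)"
    by (simp add: pl)
qed

lemma lam0_Lam: "lam0 Lam = 1"
proof -
  have "1 = \<epsilon> (sw (\<lambda>x y. scale (lam0 x) y) Lam)" by (simp add: lam0_Lam_left counit_one)
  also have "\<dots> = sw (\<lambda>x y. lam0 (scale (\<epsilon> y) x)) Lam"
    by (subst sw_comp) (simp_all add: additive_def lin_simps lam0_simps mult.commute)
  also have "\<dots> = lam0 Lam"
    by (rule sw_counit_right) (simp add: additive_def lam0_simps)
  finally show ?thesis by simp
qed

text \<open>By \<open>lam0_recover\<close>, both sides have the same value on the first leg of \<open>\<Delta> \<Lambda>\<close>.  This makes \<open>\<lambda>\<^sub>0\<close> a Frobenius form.\<close>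

lemma lam0_frobenius: "functional f \<Longrightarrow> f x = lam0 (S (sw (\<lambda>x y. scale (f x) y) Lam) * x)"
  by (rule Lam_left_eqI[of f "\<lambda>x. lam0 (S (sw (\<lambda>x y. scale (f x) y) Lam) * x)"])
    (auto simp: lam0_recover, auto simp: functional_def lin_simps lam0_simps)

lemma lam0_nondegenerate: "(\<And>b. lam0 (a * b) = 0) \<Longrightarrow> a = 0"
proof -
  assume a: "\<And>b. lam0 (a * b) = 0"
  obtain a' where "a = S a'" using surj_S by blast
  then show "a = 0" using lam0_recover[of a'] a by (simp add: sw_zero S_zero)
qed

lemma S_Lam: "S Lam = Lam"
proof -
  have "S Lam * h = scale (\<epsilon> h) (S Lam)" for h
  proof -
    obtain h' where "h = S h'" using surj_S by blast
    then show ?thesis using left_Lam[of h'] by (metis S_mult S_scale eps_S)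
  qed
  from this[of Lam] show ?thesis by (simp add: left_Lam eps_S eps_Lam)
qed

lemma lam0_S_left_integral: "sw (\<lambda>x y. scale (lam0 (S y)) x) h = scale (lam0 (S h)) 1"
proof -
  have "S (sw (\<lambda>x y. scale (lam0 (S y)) x) h) = sw (\<lambda>x y. scale (lam0 (S y)) (S x)) h"
    by (subst sw_comp) (simp_all add: sw_simps)
  also have "\<dots> = sw (\<lambda>x y. scale (lam0 x) y) (S h)"
    by (rule sw_S[symmetric]) (simp add: sw_simps lam0_simps)
  also have "\<dots> = S (scale (lam0 (S h)) 1)"
    by (simp add: lam0_right_integral S_scale S_one)
  finally show ?thesis using inj_S by (simp add: inj_eq)
qed

text \<open>The modular element of \<open>H\<^sup>*\<close>; it measures the failure of the right integral \<open>\<lambda>\<^sub>0\<close> to be a left one.\<close>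

definition modular :: 'h where
  "modular = sw (\<lambda>x y. scale (lam0 y) x) Lam"

text \<open>For a functional \<open>p\<close>, the convolution product \<open>p * \<lambda>\<^sub>0\<close> is again a right integral, hence a multiple of \<open>\<lambda>\<^sub>0\<close>;
evaluation on \<open>\<Lambda>\<close> identifies the factor.\<close>

lemma lam0_left_modular: "sw (\<lambda>x y. scale (lam0 y) x) h = scale (lam0 h) modular"
proof (rule functional_separate)
  fix p assume p: "functional p"
  note pl = functional_simps[OF p]
  have psw: "p (sw (\<lambda>x y. scale (lam0 y) x) h) = sw (\<lambda>x y. lam0 y * p x) h" for h
    by (subst sw_comp) (simp_all add: additive_def pl)
  moreover have "sw (\<lambda>x y. lam0 y * p x) h = lam0 h * p modular"
  proof (rule Lam_left_eqI[of "sw (\<lambda>x y. lam0 y * p x)" "\<lambda>h. lam0 h * p modular"])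
    have "sw (\<lambda>z y. scale (sw (\<lambda>u v. lam0 v * p u) z) y) Lam
        = sw (\<lambda>z y. sw (\<lambda>u v. scale (lam0 v * p u) y) z) Lam"
      by (simp only: sw_scale_leftf)
    also have "\<dots> = sw (\<lambda>u z. sw (\<lambda>v y. scale (lam0 v * p u) y) z) Lam"
      by (rule sw_coassoc) (simp add: sw_simps lam0_simps pl)
    also have "\<dots> = sw (\<lambda>u z. scale (p u) (sw (\<lambda>v y. scale (lam0 v) y) z)) Lam"
      by (simp only: sw_scalef[symmetric] scale_scale mult.commute)
    also have "\<dots> = sw (\<lambda>u z. scale (lam0 z * p u) 1) Lam"
      by (simp add: lam0_right_integral mult.commute)
    also have "\<dots> = scale (p modular) 1"
      by (simp only: sw_scale_leftf modular_def psw)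
    also have "\<dots> = sw (\<lambda>x y. scale (p modular) (scale (lam0 x) y)) Lam"
      by (simp only: sw_scalef lam0_Lam_left)
    finally show "sw (\<lambda>z y. scale (sw (\<lambda>u v. lam0 v * p u) z) y) Lam = sw (\<lambda>x y. scale (lam0 x * p modular) y) Lam"
      by (simp add: mult.commute)
  qed (auto simp: functional_def sw_simps lam0_simps pl)
  ultimately show "p (sw (\<lambda>x y. scale (lam0 y) x) h) = p (scale (lam0 h) modular)"
    by (simp add: pl)
qed

lemma eps_modular: "\<epsilon> modular = 1"
proof -
  have "\<epsilon> modular = sw (\<lambda>x y. lam0 (scale (\<epsilon> x) y)) Lam"
    unfolding modular_def by (subst sw_comp) (simp_all add: sw_simps lam0_simps)
  also have "\<dots> = lam0 Lam"
    by (rule sw_counit_left) (simp add: additive_def lam0_simps)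
  finally show ?thesis by (simp add: lam0_Lam)
qed

lemma modular_grouplike:
  fixes f :: "'h \<Rightarrow> 'h \<Rightarrow> 'b::ab_group_add"
  assumes f: "bal2 f"
  shows "sw f modular = f modular modular"
proof -
  note fl = bal2_simps[OF f]
  have "sw f modular = sw (\<lambda>z y. sw f (scale (lam0 y) z)) Lam"
    unfolding modular_def by (rule sw_comp) (simp add: additive_def sw_add[OF f])
  also have "\<dots> = sw (\<lambda>z y. sw (\<lambda>u v. f u (scale (lam0 y) v)) z) Lam"
    by (simp add: sw_scale[OF f] fl)
  also have "\<dots> = sw (\<lambda>u t. sw (\<lambda>v y. f u (scale (lam0 y) v)) t) Lam"
    by (rule sw_coassoc) (simp add: sw_simps lam0_simps fl)
  also have "\<dots> = sw (\<lambda>u t. f u (sw (\<lambda>v y. scale (lam0 y) v) t)) Lam"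
    by (intro sw_cong sw_comp[symmetric]) (simp add: additive_def fl)
  also have "\<dots> = sw (\<lambda>u t. f (scale (lam0 t) u) modular) Lam"
    by (simp add: lam0_left_modular fl)
  also have "\<dots> = (\<lambda>z. f z modular) (sw (\<lambda>x y. scale (lam0 y) x) Lam)"
    by (rule sw_comp[symmetric]) (simp add: additive_def fl)
  finally show ?thesis by (simp add: modular_def[symmetric])
qed

text \<open>\<open>\<lambda>\<^sub>0 \<circ> S\<close> is represented by \<open>\<Sum> S (\<lambda>\<^sub>0 (S \<Lambda>\<^sub>1) \<Lambda>\<^sub>2)\<close>, which is the modular element because \<open>S \<Lambda> = \<Lambda>\<close>.\<close>

lemma lam0_S: "lam0 (S h) = lam0 (modular * h)"
proof -
  have f: "functional (\<lambda>h. lam0 (S h))" by (auto simp: functional_def lin_simps lam0_simps)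
  have "S (sw (\<lambda>x y. scale (lam0 (S x)) y) Lam) = sw (\<lambda>x y. scale (lam0 (S x)) (S y)) Lam"
    by (subst sw_comp) (simp_all add: sw_simps)
  also have "\<dots> = sw (\<lambda>x y. scale (lam0 y) x) (S Lam)"
    by (rule sw_S[symmetric]) (simp add: sw_simps lam0_simps)
  finally have "S (sw (\<lambda>x y. scale (lam0 (S x)) y) Lam) = modular"
    by (simp add: S_Lam modular_def)
  then show ?thesis using lam0_frobenius[OF f, of h] by simp
qed

text \<open>The form \<open>\<lambda>\<^sub>0 \<circ> S\<close> has Nakayama automorphism \<open>S\<^sup>-\<^sup>2\<close>, while \<open>\<lambda>\<^sub>0\<close> has \<open>S\<^sup>2\<close>; the two forms differ by the modular
element.\<close>

lemma modular_commute: "modular * x = S (S (S (S x))) * modular"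
proof -
  have "lam0 ((modular * x - S (S (S (S x))) * modular) * h) = 0" for h
  proof -
    have "lam0 (modular * x * h) = lam0 (S h * S x)"
      by (simp add: lam0_S[symmetric] S_mult mult.assoc)
    also have "\<dots> = lam0 (S (h * S (S x)))"
      by (simp add: lam0_nakayama[of "S h"] S_mult)
    also have "\<dots> = lam0 (modular * h * S (S x))"
      by (simp add: lam0_S mult.assoc)
    also have "\<dots> = lam0 (S (S (S (S x))) * modular * h)"
      using lam0_nakayama[of "modular * h" "S (S x)"] by (simp add: mult.assoc)
    finally show ?thesis by (simp add: left_diff_distrib functional_diff[OF functional_lam0])
  qed
  then have "modular * x - S (S (S (S x))) * modular = 0" by (rule lam0_nondegenerate)
  then show ?thesis by simp
qed

end

section \<open>The square of the antipode is inner of finite order\<close>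

context semisimple_hopf_algebra
begin

lemma modular_power_grouplike:
  fixes f :: "'h \<Rightarrow> 'h \<Rightarrow> 'b::ab_group_add"
  shows "bal2 f \<Longrightarrow> sw f (modular ^ n) = f (modular ^ n) (modular ^ n)"
proof (induction n arbitrary: f)
  case 0
  then show ?case by (simp add: sw_one)
next
  case (Suc n)
  note fl = bal2_simps[OF Suc.prems]
  have "sw f (modular ^ Suc n) = sw (\<lambda>x y. sw (\<lambda>u v. f (x * u) (y * v)) (modular ^ n)) modular"
    using sw_mult[OF Suc.prems] by simp
  also have "\<dots> = sw (\<lambda>x y. f (x * modular ^ n) (y * modular ^ n)) modular"
    by (intro sw_cong Suc.IH) (simp add: sw_simps fl)
  also have "\<dots> = f (modular * modular ^ n) (modular * modular ^ n)"
    by (rule modular_grouplike) (simp add: sw_simps fl)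
  finally show ?case by simp
qed

definition grouplike :: "'h \<Rightarrow> bool" where
  "grouplike a \<longleftrightarrow> a \<noteq> 0 \<and> (\<forall>p q. functional p \<longrightarrow> functional q \<longrightarrow> sw (\<lambda>x y. p x * q y) a = p a * q a)"

text \<open>If \<open>g = \<Sum> r y y\<close>, comparing the coefficients of \<open>\<Delta> g = g \<otimes> g\<close> shows that the \<open>r y\<close> are orthogonal
idempotents of the field, so exactly one of them is \<open>1\<close>.\<close>

lemma grouplike_independent:
  assumes "finite X" "\<And>x. x \<in> X \<Longrightarrow> grouplike x"
  shows "independent X"
  using assms
proof (induction X)
  case empty
  then show ?case by (simp add: independent_empty)
next
  case (insert g X)
  have X: "independent X" using insert by simp
  have "g \<notin> span X"
  proof
    assume g: "g \<in> span X"
    define BB where "BB = extend_basis X"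
    have BB: "independent BB" "span BB = UNIV" "X \<subseteq> BB"
      unfolding BB_def using X by (simp_all add: independent_extend_basis span_extend_basis extend_basis_superset)
    define \<phi> where "\<phi> x v = representation BB v x" for x v
    have \<phi>: "functional (\<phi> x)" for x
      unfolding \<phi>_def functional_def using BB by (simp add: representation_add representation_scale)
    have \<phi>X: "\<phi> x y = (if x = y then 1 else 0)" if "y \<in> X" for x y
      using that BB representation_basis[OF BB(1), of y] by (auto simp: \<phi>_def)
    note \<phi>l = functional_simps[OF \<phi>]
    define r where "r = representation X g"
    have gr: "g = (\<Sum>y\<in>X. scale (r y) y)"
      unfolding r_def using sum_representation_eq[OF X g insert.hyps(1) subset_refl] by simp
    have \<phi>g: "\<phi> x g = r x" if "x \<in> X" for x
      by (subst gr) (simp add: functional_sum[OF \<phi>] \<phi>l \<phi>X that insert.hyps(1) if_distrib cong: if_cong)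
    have rr: "r x * r x' = (if x = x' then r x else 0)" if x: "x \<in> X" "x' \<in> X" for x x'
    proof -
      have F: "functional (sw (\<lambda>a b. \<phi> x a * \<phi> x' b))"
        by (auto simp: functional_def sw_simps \<phi>l)
      have "r x * r x' = sw (\<lambda>a b. \<phi> x a * \<phi> x' b) g"
        using insert.prems[of g] \<phi> x by (simp add: grouplike_def \<phi>g)
      also have "\<dots> = (\<Sum>y\<in>X. r y * sw (\<lambda>a b. \<phi> x a * \<phi> x' b) y)"
        by (subst gr) (simp add: functional_sum[OF F] functional_scale[OF F])
      also have "\<dots> = (\<Sum>y\<in>X. if y = x then (if x = x' then r x else 0) else 0)"
        using insert.prems \<phi> x by (intro sum.cong HOL.refl) (auto simp: grouplike_def \<phi>X)
      also have "\<dots> = (if x = x' then r x else 0)"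
        using x insert.hyps(1) by simp
      finally show ?thesis .
    qed
    have "g \<noteq> 0" using insert.prems[of g] by (simp add: grouplike_def)
    then obtain x where x: "x \<in> X" "r x \<noteq> 0"
      using gr by (metis (no_types, lifting) scale_zero_left sum.neutral)
    have "r x = 1" using rr[OF x(1) x(1)] x(2) by simp
    moreover have "r y = 0" if "y \<in> X" "y \<noteq> x" for y
      using rr[OF x(1) that(1)] that x by simp
    ultimately have "g = (\<Sum>y\<in>X. if y = x then x else 0)"
      by (subst gr) (intro sum.cong HOL.refl, auto)
    then have "g = x" using x insert.hyps(1) by simp
    then show False using x(1) insert.hyps(2) by simp
  qed
  then show ?case using X by (rule independent_insertI)
qed

text \<open>The powers are grouplike, and a finite-dimensional space has room for finitely many of them.\<close>

lemma modular_finite_order: "\<exists>M>0. modular ^ M = 1"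
proof -
  have eps: "\<epsilon> (modular ^ n) = 1" for n
    by (induction n) (auto simp: eps_modular counit_mult counit_one)
  have grp: "grouplike (modular ^ n)" for n
    unfolding grouplike_def
  proof (intro conjI allI impI)
    show "modular ^ n \<noteq> 0" using eps[of n] eps_zero by auto
    fix p q :: "'h \<Rightarrow> 'k" assume pq: "functional p" "functional q"
    show "sw (\<lambda>x y. p x * q y) (modular ^ n) = p (modular ^ n) * q (modular ^ n)"
      by (rule modular_power_grouplike)
        (simp add: sw_simps functional_add[OF pq(1)] functional_add[OF pq(2)] functional_scale[OF pq(1)] functional_scale[OF pq(2)])
  qed
  have "independent ((\<lambda>n. modular ^ n) ` {..dimension})"
    using grp by (intro grouplike_independent) auto
  then have "card ((\<lambda>n. modular ^ n) ` {..dimension}) \<le> dimension"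
    using independent_card_le_dim[of "(\<lambda>n. modular ^ n) ` {..dimension}" UNIV] by (simp add: dimension_def)
  then have "\<not> inj_on (\<lambda>n. modular ^ n) {..dimension}"
    by (auto simp: card_image)
  then obtain i j where ij: "i < j" "modular ^ i = modular ^ j"
    unfolding inj_on_def by (metis linorder_neqE_nat)
  have "sw (\<lambda>x y. S x * y) modular = S modular * modular"
    by (rule modular_grouplike) (simp add: sw_simps)
  then have inv: "S modular * modular = 1"
    using sw_antipode_left[of "\<lambda>x. x" modular] by (simp add: additive_def eps_modular)
  have inv_pow: "S modular ^ n * modular ^ n = 1" for n
  proof (induction n)
    case (Suc n)
    have "S modular ^ Suc n * modular ^ Suc n = S modular ^ n * (S modular * modular) * modular ^ n"
      unfolding power_Suc2[of "S modular"] power_Suc[of modular] by (simp only: mult.assoc)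
    then show ?case using Suc inv by simp
  qed simp
  have "1 = S modular ^ i * modular ^ j" using ij(2) inv_pow[of i] by simp
  also have "\<dots> = (S modular ^ i * modular ^ i) * modular ^ (j - i)"
    using ij(1) by (simp add: mult.assoc flip: power_add)
  also have "\<dots> = modular ^ (j - i)" by (simp add: inv_pow)
  finally show ?thesis using ij(1) by (intro exI[of _ "j - i"]) simp
qed

lemma S2_finite_order: "\<exists>M>0. \<forall>x. ((\<lambda>x. S (S x)) ^^ M) x = x"
proof -
  obtain M where M: "M > 0" "modular ^ M = 1" using modular_finite_order by blast
  define T where "T = (\<lambda>x. S (S x))"
  have "modular ^ n * x = (T ^^ (2 * n)) x * modular ^ n" for n x
  proof (induction n arbitrary: x)
    case (Suc n)
    have "modular ^ Suc n * x = modular ^ n * (modular * x)"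
      by (simp add: power_Suc2 mult.assoc del: power_Suc)
    also have "\<dots> = modular ^ n * T (T x) * modular"
      using modular_commute[of x] by (simp add: mult.assoc T_def)
    also have "\<dots> = (T ^^ (2 * n)) (T (T x)) * modular ^ Suc n"
      by (simp add: Suc.IH power_Suc2 mult.assoc del: power_Suc)
    finally show ?case by (simp add: funpow_swap1)
  qed simp
  from this[of M] M show ?thesis
    by (intro exI[of _ "2 * M"]) (simp add: T_def)
qed

definition chi :: "'h \<Rightarrow> 'k" where
  "chi h = tr (\<lambda>x. h * x)"

lemma functional_chi: "functional chi"
  by (auto simp: functional_def chi_def lin_simps tr_add tr_scale)

lemma endo_mult_left: "endo (\<lambda>x. a * x)" and endo_mult_right: "endo (\<lambda>x. x * a)"
  by (auto simp: endo_def lin_simps)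

lemma chi_commute: "chi (a * b) = chi (b * a)"
  using tr_commute[OF endo_mult_left[of a] endo_mult_left[of b]] by (simp add: chi_def mult.assoc)

lemma chi_idempotent: "e * e = e \<Longrightarrow> chi e = 0 \<Longrightarrow> e = 0"
  using tr_idempotent_eq_0[OF endo_mult_left[of e], of 1] by (simp add: chi_def flip: mult.assoc)

text \<open>The radical of the trace form is a left ideal, hence generated by an idempotent \<open>e\<close>, and \<open>\<chi> e = 0\<close>
forces \<open>e = 0\<close>.\<close>

lemma chi_nondegenerate:
  assumes "\<And>b. chi (a * b) = 0"
  shows "a = 0"
proof -
  define K where "K = {a. \<forall>b. chi (a * b) = 0}"
  have "left_ideal K"
    unfolding left_ideal_def K_def
  proof (intro conjI ballI allI; clarsimp)
    show "chi 0 = 0" by (rule functional_zero[OF functional_chi])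
    show "chi ((x + y) * b) = 0" if "\<forall>b. chi (x * b) = 0" "\<forall>b. chi (y * b) = 0" for x y b
      using that by (simp add: distrib_right functional_add[OF functional_chi])
    show "chi (h * x * b) = 0" if "\<forall>b. chi (x * b) = 0" for h x b
      using that chi_commute[of h "x * b"] by (simp add: mult.assoc)
  qed
  then obtain e where e: "e \<in> K" "\<And>x. x \<in> K \<Longrightarrow> x * e = x"
    by (rule left_ideal_complement) blast
  have "chi (e * 1) = 0" using e(1) unfolding K_def by blast
  then have "e = 0" using e by (intro chi_idempotent) auto
  moreover have "a \<in> K" using assms by (simp add: K_def)
  ultimately show ?thesis using e(2) by force
qed

text \<open>Write \<open>\<chi> = \<lambda>\<^sub>0 (v _)\<close>.  Symmetry of \<open>\<chi>\<close> and the Nakayama automorphism of \<open>\<lambda>\<^sub>0\<close> give \<open>S\<^sup>2 a v = v a\<close>, and \<open>v\<close> is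
invertible because \<open>\<chi>\<close> is nondegenerate.\<close>

lemma S2_inner:
  obtains v vi M where "v * vi = 1" "vi * v = 1" "\<And>a. S (S a) * v = v * a"
    "M > 0" "\<And>a. v ^ M * a = a * v ^ M"
proof -
  define v where "v = S (sw (\<lambda>x y. scale (chi x) y) Lam)"
  have chi: "chi x = lam0 (v * x)" for x
    unfolding v_def by (rule lam0_frobenius[OF functional_chi])
  have comm: "S (S a) * v = v * a" for a
  proof -
    have "lam0 ((S (S a) * v - v * a) * b) = 0" for b
    proof -
      have "lam0 (S (S a) * v * b) = chi (b * a)"
        using lam0_nakayama[of "v * b" a] by (simp add: chi mult.assoc)
      also have "\<dots> = lam0 (v * a * b)"
        using chi_commute[of a b] by (simp add: chi mult.assoc)
      finally show ?thesis by (simp add: left_diff_distrib functional_diff[OF functional_lam0])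
    qed
    then have "S (S a) * v - v * a = 0" by (rule lam0_nondegenerate)
    then show ?thesis by simp
  qed
  have inj0: "a = 0" if "v * a = 0" for a
    by (rule chi_nondegenerate) (simp add: chi that flip: mult.assoc, simp add: functional_zero[OF functional_lam0])
  have "inj (\<lambda>a. v * a)"
    by (rule injI) (metis inj0 eq_iff_diff_eq_0 right_diff_distrib)
  then have "surj (\<lambda>a. v * a)"
    using linear_inj_imp_surj endo_mult_left endo_iff_linear by blast
  then obtain vi where vi: "v * vi = 1" by (metis surjE)
  have "v * (vi * v - 1) = 0" by (simp add: right_diff_distrib vi flip: mult.assoc)
  then have vi': "vi * v = 1" using inj0 by fastforce
  obtain M where M: "M > 0" "\<And>x. ((\<lambda>x. S (S x)) ^^ M) x = x" using S2_finite_order by blast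
  have pow: "((\<lambda>x. S (S x)) ^^ n) a * v ^ n = v ^ n * a" for n a
  proof (induction n arbitrary: a)
    case (Suc n)
    have "((\<lambda>x. S (S x)) ^^ Suc n) a * v ^ Suc n = ((\<lambda>x. S (S x)) ^^ n) (S (S a)) * v ^ n * v"
      by (simp add: funpow_Suc_right power_Suc2 mult.assoc del: power_Suc funpow.simps)
    also have "\<dots> = v ^ n * (v * a)" by (simp only: Suc.IH mult.assoc comm)
    finally show ?case by (simp add: power_Suc2 mult.assoc del: power_Suc)
  qed simp
  show ?thesis
    by (rule that[of v vi M]) (use vi vi' comm M pow[of M] in auto)
qed

end

section \<open>Primitive idempotents\<close>

context semisimple_hopf_algebra
begin

lemma span_image_explicit:
  assumes "v \<in> span (f ` A)" "finite A"
  shows "\<exists>c. v = (\<Sum>j\<in>A. scale (c j) (f j))"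
  using assms(1)
proof (induction rule: span_induct_alt)
  case base
  show ?case by (rule exI[of _ "\<lambda>_. 0"]) simp
next
  case (step r x y)
  then obtain a c where a: "a \<in> A" "x = f a" "y = (\<Sum>j\<in>A. scale (c j) (f j))" by blast
  have "scale r x + y = (\<Sum>j\<in>A. scale ((if j = a then r else 0) + c j) (f j))"
    using a assms(2) by (simp add: scale_left_distrib sum.distrib if_distrib[of "\<lambda>r. scale r _"] cong: if_cong)
  then show ?case by (rule exI[of _ "\<lambda>j. (if j = a then r else 0) + c j"])
qed

lemma sequence_dependent:
  fixes f :: "nat \<Rightarrow> 'h"
  shows "\<exists>n c. f n = (\<Sum>j<n. scale (c j) (f j))"
proof -
  have "\<exists>n. f n \<in> span (f ` {..<n})"
  proof (rule ccontr)
    assume "\<nexists>n. f n \<in> span (f ` {..<n})"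
    then have f: "f n \<notin> span (f ` {..<n})" for n by blast
    have "independent (f ` {..<n}) \<and> card (f ` {..<n}) = n" for n
    proof (induction n)
      case (Suc n)
      have "f n \<notin> f ` {..<n}" using f[of n] by (rule contrapos_nn) (rule span_base)
      moreover have "independent (insert (f n) (f ` {..<n}))"
        using Suc f[of n] by (intro independent_insertI) auto
      ultimately show ?case using Suc by (simp only: lessThan_Suc image_insert) simp
    qed (simp add: independent_empty)
    from this[of "Suc dimension"] show False
      using independent_card_le_dim[of "f ` {..<Suc dimension}" UNIV] by (simp add: dimension_def)
  qed
  then obtain n where "f n \<in> span (f ` {..<n})" ..
  from span_image_explicit[OF this] show ?thesis by auto
qed

definition poly_apply :: "('h \<Rightarrow> 'h) \<Rightarrow> 'k poly \<Rightarrow> 'h \<Rightarrow> 'h" where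
  "poly_apply T p z = (\<Sum>i\<le>degree p. scale (coeff p i) ((T ^^ i) z))"

lemma poly_apply_le: "degree p \<le> n \<Longrightarrow> poly_apply T p z = (\<Sum>i\<le>n. scale (coeff p i) ((T ^^ i) z))"
  unfolding poly_apply_def by (rule sum.mono_neutral_left) (auto simp: coeff_eq_0)

lemma poly_apply_linear_factor:
  assumes T: "endo T"
  shows "poly_apply T ([:- c, 1:] * q) z = poly_apply T q (T z - scale c z)"
proof -
  define n where "n = degree q"
  have Ti: "(T ^^ i) (T z - scale c z) = (T ^^ Suc i) z - scale c ((T ^^ i) z)" for i
    by (induction i) (simp_all add: endo_diff[OF T] endo_scale[OF T])
  have eq: "[:- c, 1:] * q = pCons 0 q - Polynomial.smult c q" by simp
  have "degree ([:- c, 1:] * q) \<le> Suc n"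
    using degree_mult_le[of "[:- c, 1:]" q] by (simp add: n_def)
  then have "poly_apply T ([:- c, 1:] * q) z = (\<Sum>i\<le>Suc n. scale (coeff (pCons 0 q - Polynomial.smult c q) i) ((T ^^ i) z))"
    unfolding eq by (rule poly_apply_le)
  also have "\<dots> = (\<Sum>i\<le>Suc n. scale (coeff (pCons 0 q) i) ((T ^^ i) z))
      - (\<Sum>i\<le>Suc n. scale (c * coeff q i) ((T ^^ i) z))"
    by (simp add: scale_left_diff_distrib sum_subtractf del: sum.atMost_Suc)
  also have "(\<Sum>i\<le>Suc n. scale (coeff (pCons 0 q) i) ((T ^^ i) z)) = (\<Sum>i\<le>n. scale (coeff q i) ((T ^^ Suc i) z))"
    by (subst sum.atMost_Suc_shift) simp
  also have "(\<Sum>i\<le>Suc n. scale (c * coeff q i) ((T ^^ i) z)) = (\<Sum>i\<le>n. scale (c * coeff q i) ((T ^^ i) z))"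
    by (simp add: n_def coeff_eq_0)
  finally show ?thesis
    unfolding poly_apply_def n_def[symmetric] Ti
    by (simp add: scale_right_diff_distrib sum_subtractf mult.commute del: funpow.simps)
qed

text \<open>A nonzero polynomial \<open>p\<close> with \<open>p(T) z = 0\<close> is split into linear factors; the first one to kill its
argument produces the eigenvector.\<close>

lemma eigenvector:
  assumes T: "endo T" and V: "subspace V" "\<And>x. x \<in> V \<Longrightarrow> T x \<in> V" and x: "x \<in> V" "x \<noteq> 0"
  obtains c y where "y \<in> V" "y \<noteq> 0" "T y = scale c y"
proof -
  have *: "\<exists>c y. y \<in> V \<and> y \<noteq> 0 \<and> T y = scale c y"
    if "degree p = d" "p \<noteq> 0" "z \<in> V" "z \<noteq> 0" "poly_apply T p z = 0" for p d z
    using that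
  proof (induction d arbitrary: p z)
    case 0
    then show ?case by (auto simp: poly_apply_def leading_coeff_0_iff[of p, symmetric] simp del: leading_coeff_0_iff)
  next
    case (Suc d)
    then have "\<exists>c. poly p c = 0" by (intro alg_closed_imp_poly_has_root) simp
    then obtain c where "poly p c = 0" by blast
    then obtain q where q: "p = [:- c, 1:] * q" by (auto simp: poly_eq_0_iff_dvd elim: dvdE)
    define w where "w = T z - scale c z"
    have w: "w \<in> V" unfolding w_def using V Suc.prems by (intro subspace_diff subspace_scale) auto
    show ?case
    proof (cases "w = 0")
      case True
      then show ?thesis using Suc.prems by (auto simp: w_def)
    next
      case False
      have "q \<noteq> 0" using Suc.prems q by auto
      then have "degree q = d" using Suc.prems(1) unfolding q by (subst (asm) degree_mult_eq) auto
      moreover have "poly_apply T q w = 0" using Suc.prems(5) by (simp only: q poly_apply_linear_factor[OF T] w_def)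
      ultimately show ?thesis using Suc.IH \<open>q \<noteq> 0\<close> w False by blast
    qed
  qed
  obtain n c where n: "(T ^^ n) x = (\<Sum>j<n. scale (c j) ((T ^^ j) x))"
    using sequence_dependent[of "\<lambda>i. (T ^^ i) x"] by blast
  define p where "p = monom 1 n - (\<Sum>j<n. monom (c j) j)"
  have cp: "coeff p i = (if i = n then 1 else if i < n then - c i else 0)" for i
    by (auto simp: p_def coeff_sum)
  have dp: "degree p \<le> n" by (rule degree_le) (auto simp: cp)
  have "p \<noteq> 0" using cp[of n] by auto
  moreover have "poly_apply T p x = 0"
    unfolding poly_apply_le[OF dp] lessThan_Suc_atMost[symmetric]
    by (simp add: cp n sum_negf)
  ultimately show ?thesis using *[OF HOL.refl _ x] that by blast
qed

text \<open>The last clause says that the left ideal \<open>H e\<close> is minimal.\<close>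

definition primitive :: "'h \<Rightarrow> bool" where
  "primitive e \<longleftrightarrow> e \<noteq> 0 \<and> e * e = e \<and> (\<forall>a. a * e \<noteq> 0 \<longrightarrow> (\<exists>b. b * (a * e) = e))"

lemma primitiveD: "primitive e \<Longrightarrow> a * e \<noteq> 0 \<Longrightarrow> \<exists>b. b * (a * e) = e"
  by (simp add: primitive_def)

text \<open>Schur's lemma for \<open>e H e = End (H e)\<close>: right multiplication by \<open>e a e\<close> has an eigenvector in \<open>H e\<close>, which
generates \<open>H e\<close>.\<close>

lemma primitive_corner:
  assumes e: "primitive e"
  shows "\<exists>c. e * a * e = scale c e"
proof -
  define V where "V = {x. x * e = x}"
  have "subspace V" by (auto simp: V_def subspace_def lin_simps)
  moreover have "x * (e * a * e) \<in> V" for x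
    using e by (simp add: V_def primitive_def mult.assoc)
  moreover have "e \<in> V" "e \<noteq> 0" using e by (auto simp: V_def primitive_def)
  ultimately obtain c y where y: "y \<in> V" "y \<noteq> 0" "y * (e * a * e) = scale c y"
    using eigenvector[OF endo_mult_right[of "e * a * e"], of V e] by metis
  then have "y * e = y" by (simp add: V_def)
  then obtain b where b: "b * y = e"
    using primitiveD[OF e, of y] y(2) by auto
  have "e * a * e = e * (e * a * e)" using e by (simp add: primitive_def flip: mult.assoc)
  also have "\<dots> = b * (y * (e * a * e))" by (simp add: b flip: mult.assoc)
  also have "\<dots> = scale c e" by (simp add: y(3) lin_simps b)
  finally show ?thesis by blast
qed

lemma left_ideal_primitive:
  assumes K: "left_ideal K" "y \<in> K" "y \<noteq> 0"
  obtains e where "primitive e" "e \<in> K"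
proof -
  define P where "P I \<longleftrightarrow> left_ideal I \<and> I \<subseteq> K \<and> (\<exists>x\<in>I. x \<noteq> 0)" for I
  have "P K" using K by (auto simp: P_def)
  then obtain I where I: "P I" "\<And>I'. P I' \<Longrightarrow> dim I \<le> dim I'"
    using ex_has_least_nat[of P K dim] by blast
  have lI: "left_ideal I" using I(1) by (simp add: P_def)
  obtain e where e: "e \<in> I" "\<And>x. x \<in> I \<Longrightarrow> x * e = x"
    using left_ideal_complement[OF lI] by blast
  have "\<exists>b. b * (a * e) = e" if a: "a * e \<noteq> 0" for a
  proof -
    define I' where "I' = range (\<lambda>b. b * (a * e))"
    have "left_ideal I'"
      unfolding left_ideal_def I'_def
      by (auto simp: distrib_right[symmetric] mult.assoc[symmetric] intro: range_eqI[of _ _ 0])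
    moreover have sub: "I' \<subseteq> I"
      unfolding I'_def using lI e(1) by (auto simp: left_ideal_def)
    moreover have "a * e \<in> I'" unfolding I'_def by (rule range_eqI[of _ _ 1]) simp
    ultimately have "P I'" using a I(1) by (auto simp: P_def)
    then have "dim I \<le> dim I'" by (rule I(2))
    then have "I' = I"
      using \<open>left_ideal I'\<close> lI sub by (intro subspace_dim_equal left_ideal_subspace)
    then have "e \<in> range (\<lambda>b. b * (a * e))" using e(1) by (simp add: I'_def)
    then show ?thesis by (metis rangeE)
  qed
  moreover have "e \<noteq> 0" using e(2) I(1) by (force simp: P_def)
  ultimately have "primitive e" using e by (auto simp: primitive_def)
  moreover have "e \<in> K" using I(1) e(1) by (auto simp: P_def)
  ultimately show ?thesis by (rule that)
qed

lemma of_nat_mult_eq_scale: "of_nat n * a = scale (of_nat n) a"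
  by (induction n) (auto simp: scale_left_distrib distrib_right)

lemma inverse_powers:
  fixes a b :: 'h
  assumes "a * b = 1"
  shows "a ^ n * b ^ n = 1"
proof (induction n)
  case (Suc n)
  have "a ^ Suc n * b ^ Suc n = a ^ n * (a * b) * b ^ n"
    unfolding power_Suc2[of a] power_Suc[of b] by (simp only: mult.assoc)
  then show ?case using Suc assms by simp
qed simp

text \<open>Right multiplication by \<open>v\<close> has an eigenvalue \<open>c\<close> on \<open>H f\<close>, and a minimal left ideal \<open>H e0\<close> of its
eigenspace satisfies \<open>e0 v = c e0\<close>.  Averaging \<open>f e0\<close> over conjugation by the powers of \<open>v\<close>, a finite
group since \<open>v ^ M\<close> is central, yields an idempotent that is an eigenvector on both sides.\<close>

lemma primitive_eigen:
  assumes v: "v * vi = 1" "vi * v = 1" and M: "M > 0" "\<And>a. v ^ M * a = a * v ^ M"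
    and f: "f * f = f" "f \<noteq> 0" "f * v = v * f"
  obtains e c where "primitive e" "f * e = e" "e * f = e" "v * e = scale c e" "e * v = scale c e"
proof -
  define V where "V = {x. x * f = x}"
  have V: "subspace V" "\<And>x. x \<in> V \<Longrightarrow> x * v \<in> V" "f \<in> V"
    using f by (auto simp: V_def subspace_def lin_simps mult.assoc) (metis mult.assoc)
  obtain c y where y: "y \<in> V" "y \<noteq> 0" "y * v = scale c y"
    using eigenvector[OF endo_mult_right[of v] V(1) V(2) V(3) f(2)] by blast
  define K where "K = {x. x * f = x \<and> x * v = scale c x}"
  have "left_ideal K" by (auto simp: K_def left_ideal_def lin_simps mult.assoc)
  then obtain e0 where e0: "primitive e0" "e0 \<in> K"
    using left_ideal_primitive[of K y] y by (auto simp: K_def V_def)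
  have e0': "e0 * f = e0" "e0 * v = scale c e0" "e0 * e0 = e0" "e0 \<noteq> 0"
    using e0 by (auto simp: K_def primitive_def)
  have c: "c \<noteq> 0"
  proof
    assume "c = 0"
    then have "e0 * v * vi = 0" using e0' by simp
    then have "e0 * (v * vi) = 0" by (simp only: mult.assoc)
    then show False using v(1) e0'(4) by simp
  qed
  have e0vi: "e0 * vi ^ k = scale (inverse c ^ k) e0" for k
  proof (induction k)
    case (Suc k)
    have "scale c (e0 * vi) = e0 * v * vi" by (simp add: e0' lin_simps)
    then have "scale c (e0 * vi) = e0" by (simp add: mult.assoc v)
    then have "scale (inverse c) (scale c (e0 * vi)) = scale (inverse c) e0" by (simp only:)
    then have "e0 * vi = scale (inverse c) e0" using c by simp
    then show ?case using Suc by (simp add: power_Suc2 lin_simps flip: mult.assoc del: power_Suc)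
  qed simp
  have fvi: "f * vi ^ k = vi ^ k * f" for k
  proof (induction k)
    case (Suc k)
    have "f * vi = vi * (v * f) * vi" using v by (simp flip: mult.assoc)
    also have "\<dots> = vi * f" unfolding f(3)[symmetric] using v by (simp add: mult.assoc)
    finally have "f * vi = vi * f" .
    then show ?case using Suc by (simp flip: mult.assoc) (simp add: mult.assoc)
  qed simp
  have viM: "vi ^ M * a = a * vi ^ M" for a
  proof -
    have "vi ^ M * a = vi ^ M * (a * v ^ M) * vi ^ M"
      using inverse_powers[OF v(1), of M] by (simp add: mult.assoc)
    also have "\<dots> = (vi ^ M * v ^ M) * a * vi ^ M" by (simp only: M(2) mult.assoc)
    finally show ?thesis using inverse_powers[OF v(2), of M] by simp
  qed
  \<comment> \<open>if \<open>x * v = scale c x\<close>, then \<open>P * x\<close> is the average of the conjugates \<open>vi ^ k * x * v ^ k\<close>\<close>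
  define P where "P = scale (inverse (of_nat M)) (\<Sum>k<M. scale (c ^ k) (vi ^ k))"
  have e0P: "e0 * P = e0"
    using c M(1) by (simp add: P_def lin_simps sum_distrib_left e0vi of_nat_mult_eq_scale flip: power_mult_distrib)
  have fP: "f * P = P * f"
    by (simp add: P_def lin_simps sum_distrib_left sum_distrib_right fvi)
  define x where "x = f * e0"
  define e where "e = P * x"
  have ve: "v * e = scale c e"
  proof -
    define g where "g k = scale (c ^ k) (v * vi ^ k * x)" for k
    have "g M = scale (c ^ M) (v * x * vi ^ M)" by (simp add: g_def mult.assoc viM)
    also have "\<dots> = g 0" using c by (simp add: g_def x_def mult.assoc e0vi lin_simps flip: power_mult_distrib)
    finally have gM: "g M = g 0" .
    have gS: "g (Suc k) = scale (c ^ k) (scale c (vi ^ k * x))" for k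
      using v(1) by (simp add: g_def mult.commute[of c] flip: mult.assoc)
    have "(\<Sum>k<M. g k - g (Suc k)) = g 0 - g M" by (rule sum_lessThan_telescope')
    then have "(\<Sum>k<M. g k) = (\<Sum>k<M. g (Suc k))" by (simp add: gM sum_subtractf)
    moreover have "v * e = scale (inverse (of_nat M)) (\<Sum>k<M. g k)"
      by (simp add: e_def P_def g_def lin_simps sum_distrib_left sum_distrib_right mult.assoc)
    moreover have "scale c e = scale (inverse (of_nat M)) (\<Sum>k<M. g (Suc k))"
      by (simp add: e_def P_def gS lin_simps sum_distrib_right scale_sum_right)
    ultimately show ?thesis by simp
  qed
  have fx: "f * x = x" by (simp add: x_def f flip: mult.assoc)
  have e0e: "e0 * e = e0" by (simp add: e_def x_def e0P e0' flip: mult.assoc)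
  have xe: "x * e = x" by (simp add: x_def mult.assoc e0e)
  have "primitive e"
    unfolding primitive_def
  proof (intro conjI allI impI)
    show "e \<noteq> 0" using e0e e0'(4) by auto
    show "e * e = e" by (simp add: e_def mult.assoc xe[unfolded e_def])
    fix a assume "a * e \<noteq> 0"
    then have "(a * P * f) * e0 \<noteq> 0" by (simp add: e_def x_def mult.assoc)
    then obtain b where "b * ((a * P * f) * e0) = e0" using primitiveD[OF e0(1)] by blast
    then have "(P * f * b) * (a * e) = e" by (simp add: e_def x_def mult.assoc)
    then show "\<exists>b. b * (a * e) = e" by blast
  qed
  moreover have "f * e = e" by (simp add: e_def fP fx mult.assoc flip: mult.assoc[of f P])
  moreover have "e * f = e" by (simp add: e_def x_def mult.assoc e0')
  moreover have "e * v = scale c e" by (simp add: e_def x_def mult.assoc e0' lin_simps)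
  ultimately show ?thesis using that ve by blast
qed

text \<open>An orthogonal family of primitive idempotents of maximal size: if its sum were not \<open>1\<close>, then
\<open>primitive_eigen\<close> would apply to the complementary idempotent and enlarge it.\<close>

lemma complete_primitives:
  assumes v: "v * vi = 1" "vi * v = 1" and M: "M > 0" "\<And>a. v ^ M * a = a * v ^ M"
  obtains J w where "finite J" "\<And>e. e \<in> J \<Longrightarrow> primitive e" "\<And>e. e \<in> J \<Longrightarrow> v * e = scale (w e) e"
    "\<And>e. e \<in> J \<Longrightarrow> e * v = scale (w e) e" "\<And>e e'. e \<in> J \<Longrightarrow> e' \<in> J \<Longrightarrow> e \<noteq> e' \<Longrightarrow> e * e' = 0" "\<Sum>J = 1"
proof -
  define P where "P J \<longleftrightarrow> finite J \<and> (\<forall>e\<in>J. primitive e \<and> (\<exists>c. v * e = scale c e \<and> e * v = scale c e)) \<and>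
      (\<forall>e\<in>J. \<forall>e'\<in>J. e \<noteq> e' \<longrightarrow> e * e' = 0)" for J
  have mulJ: "e * (\<Sum>x\<in>J. scale (r x) x) = scale (r e) e" "(\<Sum>x\<in>J. scale (r x) x) * e = scale (r e) e"
    if "P J" "e \<in> J" for J e r
  proof -
    have *: "e * x = (if x = e then e else 0)" "x * e = (if x = e then e else 0)" if "x \<in> J" for x
      using \<open>P J\<close> \<open>e \<in> J\<close> that unfolding P_def primitive_def by auto
    have "finite J" using \<open>P J\<close> by (simp add: P_def)
    then show "e * (\<Sum>x\<in>J. scale (r x) x) = scale (r e) e" "(\<Sum>x\<in>J. scale (r x) x) * e = scale (r e) e"
      using that(2) by (simp_all add: sum_distrib_left sum_distrib_right lin_simps * if_distrib[of "scale _"] cong: if_cong)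
  qed
  have bound: "card J \<le> dimension" if J: "P J" for J
  proof -
    have fJ: "finite J" using J by (simp add: P_def)
    have "independent J"
    proof (rule independent_if_scalars_zero[OF fJ])
      fix r e assume "(\<Sum>x\<in>J. scale (r x) x) = 0" "e \<in> J"
      then show "r e = 0" using mulJ(1)[OF J, of e r] J by (auto simp: P_def primitive_def)
    qed
    then show ?thesis using independent_card_le_dim[of J UNIV] by (simp add: dimension_def)
  qed
  have "P {}" by (simp add: P_def)
  then obtain J where J: "P J" "\<And>J'. P J' \<Longrightarrow> card J' \<le> card J"
    using ex_has_greatest_nat[of P "{}" card "Suc dimension"] bound by (metis le_imp_less_Suc)
  define f where "f = 1 - \<Sum>J"
  have Jf: "e * f = 0" "f * e = 0" if "e \<in> J" for e
    using mulJ[OF J(1) that, of "\<lambda>_. 1"] by (auto simp: f_def algebra_simps)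
  have "\<Sum>J = 1"
  proof (rule ccontr)
    assume "\<Sum>J \<noteq> 1"
    then have f0: "f \<noteq> 0" by (auto simp: f_def)
    have ff: "f * f = f"
    proof -
      have "f * f = f - f * \<Sum>J" by (simp add: f_def right_diff_distrib)
      then show ?thesis using Jf by (simp add: sum_distrib_left)
    qed
    have "v * \<Sum>J = \<Sum>J * v"
      unfolding sum_distrib_left sum_distrib_right
      using J(1) by (intro sum.cong HOL.refl) (auto simp: P_def)
    then have "f * v = v * f" by (simp add: f_def algebra_simps)
    then obtain e c where e: "primitive e" "f * e = e" "e * f = e" "v * e = scale c e" "e * v = scale c e"
      using primitive_eigen[OF v M ff f0] by blast
    have eJ: "x * e = 0" "e * x = 0" if "x \<in> J" for x
      using Jf[OF that] mult.assoc[of x f e] mult.assoc[of e f x] by (simp_all add: e(2,3))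
    have "e \<notin> J" using eJ e(1) by (auto simp: primitive_def)
    moreover have "P (insert e J)" using J(1) e eJ by (auto simp: P_def)
    ultimately show False using J(2)[of "insert e J"] J(1) by (simp add: P_def)
  qed
  moreover obtain w where "\<forall>e\<in>J. v * e = scale (w e) e \<and> e * v = scale (w e) e"
    using J(1) bchoice[of J "\<lambda>e c. v * e = scale c e \<and> e * v = scale c e"] by (auto simp: P_def)
  ultimately show ?thesis using J(1) that[of J w] by (auto simp: P_def)
qed

end

section \<open>Sums of ratios of roots of unity\<close>

text \<open>The order as a divisibility property, which is how it is used.\<close>

definition has_order :: "'a::monoid_mult \<Rightarrow> nat \<Rightarrow> bool" where
  "has_order x d \<longleftrightarrow> d > 0 \<and> (\<forall>t. x ^ t = 1 \<longleftrightarrow> d dvd t)"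

lemma ex_has_order:
  fixes x :: "'a::monoid_mult"
  assumes "x ^ M = 1" "M > 0"
  shows "\<exists>d. has_order x d"
proof -
  define d where "d = (LEAST d. d > 0 \<and> x ^ d = 1)"
  have d: "d > 0" "x ^ d = 1"
    unfolding d_def using LeastI[of "\<lambda>d. d > 0 \<and> x ^ d = 1" M] assms by auto
  have "x ^ t = 1 \<longleftrightarrow> d dvd t" for t
  proof
    assume "d dvd t"
    then show "x ^ t = 1" using d by (auto simp: power_mult)
  next
    assume t: "x ^ t = 1"
    have "x ^ (d * (t div d)) * x ^ (t mod d) = 1" using t by (simp flip: power_add)
    then have "x ^ (t mod d) = 1" using d by (simp add: power_mult)
    moreover have "t mod d < d" using d by simp
    ultimately have "t mod d = 0"
      using not_less_Least[of "t mod d" "\<lambda>d. d > 0 \<and> x ^ d = 1"] unfolding d_def[symmetric] by auto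
    then show "d dvd t" by auto
  qed
  with d show ?thesis unfolding has_order_def by blast
qed

lemma has_order_power:
  "has_order x (k * l) \<Longrightarrow> has_order (x ^ k) l"
  by (auto simp: has_order_def simp flip: power_mult)

lemma has_order_mult:
  fixes x y :: "'a::comm_monoid_mult"
  assumes "has_order x a" "has_order y b" "coprime a b"
  shows "has_order (x * y) (a * b)"
proof -
  have xa: "x ^ a = 1" and yb: "y ^ b = 1" using assms(1,2) by (auto simp: has_order_def)
  have "(x * y) ^ t = 1 \<longleftrightarrow> a * b dvd t" for t
  proof
    assume t: "(x * y) ^ t = 1"
    have "1 = ((x * y) ^ t) ^ a" using t by simp
    also have "\<dots> = (x ^ a) ^ t * y ^ (t * a)"
      by (simp add: power_mult_distrib mult.commute flip: power_mult)
    finally have "y ^ (t * a) = 1" by (simp add: xa)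
    then have "b dvd t * a" using assms(2) by (simp add: has_order_def)
    then have "b dvd t" using assms(3) by (simp add: coprime_commute coprime_dvd_mult_left_iff)
    have "1 = ((x * y) ^ t) ^ b" using t by simp
    also have "\<dots> = x ^ (t * b) * (y ^ b) ^ t"
      by (simp add: power_mult_distrib mult.commute flip: power_mult)
    finally have "x ^ (t * b) = 1" by (simp add: yb)
    then have "a dvd t * b" using assms(1) by (simp add: has_order_def)
    then have "a dvd t" using assms(3) by (simp add: coprime_dvd_mult_left_iff)
    with \<open>b dvd t\<close> show "a * b dvd t" using assms(3) by (intro divides_mult)
  next
    assume "a * b dvd t"
    then have "a dvd t" "b dvd t" by (auto dest: dvd_mult_left dvd_mult_right)
    then show "(x * y) ^ t = 1" using assms(1,2) unfolding has_order_def power_mult_distrib by (metis mult_1)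
  qed
  then show ?thesis using assms by (simp add: has_order_def)
qed

text \<open>The \<open>d\<close> distinct powers of \<open>z\<close> exhaust the roots of \<open>X^d - 1\<close>.\<close>

lemma roots_of_unity_powers:
  fixes z x :: "'a::field"
  assumes z: "has_order z d" and x: "x ^ d = 1"
  shows "\<exists>n. x = z ^ n"
proof -
  have d: "d > 0" using z by (simp add: has_order_def)
  have "inj_on (\<lambda>n. z ^ n) {..<d}"
  proof (rule linorder_inj_onI')
    fix i j assume ij: "i \<in> {..<d}" "j \<in> {..<d}" "i < j"
    show "z ^ i \<noteq> z ^ j"
    proof
      assume eq: "z ^ i = z ^ j"
      have "z ^ d = 1" using z by (simp add: has_order_def)
      then have "z \<noteq> 0" using d by (auto simp: power_0_left)
      moreover have "z ^ i * z ^ (j - i) = z ^ j" using ij by (simp flip: power_add)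
      then have "z ^ i * z ^ (j - i) = z ^ i" by (simp add: eq)
      ultimately have "z ^ (j - i) = 1" by simp
      then have "d dvd j - i" using z by (simp add: has_order_def)
      then show False using ij by (auto dest: dvd_imp_le)
    qed
  qed
  then have card: "card ((\<lambda>n. z ^ n) ` {..<d}) = d" by (simp add: card_image)
  define p :: "'a poly" where "p = monom 1 d - 1"
  have "coeff p d = 1" using d by (simp add: p_def)
  then have p0: "p \<noteq> 0" by auto
  have pd: "degree p \<le> d" unfolding p_def by (intro degree_diff_le degree_monom_le) simp
  have roots: "{y. poly p y = 0} = {y. y ^ d = 1}" by (simp add: p_def poly_monom)
  have "z ^ n \<in> {y. y ^ d = 1}" for n
    using z by (simp add: has_order_def flip: power_mult)
  then have "(\<lambda>n. z ^ n) ` {..<d} \<subseteq> {y. y ^ d = 1}" by auto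
  moreover have "finite {y::'a. y ^ d = 1}" using poly_roots_finite[OF p0] roots by simp
  moreover have "card {y::'a. y ^ d = 1} \<le> d" using card_poly_roots_bound[OF p0] pd roots by simp
  ultimately have "(\<lambda>n. z ^ n) ` {..<d} = {y. y ^ d = 1}"
    using card by (intro card_seteq) auto
  then show ?thesis using x by auto
qed

text \<open>Take a root of unity of maximal order \<open>d\<close>.  If the order \<open>e\<close> of another one did not divide \<open>d\<close>, the
part of it for a prime \<open>p\<close> with larger exponent in \<open>e\<close> could be combined with the \<open>p\<close>-free part of
the first one to a root of larger order.\<close>

lemma roots_of_unity_cyclic:
  fixes M :: nat
  assumes M: "M > 0"
  shows "\<exists>z::'a::field. z ^ M = 1 \<and> (\<forall>x. x ^ M = 1 \<longrightarrow> (\<exists>n. x = z ^ n))"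
proof -
  define P where "P d \<longleftrightarrow> (\<exists>z::'a. z ^ M = 1 \<and> has_order z d)" for d
  have "has_order (1::'a) 1" by (simp add: has_order_def)
  then have "P 1" unfolding P_def by (intro exI[of _ 1]) simp
  moreover have bound: "d \<le> M" if "P d" for d
    using that M by (auto simp: P_def has_order_def dest: dvd_imp_le)
  ultimately obtain d where d: "P d" "\<And>d'. P d' \<Longrightarrow> d' \<le> d"
    using ex_has_greatest_nat[of P 1 "\<lambda>d. d" "Suc M"] by (metis le_imp_less_Suc)
  obtain z :: 'a where z: "z ^ M = 1" "has_order z d" using d(1) by (auto simp: P_def)
  have d0: "d > 0" using z by (simp add: has_order_def)
  have "\<exists>n. x = z ^ n" if x: "x ^ M = 1" for x :: 'a
  proof -
    obtain e where e: "has_order x e" using ex_has_order[OF x M] by blast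
    have e0: "e > 0" using e by (simp add: has_order_def)
    have "e dvd d"
    proof (rule ccontr)
      assume "\<not> e dvd d"
      then obtain p where p: "prime p" "multiplicity p d < multiplicity p e"
        using multiplicity_le_imp_dvd[of e d] e0 by (metis linorder_not_less neq0_conv)
      define k where "k = multiplicity p d"
      obtain d' where d': "d = p ^ k * d'" "\<not> p dvd d'"
        unfolding k_def using multiplicity_decompose'[of d p] p(1) d0 by (metis not_prime_unit neq0_conv)
      have "p ^ Suc k dvd e" using p(2) by (intro multiplicity_dvd') (simp add: k_def)
      then obtain e' where e': "e = e' * p ^ Suc k" by (metis dvdE mult.commute)
      have "has_order (z ^ (p ^ k)) d'" using z(2) d'(1) by (intro has_order_power) simp
      moreover have "has_order (x ^ e') (p ^ Suc k)" using e e' by (intro has_order_power) simp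
      moreover have "coprime d' (p ^ Suc k)"
        using d'(2) p(1) by (metis coprime_commute coprime_power_right_iff prime_imp_coprime)
      ultimately have "has_order (z ^ (p ^ k) * x ^ e') (d' * p ^ Suc k)" by (rule has_order_mult)
      moreover have "(z ^ (p ^ k) * x ^ e') ^ M = 1"
      proof -
        have "(z ^ (p ^ k) * x ^ e') ^ M = (z ^ M) ^ (p ^ k) * (x ^ M) ^ e'"
          by (simp add: power_mult_distrib mult.commute flip: power_mult)
        then show ?thesis using z x by simp
      qed
      ultimately have "P (d' * p ^ Suc k)" unfolding P_def by blast
      then have "d' * p ^ Suc k \<le> d" by (rule d(2))
      then have "d * p \<le> d" using d'(1) by (simp add: mult_ac)
      then show False using d0 prime_gt_1_nat[OF p(1)] by simp
    qed
    then have "x ^ d = 1" using e by (simp add: has_order_def)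
    then show ?thesis using roots_of_unity_powers[OF z(2)] by blast
  qed
  with z(1) show ?thesis by blast
qed

definition rat_eval :: "rat poly \<Rightarrow> 'a::field_char_0 \<Rightarrow> 'a" where
  "rat_eval p x = poly (map_poly of_rat p) x"

lemma rat_eval_0 [simp]: "rat_eval 0 x = 0"
  and rat_eval_pCons [simp]: "rat_eval (pCons a p) x = of_rat a + x * rat_eval p x"
  by (simp_all add: rat_eval_def map_poly_pCons)

lemma rat_eval_add [simp]: "rat_eval (p + q) x = rat_eval p x + rat_eval q x"
  by (induction p q rule: poly_induct2) (auto simp: of_rat_add algebra_simps)

lemma rat_eval_smult [simp]: "rat_eval (Polynomial.smult a p) x = of_rat a * rat_eval p x"
  by (induction p) (auto simp: of_rat_mult algebra_simps)

lemma rat_eval_mult [simp]: "rat_eval (p * q) x = rat_eval p x * rat_eval q x"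
  by (induction p) (auto simp: algebra_simps)

lemma rat_eval_monom [simp]: "rat_eval (monom a n) x = of_rat a * x ^ n"
  by (simp add: rat_eval_def map_poly_monom poly_monom)

lemma rat_eval_diff [simp]: "rat_eval (p - q) x = rat_eval p x - rat_eval q x"
  using rat_eval_add[of "p - q" q x] by (simp add: algebra_simps)

lemma rat_eval_sum [simp]: "rat_eval (sum f A) x = (\<Sum>i\<in>A. rat_eval (f i) x)"
  by (induction A rule: infinite_finite_induct) auto

text \<open>A complex root of the minimal polynomial of \<open>z\<close> over the rationals.  This transfers a vanishing
polynomial expression from an abstract field to the complex numbers without embedding the field.\<close>

lemma rat_polys_common_complex_root:
  fixes z :: "'a::field_char_0"
  assumes "p \<noteq> 0" "rat_eval p z = 0"
  shows "\<exists>w::complex. \<forall>q. rat_eval q z = 0 \<longrightarrow> rat_eval q w = 0"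
proof -
  define P where "P p \<longleftrightarrow> p \<noteq> 0 \<and> rat_eval p z = 0" for p
  obtain m where m: "P m" "\<And>q. P q \<Longrightarrow> degree m \<le> degree q"
    using ex_has_least_nat[of P p degree] assms by (auto simp: P_def)
  have m_dvd: "m dvd q" if q: "rat_eval q z = 0" for q
  proof (rule ccontr)
    assume n: "\<not> m dvd q"
    have "rat_eval q z = rat_eval (q div m) z * rat_eval m z + rat_eval (q mod m) z"
      by (simp only: div_mult_mod_eq flip: rat_eval_mult rat_eval_add)
    then have "rat_eval (q mod m) z = 0" using q m(1) by (simp add: P_def)
    then have "P (q mod m)" using n by (auto simp: P_def mod_eq_0_iff_dvd)
    then have "degree m \<le> degree (q mod m)" by (rule m(2))
    then show False using n m(1) degree_mod_less[of m q] by (auto simp: P_def mod_eq_0_iff_dvd)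
  qed
  have "degree m \<noteq> 0"
  proof
    assume "degree m = 0"
    then obtain a where "m = [:a:]" by (rule degree_eq_zeroE)
    then show False using m(1) by (simp add: P_def)
  qed
  then have "degree (map_poly of_rat m :: complex poly) > 0"
    by (subst degree_map_poly) auto
  then obtain w :: complex where "rat_eval m w = 0"
    unfolding rat_eval_def using alg_closed_imp_poly_has_root by blast
  then have "\<forall>q. rat_eval q z = 0 \<longrightarrow> rat_eval q w = 0" using m_dvd unfolding dvd_def by fastforce
  then show ?thesis ..
qed

lemma sum_equiv_classes:
  assumes J: "finite J" "equiv J R"
  shows "sum f R = (\<Sum>C\<in>J // R. sum f (C \<times> C))"
proof -
  have RJ: "R \<subseteq> J \<times> J" using J(2) by (auto simp: equiv_def refl_on_def)
  have "R = (\<Union>C\<in>J // R. C \<times> C)"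
  proof
    show "R \<subseteq> (\<Union>C\<in>J // R. C \<times> C)"
    proof (rule subrelI)
      fix i j assume ij: "(i, j) \<in> R"
      then have "i \<in> J" using RJ by auto
      then have "R `` {i} \<in> J // R" "i \<in> R `` {i}"
        by (rule quotientI, rule equiv_class_self[OF J(2)])
      with ij show "(i, j) \<in> (\<Union>C\<in>J // R. C \<times> C)" by blast
    qed
    show "(\<Union>C\<in>J // R. C \<times> C) \<subseteq> R"
      using in_quotient_imp_in_rel[OF J(2)] by blast
  qed
  moreover have "sum f (\<Union>C\<in>J // R. C \<times> C) = (\<Sum>C\<in>J // R. sum f (C \<times> C))"
  proof (rule sum.UNION_disjoint)
    show "finite (J // R)" by (rule finite_quotient[OF J(1) RJ])
    show "\<forall>C\<in>J // R. finite (C \<times> C)" using finite_equiv_class[OF J(1) RJ] by blast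
    show "\<forall>C\<in>J // R. \<forall>D\<in>J // R. C \<noteq> D \<longrightarrow> C \<times> C \<inter> D \<times> D = {}"
      using quotient_disj[OF J(2)] by blast
  qed
  ultimately show ?thesis by simp
qed

text \<open>After division by a representative of each class the \<open>w i\<close> become powers of one root of unity \<open>z\<close>, and
the sum becomes a rational polynomial in \<open>z\<close>.  If it vanished, so would the polynomial at some complex root of
unity \<open>u\<close>, where it equals \<open>\<Sum> |\<Sum> u ^ a i|\<^sup>2\<close>, the outer sum over the classes.  The singleton class contributes \<open>1\<close>.\<close>

lemma sum_ratios_nonzero:
  fixes w :: "'i \<Rightarrow> 'a::field_char_0"
  assumes J: "finite J" "equiv J R"
    and i0: "i0 \<in> J" "R `` {i0} = {i0}" and w: "\<And>i. i \<in> J \<Longrightarrow> w i \<noteq> 0" and M: "M > 0" "\<And>i j. (i, j) \<in> R \<Longrightarrow> (w i / w j) ^ M = 1"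
  shows "(\<Sum>(i, j)\<in>R. w i / w j) \<noteq> 0"
proof
  assume zero: "(\<Sum>(i, j)\<in>R. w i / w j) = 0"
  have RJ: "R \<subseteq> J \<times> J" using J(2) by (auto simp: equiv_def refl_on_def)
  have fR: "finite R" using RJ J(1) finite_subset by blast
  define rep where "rep i = (SOME j. (i, j) \<in> R)" for i
  have rep: "(i, rep i) \<in> R" if "i \<in> J" for i
    unfolding rep_def by (rule someI[of _ i]) (use that J(2) in \<open>auto simp: equiv_def refl_on_def\<close>)
  have rep_eq: "rep i = rep j" if "(i, j) \<in> R" for i j
  proof -
    have "R `` {i} = R `` {j}" using J(2) that by (rule equiv_class_eq)
    then have "(i, k) \<in> R \<longleftrightarrow> (j, k) \<in> R" for k by auto
    then show ?thesis by (simp add: rep_def)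
  qed
  obtain z :: 'a where z: "z ^ M = 1" "\<And>x. x ^ M = 1 \<Longrightarrow> \<exists>n. x = z ^ n"
    using roots_of_unity_cyclic[OF M(1), where 'a = 'a] by blast
  have "\<forall>i\<in>J. \<exists>n. w i / w (rep i) = z ^ n" using z(2) M(2) rep by blast
  then obtain a where a: "\<And>i. i \<in> J \<Longrightarrow> w i / w (rep i) = z ^ a i" by metis
  \<comment> \<open>conjugate exponents are kept nonnegative, in order to work with polynomials\<close>
  have zinv: "inverse (z ^ n) = z ^ ((M - 1) * n)" for n
  proof -
    have "z ^ n * z ^ ((M - 1) * n) = (z ^ M) ^ n"
      using M(1) by (simp add: algebra_simps flip: power_add power_mult)
    then have "z ^ n * z ^ ((M - 1) * n) = 1" by (simp add: z(1))
    then show ?thesis by (metis inverse_unique)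
  qed
  define f :: "rat poly" where "f = (\<Sum>(i, j)\<in>R. monom 1 (a i + (M - 1) * a j))"
  have ratio: "w i / w j = z ^ (a i + (M - 1) * a j)" if "(i, j) \<in> R" for i j
  proof -
    have ij: "i \<in> J" "j \<in> J" "rep i \<in> J" using that RJ rep[of i] by auto
    have "w i / w j = (w i / w (rep i)) * inverse (w j / w (rep j))"
      using w ij rep_eq[OF that] by (simp add: field_simps)
    then show ?thesis using a ij by (simp add: zinv power_add)
  qed
  have fz: "rat_eval f z = 0"
    using zero ratio by (simp add: f_def case_prod_unfold)
  have Xz: "rat_eval (monom 1 M - 1) z = 0" using z(1) by (simp add: one_pCons)
  have "coeff (monom 1 M - 1 :: rat poly) M = 1" using M(1) by simp
  then have "(monom 1 M - 1 :: rat poly) \<noteq> 0" by (metis coeff_0 zero_neq_one)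
  then obtain u :: complex where u: "\<And>q. rat_eval q z = 0 \<Longrightarrow> rat_eval q u = 0"
    using rat_polys_common_complex_root[OF _ Xz] by blast
  have uM: "u ^ M = 1" using u[OF Xz] by (simp add: one_pCons)
  have u1: "cmod u = 1" using power_eq_1_iff[OF uM] M(1) by simp
  have ucnj: "u ^ ((M - 1) * n) = cnj (u ^ n)" for n
  proof -
    have "u * u ^ (M - 1) = u * cnj u"
      using uM M(1) u1 by (simp add: complex_norm_square[symmetric] flip: power_Suc)
    moreover have "u \<noteq> 0" using u1 by auto
    ultimately have "u ^ (M - 1) = cnj u" by simp
    then show ?thesis by (simp add: power_mult)
  qed
  define s where "s C = (\<Sum>i\<in>C. u ^ a i)" for C
  have classes: "finite (J // R)" "\<And>C. C \<in> J // R \<Longrightarrow> finite C"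
    using finite_quotient[OF J(1) RJ] finite_equiv_class[OF J(1) RJ] by simp_all
  have "0 = rat_eval f u" using u[OF fz] by simp
  also have "\<dots> = (\<Sum>(i, j)\<in>R. u ^ a i * cnj (u ^ a j))"
    by (simp add: f_def case_prod_unfold power_add ucnj[simplified])
  also have "\<dots> = (\<Sum>C\<in>J // R. \<Sum>(i, j)\<in>C \<times> C. u ^ a i * cnj (u ^ a j))"
    by (rule sum_equiv_classes[OF J])
  also have "\<dots> = (\<Sum>C\<in>J // R. s C * cnj (s C))"
    by (simp add: s_def sum_product sum.cartesian_product)
  also have "\<dots> = of_real (\<Sum>C\<in>J // R. (cmod (s C))\<^sup>2)"
    by (simp only: of_real_sum complex_norm_square)
  finally have "(\<Sum>C\<in>J // R. (cmod (s C))\<^sup>2) = 0" by (metis of_real_eq_0_iff)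
  then have "(cmod (s {i0}))\<^sup>2 = 0"
    using classes(1) i0 by (subst (asm) sum_nonneg_eq_0_iff) (auto intro!: quotientI[of i0 J R, unfolded i0(2)])
  then show False using u1 by (simp add: s_def norm_power)
qed

section \<open>Matrix units\<close>

text \<open>A basis \<open>E i j\<close> of \<open>H\<close>, indexed by the pairs of an equivalence relation \<open>R\<close>, that multiplies like matrix
units; the blocks of \<open>H\<close> are the classes of \<open>R\<close>.  The functionals \<open>entry\<close> are the matrix entries, and \<open>S\<^sup>2\<close> acts
diagonally.\<close>

locale matrix_units = semisimple_hopf_algebra scale \<Delta> \<epsilon> S
  for scale :: "'k::{alg_closed_field, field_char_0} \<Rightarrow> 'h::ring_1 \<Rightarrow> 'h"
    and \<Delta> \<epsilon> S +
  fixes J :: "'h set" and R :: "('h \<times> 'h) set" and E :: "'h \<Rightarrow> 'h \<Rightarrow> 'h"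
    and entry :: "'h \<Rightarrow> 'h \<Rightarrow> 'h \<Rightarrow> 'k" and w :: "'h \<Rightarrow> 'k"
  assumes fin_J: "finite J"
    and equiv_R: "equiv J R"
    and E_mult: "(i, j) \<in> R \<Longrightarrow> (k, l) \<in> R \<Longrightarrow> E i j * E k l = (if j = k then E i l else 0)"
    and E_sum: "(\<Sum>i\<in>J. E i i) = 1"
    and entry_expand: "(\<Sum>(i, j)\<in>R. scale (entry i j h) (E i j)) = h"
    and functional_entry: "functional (entry i j)"
    and entry_E: "(i, j) \<in> R \<Longrightarrow> (k, l) \<in> R \<Longrightarrow> entry i j (E k l) = (if i = k \<and> j = l then 1 else 0)"
    and S2_E: "(i, j) \<in> R \<Longrightarrow> S (S (E i j)) = scale (w i / w j) (E i j)"
    and w_nonzero: "i \<in> J \<Longrightarrow> w i \<noteq> 0"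
begin

lemma R_J: "(i, j) \<in> R \<Longrightarrow> i \<in> J \<and> j \<in> J"
  using equiv_R by (auto simp: equiv_def refl_on_def)

lemma R_refl: "i \<in> J \<Longrightarrow> (i, i) \<in> R"
  using equiv_R by (simp add: equiv_def refl_on_def)

lemma R_sym: "(i, j) \<in> R \<Longrightarrow> (j, i) \<in> R"
  using equiv_R by (auto simp: equiv_def dest: symD)

lemma R_trans: "(i, j) \<in> R \<Longrightarrow> (j, k) \<in> R \<Longrightarrow> (i, k) \<in> R"
  using equiv_R by (auto simp: equiv_def dest: transD)

lemma fin_R: "finite R"
  using fin_J R_J by (intro finite_subset[of R "J \<times> J"]) auto

lemma entry_add: "entry i j (x + y) = entry i j x + entry i j y" and entry_scale: "entry i j (scale r x) = r * entry i j x"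
  using functional_entry by (auto simp: functional_def)

lemma tr_E: "tr F = (\<Sum>(i, j)\<in>R. entry i j (F (E i j)))" if "endo F"
proof -
  have "tr F = (\<Sum>z\<in>R. entry (fst z) (snd z) (F (E (fst z) (snd z))))"
  proof (rule tr_expand[where \<phi> = "\<lambda>z. entry (fst z) (snd z)" and x = "\<lambda>z. F (E (fst z) (snd z))"])
    fix h
    have "F h = F (\<Sum>(i, j)\<in>R. scale (entry i j h) (E i j))" by (simp only: entry_expand)
    then show "F h = (\<Sum>z\<in>R. scale (entry (fst z) (snd z) h) (F (E (fst z) (snd z))))"
      by (simp add: endo_sum[OF that] endo_scale[OF that] case_prod_unfold)
  qed (rule functional_entry)
  then show ?thesis by (simp add: case_prod_unfold)
qed

lemma entry_mult_E_left:
  assumes "(i, j) \<in> R" "(k, l) \<in> R"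
  shows "entry i j (h * E k l) = (if j = l then entry i k h else 0)"
proof -
  have "entry i j (h * E k l) = entry i j ((\<Sum>(a, b)\<in>R. scale (entry a b h) (E a b)) * E k l)"
    by (simp only: entry_expand)
  also have "\<dots> = (\<Sum>(a, b)\<in>R. entry a b h * entry i j (E a b * E k l))"
    by (simp add: sum_distrib_right lin_simps functional_sum[OF functional_entry] entry_scale case_prod_unfold)
  also have "\<dots> = (\<Sum>z\<in>R. if z = (i, k) then (if j = l then entry i k h else 0) else 0)"
  proof (intro sum.cong HOL.refl, clarify)
    fix a b assume ab: "(a, b) \<in> R"
    show "entry a b h * entry i j (E a b * E k l) = (if (a, b) = (i, k) then (if j = l then entry i k h else 0) else 0)"
      using ab assms functional_zero[OF functional_entry] R_trans[of a b l]
      by (cases "b = k") (auto simp: E_mult entry_E)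
  qed
  also have "\<dots> = (if j = l then entry i k h else 0)"
    using fin_R assms R_trans[of i l k] R_sym[of k l] by auto
  finally show ?thesis .
qed

lemma entry_mult_E_right:
  assumes "(i, j) \<in> R" "(k, l) \<in> R"
  shows "entry i j (E k l * h) = (if i = k then entry l j h else 0)"
proof -
  have "entry i j (E k l * h) = entry i j (E k l * (\<Sum>(a, b)\<in>R. scale (entry a b h) (E a b)))"
    by (simp only: entry_expand)
  also have "\<dots> = (\<Sum>(a, b)\<in>R. entry a b h * entry i j (E k l * E a b))"
    by (simp add: sum_distrib_left lin_simps functional_sum[OF functional_entry] entry_scale case_prod_unfold)
  also have "\<dots> = (\<Sum>z\<in>R. if z = (l, j) then (if i = k then entry l j h else 0) else 0)"
  proof (intro sum.cong HOL.refl, clarify)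
    fix a b assume ab: "(a, b) \<in> R"
    show "entry a b h * entry i j (E k l * E a b) = (if (a, b) = (l, j) then (if i = k then entry l j h else 0) else 0)"
      using ab assms functional_zero[OF functional_entry] R_trans[of k a b]
      by (cases "l = a") (auto simp: E_mult entry_E)
  qed
  also have "\<dots> = (if i = k then entry l j h else 0)"
    using fin_R assms R_trans[of l k j] R_sym[of k l] by auto
  finally show ?thesis .
qed

lemma sum_diagonal: "(\<Sum>(i, j)\<in>R. f i) = (\<Sum>(i, j)\<in>R. f j)"
proof -
  have "(\<Sum>(i, j)\<in>R. f i) = (\<Sum>(i, j)\<in>R\<inverse>. f j)"
    by (rule sum.reindex_bij_witness[of _ prod.swap prod.swap]) auto
  also have "R\<inverse> = R" using R_sym by auto
  finally show ?thesis .
qed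

lemma chi_eq: "chi h = (\<Sum>(i, j)\<in>R. entry i i h)"
  unfolding chi_def tr_E[OF endo_mult_left]
  by (intro sum.cong HOL.refl) (auto simp: entry_mult_E_left)

lemma tr_mult_right: "tr (\<lambda>x. x * h) = chi h"
  unfolding tr_E[OF endo_mult_right] chi_eq sum_diagonal[of "\<lambda>i. entry i i h"]
  by (intro sum.cong HOL.refl) (auto simp: entry_mult_E_right)

text \<open>The one-dimensional representation \<open>\<epsilon>\<close> lives on a block of size one: in a larger block \<open>\<epsilon>\<close> would take
equal values at two orthogonal idempotents.\<close>

lemma trivial_class: "\<exists>i\<in>J. R `` {i} = {i}"
proof -
  have "(\<Sum>i\<in>J. \<epsilon> (E i i)) = 1"
    using arg_cong[OF E_sum, of \<epsilon>] by (simp add: functional_sum[OF functional_eps] counit_one)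
  then obtain i where i: "i \<in> J" "\<epsilon> (E i i) \<noteq> 0"
    by (metis (no_types, lifting) sum.neutral zero_neq_one)
  have "j = i" if ij: "(i, j) \<in> R" for j
  proof (rule ccontr)
    assume ne: "j \<noteq> i"
    have ji: "(j, i) \<in> R" using ij by (rule R_sym)
    have jj: "(j, j) \<in> R" using R_J[OF ij] R_refl by blast
    have "\<epsilon> (E i i) = \<epsilon> (E i j * E j i)" "\<epsilon> (E j j) = \<epsilon> (E j i * E i j)"
      using ij ji by (simp_all add: E_mult)
    then have "\<epsilon> (E i i) = \<epsilon> (E j j)" by (simp add: counit_mult mult.commute)
    moreover have "\<epsilon> (E i i) * \<epsilon> (E j j) = \<epsilon> (E i i * E j j)" by (simp add: counit_mult)
    moreover have "E i i * E j j = 0" using R_refl[OF i(1)] jj ne by (simp add: E_mult)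
    ultimately show False using i(2) eps_zero by simp
  qed
  then have "R `` {i} = {i}" using R_refl[OF i(1)] by auto
  with i(1) show ?thesis by blast
qed

lemma tr_S2_nonzero: "tr (\<lambda>x. S (S x)) \<noteq> 0"
proof -
  have endo: "endo (\<lambda>x. S (S x))" by (auto simp: endo_def lin_simps)
  obtain M where M: "M > 0" "\<And>x. ((\<lambda>x. S (S x)) ^^ M) x = x" using S2_finite_order by blast
  have root: "(w i / w j) ^ M = 1" if ij: "(i, j) \<in> R" for i j
  proof -
    have "((\<lambda>x. S (S x)) ^^ n) (E i j) = scale ((w i / w j) ^ n) (E i j)" for n
      by (induction n) (auto simp: S_scale S2_E[OF ij] mult.commute)
    from this[of M] have "scale ((w i / w j) ^ M) (E i j) = E i j" by (simp add: M(2))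
    then have "entry i j (scale ((w i / w j) ^ M) (E i j)) = entry i j (E i j)" by simp
    then show ?thesis using ij by (simp add: entry_scale entry_E)
  qed
  obtain i where i: "i \<in> J" "R `` {i} = {i}" using trivial_class by blast
  have "tr (\<lambda>x. S (S x)) = (\<Sum>(i, j)\<in>R. w i / w j)"
    unfolding tr_E[OF endo] by (intro sum.cong HOL.refl) (auto simp: S2_E entry_scale entry_E)
  also have "\<dots> \<noteq> 0"
    using sum_ratios_nonzero[OF fin_J equiv_R i, of w M] w_nonzero M(1) root by blast
  finally show ?thesis .
qed

end

context semisimple_hopf_algebra
begin

text \<open>Take a complete set \<open>J\<close> of primitive idempotents that are eigenvectors of the element \<open>v\<close> implementing \<open>S\<^sup>2\<close>,
and relate \<open>e\<close> and \<open>e'\<close> if \<open>e H e' \<noteq> 0\<close>, that is, if \<open>H e\<close> and \<open>H e'\<close> are isomorphic.  Each \<open>e H e'\<close> has dimension at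
most one, and elements passing through a representative of each class are compatible generators.\<close>

lemma ex_matrix_units: "\<exists>J R E entry w. matrix_units scale \<Delta> \<epsilon> S J R E entry w"
proof -
  obtain v vi M where v: "v * vi = 1" "vi * v = 1" and S2: "\<And>a. S (S a) * v = v * a"
    and M: "M > 0" "\<And>a. v ^ M * a = a * v ^ M"
    using S2_inner by metis
  obtain J w where J: "finite J" "\<And>e. e \<in> J \<Longrightarrow> primitive e" "\<And>e. e \<in> J \<Longrightarrow> v * e = scale (w e) e"
    "\<And>e. e \<in> J \<Longrightarrow> e * v = scale (w e) e" "\<And>e e'. e \<in> J \<Longrightarrow> e' \<in> J \<Longrightarrow> e \<noteq> e' \<Longrightarrow> e * e' = 0" "\<Sum>J = 1"
    using complete_primitives[OF v M] by metis
  have idem: "e * e = e" and nz: "e \<noteq> 0" if "e \<in> J" for e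
    using J(2)[OF that] by (auto simp: primitive_def)
  define R where "R = {(e, e'). e \<in> J \<and> e' \<in> J \<and> (\<exists>a. e * a * e' \<noteq> 0)}"
  have generate: "\<exists>b. b * (e * a * e') = e'" if "e' \<in> J" "e * a * e' \<noteq> 0" for e e' a
    using primitiveD[OF J(2)[OF that(1)] that(2)] .
  have equiv: "equiv J R"
  proof (rule equivI)
    show "R \<subseteq> J \<times> J" by (auto simp: R_def)
    have "e * 1 * e \<noteq> 0" if "e \<in> J" for e using idem nz that by simp
    then show "refl_on J R" unfolding refl_on_def R_def by blast
    show "sym R"
    proof (rule symI)
      fix e e' assume "(e, e') \<in> R"
      then obtain a where a: "e \<in> J" "e' \<in> J" "e * a * e' \<noteq> 0" by (auto simp: R_def)
      obtain b where b: "b * (e * a * e') = e'" using generate[OF a(2,3)] by blast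
      have "(e' * b * e) * (a * e') = e' * (b * (e * a * e'))" by (simp only: mult.assoc)
      then have "(e' * b * e) * (a * e') \<noteq> 0" using b idem[OF a(2)] nz[OF a(2)] by simp
      then have "e' * b * e \<noteq> 0" by (metis mult_zero_left)
      then show "(e', e) \<in> R" using a by (auto simp: R_def)
    qed
    show "trans R"
    proof (rule transI)
      fix e e' e'' assume "(e, e') \<in> R" "(e', e'') \<in> R"
      then obtain a a' where a: "e \<in> J" "e' \<in> J" "e'' \<in> J" "e * a * e' \<noteq> 0" "e' * a' * e'' \<noteq> 0"
        by (auto simp: R_def)
      obtain b where b: "b * (e * a * e') = e'" using generate[OF a(2,4)] by blast
      have "b * (e * (a * e' * a') * e'') = (b * (e * a * e')) * a' * e''" by (simp only: mult.assoc)
      then have "b * (e * (a * e' * a') * e'') \<noteq> 0" using a(5) by (simp only: b) simp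
      then have "e * (a * e' * a') * e'' \<noteq> 0" by (metis mult_zero_right)
      then show "(e, e'') \<in> R" using a by (auto simp: R_def)
    qed
  qed
  have RJ: "e \<in> J" "e' \<in> J" if "(e, e') \<in> R" for e e' using that by (auto simp: R_def)
  have fR: "finite R" using J(1) by (intro finite_subset[of R "J \<times> J"]) (auto simp: R_def)
  define rep where "rep e = (SOME x. (e, x) \<in> R)" for e
  have repR: "(e, rep e) \<in> R" if "e \<in> J" for e
    unfolding rep_def by (rule someI[of _ e]) (use that equiv in \<open>auto simp: equiv_def refl_on_def\<close>)
  have repJ: "rep e \<in> J" if "e \<in> J" for e using RJ(2)[OF repR[OF that]] .
  have rep_eq: "rep e = rep e'" if "(e, e') \<in> R" for e e'
  proof -
    have "R `` {e} = R `` {e'}" using equiv that by (rule equiv_class_eq)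
    then have "(e, x) \<in> R \<longleftrightarrow> (e', x) \<in> R" for x by auto
    then show ?thesis by (simp add: rep_def)
  qed
  \<comment> \<open>matrix units joining \<open>e\<close> with the representative of its class, in both directions\<close>
  have "\<exists>x y. x * e = x \<and> e * y = y \<and> y * rep e = y \<and> rep e * x = x \<and> x * y = rep e \<and> y * x = e"
    if e: "e \<in> J" for e
  proof -
    define r where "r = rep e"
    have r: "r \<in> J" "r * r = r" using repJ[OF e] idem by (auto simp: r_def)
    have "(r, e) \<in> R" using repR[OF e] equiv by (auto simp: r_def equiv_def dest: symD)
    then obtain a where a: "r * a * e \<noteq> 0" by (auto simp: R_def)
    define x where "x = r * a * e"
    obtain b where b: "b * x = e" using generate[OF e a] by (auto simp: x_def)
    have rx: "r * x = x" "x * e = x" using r idem[OF e] by (simp_all add: x_def mult.assoc flip: mult.assoc[of r r])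
    define y where "y = e * b * r"
    have y: "e * y = y" "y * r = y" using r idem[OF e] by (simp_all add: y_def mult.assoc flip: mult.assoc[of e e])
    have yx: "y * x = e" by (simp add: y_def mult.assoc rx b idem[OF e])
    obtain c where "r * (x * y) * r = scale c r" using primitive_corner[OF J(2)[OF r(1)]] by blast
    then have c: "x * y = scale c r" by (simp add: mult.assoc y rx flip: mult.assoc[of r x])
    have "c \<noteq> 0"
    proof
      assume "c = 0"
      then have "y * (x * y) * x = 0" by (simp add: c)
      moreover have "y * (x * y) * x = (y * x) * (y * x)" by (simp only: mult.assoc)
      ultimately show False using yx idem[OF e] nz[OF e] by simp
    qed
    have "x * (y * x) * y = (x * y) * (x * y)" by (simp only: mult.assoc)
    then have "scale c r = scale (c * c) r" by (simp add: yx rx c lin_simps r)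
    then have "c = 1" using \<open>c \<noteq> 0\<close> nz[OF r(1)] by simp
    then show ?thesis using rx y yx c by (intro exI[of _ x] exI[of _ y]) (simp add: r_def)
  qed
  then have "\<forall>e\<in>J. \<exists>z. fst z * e = fst z \<and> e * snd z = snd z \<and> snd z * rep e = snd z \<and>
      rep e * fst z = fst z \<and> fst z * snd z = rep e \<and> snd z * fst z = e"
    by fastforce
  from bchoice[OF this] obtain Z where Z: "\<And>e. e \<in> J \<Longrightarrow> fst (Z e) * e = fst (Z e) \<and> e * snd (Z e) = snd (Z e) \<and>
     snd (Z e) * rep e = snd (Z e) \<and> rep e * fst (Z e) = fst (Z e) \<and> fst (Z e) * snd (Z e) = rep e \<and> snd (Z e) * fst (Z e) = e"
    by blast
  define X where "X e = fst (Z e)" for e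
  define Y where "Y e = snd (Z e)" for e
  have XY: "X e * e = X e" "e * Y e = Y e" "Y e * rep e = Y e" "rep e * X e = X e" "X e * Y e = rep e" "Y e * X e = e"
    if "e \<in> J" for e
    using Z[OF that] by (simp_all add: X_def Y_def)
  have XY0: "X e * Y e' = 0" if "e \<in> J" "e' \<in> J" "e \<noteq> e'" for e e'
  proof -
    have "X e * Y e' = (X e * e) * (e' * Y e')" using XY that by simp
    also have "\<dots> = X e * (e * e') * Y e'" by (simp only: mult.assoc)
    finally show ?thesis using J(5)[OF that] by simp
  qed
  define E where "E e e' = Y e * X e'" for e e'
  have corner: "\<exists>c. X e * h * Y e' = scale c (rep e)" if ee: "(e, e') \<in> R" for e e' h
  proof -
    have "X e * h * Y e' = (rep e * X e) * h * (Y e' * rep e')" using XY RJ[OF ee] by simp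
    also have "\<dots> = rep e * (X e * h * Y e') * rep e" using rep_eq[OF ee] by (simp only: mult.assoc)
    finally show ?thesis using primitive_corner[OF J(2)[OF repJ[OF RJ(1)[OF ee]]]] by metis
  qed
  define entry where "entry e e' h = (if (e, e') \<in> R then SOME c. X e * h * Y e' = scale c (rep e) else 0)" for e e' h
  have entry: "X e * h * Y e' = scale (entry e e' h) (rep e)" if "(e, e') \<in> R" for e e' h
    using someI_ex[OF corner[OF that, of h]] that by (simp add: entry_def)
  have entryI: "entry e e' h = c" if "(e, e') \<in> R" "X e * h * Y e' = scale c (rep e)" for e e' h c
    using entry[OF that(1), of h] that nz[OF repJ[OF RJ(1)[OF that(1)]]] by simp
  have "matrix_units scale \<Delta> \<epsilon> S J R E entry w"
  proof
    show "finite J" by (rule J(1))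
    show "equiv J R" by (rule equiv)
    show "E i j * E k l = (if j = k then E i l else 0)" if "(i, j) \<in> R" "(k, l) \<in> R" for i j k l
    proof (cases "j = k")
      case True
      have "E i j * E k l = Y i * (X j * Y k) * X l" by (simp only: E_def mult.assoc)
      also have "\<dots> = Y i * rep i * X l" using XY(5) RJ[OF that(1)] rep_eq[OF that(1)] True by simp
      finally show ?thesis using XY(3) RJ[OF that(1)] True by (simp add: E_def)
    next
      case False
      have "E i j * E k l = Y i * (X j * Y k) * X l" by (simp only: E_def mult.assoc)
      then show ?thesis using XY0[of j k] RJ[OF that(1)] RJ[OF that(2)] False by simp
    qed
    show "(\<Sum>i\<in>J. E i i) = 1" using XY J(6) by (simp add: E_def)
    show "(\<Sum>(i, j)\<in>R. scale (entry i j h) (E i j)) = h" for h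
    proof -
      have "h = \<Sum>J * h * \<Sum>J" using J(6) by simp
      also have "\<dots> = (\<Sum>z\<in>J \<times> J. fst z * h * snd z)"
      proof -
        have "\<Sum>J * h * \<Sum>J = (\<Sum>i\<in>J. i * h) * \<Sum>J" by (simp only: sum_distrib_right)
        also have "\<dots> = (\<Sum>i\<in>J. \<Sum>j\<in>J. i * h * j)" by (rule sum_product)
        also have "\<dots> = (\<Sum>(i, j)\<in>J \<times> J. i * h * j)" by (rule sum.cartesian_product)
        finally show ?thesis by (simp only: case_prod_unfold)
      qed
      also have "\<dots> = (\<Sum>z\<in>R. fst z * h * snd z)"
        using J(1) by (intro sum.mono_neutral_right) (auto simp: R_def)
      also have "\<dots> = (\<Sum>(i, j)\<in>R. scale (entry i j h) (E i j))"
      proof (intro sum.cong HOL.refl, clarsimp)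
        fix i j assume ij: "(i, j) \<in> R"
        have "i * h * j = (Y i * X i) * h * (Y j * X j)" using XY(6) RJ[OF ij] by simp
        also have "\<dots> = Y i * (X i * h * Y j) * X j" by (simp only: mult.assoc)
        also have "\<dots> = scale (entry i j h) (E i j)"
          using XY(3) RJ[OF ij] by (simp add: entry[OF ij] E_def lin_simps)
        finally show "i * h * j = scale (entry i j h) (E i j)" .
      qed
      finally show ?thesis by simp
    qed
    show "functional (entry i j)" for i j
    proof (cases "(i, j) \<in> R")
      case True
      then show ?thesis
        by (auto simp: functional_def lin_simps entry[OF True] intro!: entryI)
    next
      case False
      then show ?thesis by (simp add: functional_def entry_def)
    qed
    show "entry i j (E k l) = (if i = k \<and> j = l then 1 else 0)" if "(i, j) \<in> R" "(k, l) \<in> R" for i j k l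
    proof (rule entryI[OF that(1)])
      have "X i * E k l * Y j = (X i * Y k) * (X l * Y j)" by (simp only: E_def mult.assoc)
      also have "\<dots> = scale (if i = k \<and> j = l then 1 else 0) (rep i)"
        using XY0 XY(5) RJ[OF that(1)] RJ[OF that(2)] rep_eq[OF that(1)] idem[OF repJ] by auto
      finally show "X i * E k l * Y j = scale (if i = k \<and> j = l then 1 else 0) (rep i)" .
    qed
    have wnz: "w i \<noteq> 0" if "i \<in> J" for i
    proof
      assume "w i = 0"
      then have "vi * (v * i) = 0" using J(3)[OF that] by simp
      then show False using v nz[OF that] by (simp flip: mult.assoc)
    qed
    then show "i \<in> J \<Longrightarrow> w i \<noteq> 0" for i .
    show "S (S (E i j)) = scale (w i / w j) (E i j)" if ij: "(i, j) \<in> R" for i j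
    proof -
      have "v * (i * E i j) = scale (w i) (i * E i j)" using J(3)[OF RJ(1)[OF ij]] by (simp add: lin_simps flip: mult.assoc)
      then have l: "v * E i j = scale (w i) (E i j)" using XY(2) RJ[OF ij] by (simp add: E_def flip: mult.assoc)
      have "(E i j * j) * v = scale (w j) (E i j * j)" using J(4)[OF RJ(2)[OF ij]] by (simp add: lin_simps mult.assoc)
      then have r: "E i j * v = scale (w j) (E i j)" using XY(1) RJ[OF ij] by (simp add: E_def mult.assoc)
      have "scale (w j) (E i j * vi) = E i j * v * vi" by (simp add: r lin_simps)
      then have "scale (w j) (E i j * vi) = E i j" by (simp add: mult.assoc v)
      then have "scale (inverse (w j)) (scale (w j) (E i j * vi)) = scale (inverse (w j)) (E i j)" by (simp only:)
      then have r': "E i j * vi = scale (inverse (w j)) (E i j)" using wnz[OF RJ(2)[OF ij]] by simp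
      have "S (S (E i j)) = S (S (E i j)) * v * vi" by (simp add: mult.assoc v)
      also have "\<dots> = v * E i j * vi" by (simp add: S2)
      finally show ?thesis by (simp add: l r' lin_simps divide_inverse)
    qed
  qed
  then show ?thesis by blast
qed

end

section \<open>The antipode is an involution\<close>

context semisimple_hopf_algebra
begin

lemma lam0_one_nonzero: "lam0 1 \<noteq> 0"
proof -
  obtain J R E entry w where "matrix_units scale \<Delta> \<epsilon> S J R E entry w" using ex_matrix_units by blast
  then interpret matrix_units scale \<Delta> \<epsilon> S J R E entry w .
  show ?thesis using tr_S2_nonzero by (simp add: lam0_def)
qed

text \<open>The convolution of \<open>\<lambda>\<^sub>0\<close> and \<open>\<lambda>\<^sub>0 \<circ> S\<close> is evaluated with the left and with the right factor as integral; the
common value \<open>\<lambda>\<^sub>0 1\<close> at \<open>1\<close> can be cancelled.\<close>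

lemma lam0_S_eq: "lam0 (S h) = lam0 h"
proof -
  have "sw (\<lambda>x y. lam0 x * lam0 (S y)) h = lam0 (S (sw (\<lambda>x y. scale (lam0 x) y) h))"
    by (subst sw_comp[of "\<lambda>y. lam0 (S y)"]) (simp_all add: additive_def lin_simps lam0_simps)
  also have "\<dots> = lam0 h * lam0 1"
    by (simp add: lam0_right_integral lin_simps lam0_simps S_one)
  finally have "sw (\<lambda>x y. lam0 x * lam0 (S y)) h = lam0 h * lam0 1" .
  moreover have "sw (\<lambda>x y. lam0 x * lam0 (S y)) h = lam0 (sw (\<lambda>x y. scale (lam0 (S y)) x) h)"
    by (subst sw_comp[of lam0]) (simp_all add: additive_def lin_simps lam0_simps)
  ultimately show ?thesis
    using lam0_one_nonzero by (simp add: lam0_S_left_integral lam0_simps)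
qed

text \<open>The form \<open>\<lambda>\<^sub>0 = \<lambda>\<^sub>0 \<circ> S\<close> now has both \<open>S\<^sup>2\<close> and \<open>S\<^sup>-\<^sup>2\<close> as Nakayama automorphism.\<close>

lemma S4_id: "S (S (S (S x))) = x"
proof -
  have "lam0 ((S (S (S (S x))) - x) * h) = 0" for h
  proof -
    have "lam0 (x * h) = lam0 (S h * S x)" by (simp add: lam0_S_eq flip: S_mult)
    also have "\<dots> = lam0 (S (S (S x)) * S h)" by (rule lam0_nakayama)
    also have "\<dots> = lam0 (h * S (S x))" by (simp add: lam0_S_eq flip: S_mult)
    also have "\<dots> = lam0 (S (S (S (S x))) * h)" by (rule lam0_nakayama)
    finally show ?thesis by (simp add: left_diff_distrib functional_diff[OF functional_lam0])
  qed
  then have "S (S (S (S x))) - x = 0" by (rule lam0_nondegenerate)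
  then show ?thesis by simp
qed

lemma chi_S2: "chi (S (S x)) = chi x"
proof -
  obtain v vi where v: "v * vi = 1" "vi * v = 1" and S2: "\<And>a. S (S a) * v = v * a"
    using S2_inner by metis
  have "chi (S (S x)) = chi (S (S x) * v * vi)" by (simp add: mult.assoc v)
  also have "\<dots> = chi (vi * (v * x))" by (simp add: S2 chi_commute)
  finally show ?thesis by (simp add: v flip: mult.assoc)
qed

lemma chi_one: "chi 1 = of_nat dimension"
  by (simp add: chi_def tr_id)

lemma dimension_nonzero: "of_nat dimension \<noteq> (0 :: 'k)"
proof -
  have "(1::'h) \<in> span Bas" by (simp add: Bas)
  then have "Bas \<noteq> {}" by auto
  then show ?thesis using Bas(1) by (simp add: dimension_def)
qed

lemma tr_sum: "tr (\<lambda>x. \<Sum>i\<in>A. F i x) = (\<Sum>i\<in>A. tr (F i))"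
  by (simp add: tr_def functional_sum[OF functional_coord] sum.swap[of _ A])

lemma tr_sw_sum: "tr (\<lambda>x. sw (\<lambda>a b. F a b x) h) = sw (\<lambda>a b. tr (F a b)) h"
proof -
  have "coord c (sw (\<lambda>a b. F a b c) h) = sw (\<lambda>a b. coord c (F a b c)) h" for c
    by (rule sw_comp) (simp add: additive_def coord_simps)
  then show ?thesis by (simp add: tr_def sw_sum)
qed

lemma endo_hit: "functional p \<Longrightarrow> endo (hit scale \<Delta> p)"
proof -
  assume p: "functional p"
  show ?thesis
    unfolding endo_def hit_eq
    by (auto simp: sw_simps functional_simps[OF p]) (simp flip: sw_scalef)
qed

lemma hit_hit:
  assumes "functional p" "functional q"
  shows "hit scale \<Delta> p (hit scale \<Delta> q y) = hit scale \<Delta> (sw (\<lambda>b v. p b * q v)) y"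
proof -
  note pq = functional_simps[OF assms(1)] functional_simps[OF assms(2)]
  have "hit scale \<Delta> p (hit scale \<Delta> q y) = sw (\<lambda>u v. hit scale \<Delta> p (scale (q v) u)) y"
    unfolding hit_eq[of q] by (rule sw_comp) (simp add: additive_def endo_add[OF endo_hit[OF assms(1)]])
  also have "\<dots> = sw (\<lambda>u v. sw (\<lambda>a b. scale (p b * q v) a) u) y"
    by (simp add: hit_eq sw_simps pq)
  also have "\<dots> = sw (\<lambda>a t. sw (\<lambda>b v. scale (p b * q v) a) t) y"
    by (rule sw_coassoc) (simp add: sw_simps pq)
  finally show ?thesis by (simp add: hit_eq sw_scale_leftf)
qed

text \<open>As \<open>H \<otimes> H\<close> is a free \<open>H\<close>-module of rank \<open>dim H\<close>, the square of the regular character is \<open>dim H\<close> times it.  The proof is the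
isomorphism \<open>x \<otimes> y \<mapsto> x\<^sub>1 \<otimes> x\<^sub>2 y\<close> with its inverse \<open>x \<otimes> y \<mapsto> x\<^sub>1 \<otimes> S x\<^sub>2 y\<close>, written as matrices \<open>\<beta>\<close> and \<open>\<alpha>\<close> of operators on \<open>H\<close>
with respect to a basis of the second factor, so that only traces on \<open>H\<close> occur.\<close>

lemma chi_convolution: "sw (\<lambda>a b. chi a * chi b) h = of_nat dimension * chi h"
proof -
  define m where "m c c' x = coord c (x * c')" for c c' x
  have fm: "functional (m c c')" for c c'
    by (auto simp: functional_def m_def lin_simps coord_simps)
  have fmS: "functional (\<lambda>x. m c c' (S x))" for c c'
    using fm[of c c'] by (auto simp: functional_def lin_simps)
  note ml = functional_simps[OF fm]
  note chil = functional_simps[OF functional_chi]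
  have mm: "(\<Sum>c'\<in>Bas. m c c' a * m c' c b) = m c c (a * b)" for c a b
  proof -
    have "m c c (a * b) = coord c (a * (\<Sum>c'\<in>Bas. scale (coord c' (b * c)) c'))"
      by (simp add: m_def coord_expand mult.assoc)
    then show ?thesis
      by (simp add: sum_distrib_left lin_simps functional_sum[OF functional_coord] coord_simps m_def)
  qed
  have chi_m: "chi a = (\<Sum>c\<in>Bas. m c c a)" for a
    by (simp add: chi_def tr_def m_def)
  have mchi: "(\<Sum>c\<in>Bas. \<Sum>c'\<in>Bas. m c c' a * m c' c b) = chi (a * b)" for a b
    by (simp add: mm chi_m)
  \<comment> \<open>\<open>m c c'\<close> are the matrix entries of the regular representation\<close>
  define \<alpha> where "\<alpha> c c' = hit scale \<Delta> (\<lambda>x. m c c' (S x))" for c c'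
  define \<beta> where "\<beta> c' c = hit scale \<Delta> (m c' c)" for c' c
  have \<alpha>l: "endo (\<alpha> c c')" and \<beta>l: "endo (\<beta> c' c)" for c c'
    unfolding \<alpha>_def \<beta>_def by (intro endo_hit fm fmS)+
  have \<alpha>\<beta>: "(\<Sum>c\<in>Bas. \<Sum>c'\<in>Bas. \<alpha> c c' (\<beta> c' c y)) = scale (of_nat dimension) y" for y
  proof -
    have "(\<Sum>c\<in>Bas. \<Sum>c'\<in>Bas. \<alpha> c c' (\<beta> c' c y))
        = hit scale \<Delta> (\<lambda>t. sw (\<lambda>b v. \<Sum>c\<in>Bas. \<Sum>c'\<in>Bas. m c c' (S b) * m c' c v) t) y"
      by (simp only: \<alpha>_def \<beta>_def hit_hit[OF fmS fm]) (simp only: hit_eq sw_sum scale_sum_left)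
    also have "\<dots> = sw (\<lambda>u t. scale (sw (\<lambda>b v. chi (S b * v)) t) u) y"
      by (simp only: mchi hit_eq)
    also have "(\<lambda>t. sw (\<lambda>b v. chi (S b * v)) t) = (\<lambda>t. chi (scale (\<epsilon> t) 1))"
      by (intro ext sw_antipode_left) (simp add: additive_def chil)
    also have "sw (\<lambda>u t. scale (chi (scale (\<epsilon> t) 1)) u) y = sw (\<lambda>u t. scale (of_nat dimension) (scale (\<epsilon> t) u)) y"
      by (simp add: chil chi_one mult.commute)
    also have "\<dots> = scale (of_nat dimension) y"
      by (rule sw_counit_right) (simp add: additive_def scale_right_distrib)
    finally show ?thesis .
  qed
  have \<beta>\<alpha>: "(\<Sum>c\<in>Bas. \<Sum>c'\<in>Bas. \<beta> c' c (h * \<alpha> c c' x)) = sw (\<lambda>h1 h2. scale (chi h2) (h1 * x)) h" for x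
  proof -
    have "\<beta> c' c (h * \<alpha> c c' x)
        = sw (\<lambda>x1 x2. sw (\<lambda>u v. scale (m c c' (S x2) * m c' c v) u) (h * x1)) x" for c c'
    proof -
      have "\<beta> c' c (h * \<alpha> c c' x) = sw (\<lambda>x1 x2. \<beta> c' c (h * scale (m c c' (S x2)) x1)) x"
        unfolding \<alpha>_def hit_eq
        by (rule sw_comp[of "\<lambda>z. \<beta> c' c (h * z)"]) (simp add: additive_def distrib_left endo_add[OF \<beta>l])
      also have "\<dots> = sw (\<lambda>x1 x2. scale (m c c' (S x2)) (\<beta> c' c (h * x1))) x"
        by (simp only: scale_mult_right endo_scale[OF \<beta>l])
      finally show ?thesis by (simp only: \<beta>_def hit_eq scale_scale flip: sw_scalef)
    qed
    then have "(\<Sum>c\<in>Bas. \<Sum>c'\<in>Bas. \<beta> c' c (h * \<alpha> c c' x))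
        = sw (\<lambda>x1 x2. sw (\<lambda>u v. scale (\<Sum>c\<in>Bas. \<Sum>c'\<in>Bas. m c c' (S x2) * m c' c v) u) (h * x1)) x"
      by (simp only: sw_sum scale_sum_left)
    also have "\<dots> = sw (\<lambda>x1 x2. sw (\<lambda>u v. scale (chi (v * S x2)) u) (h * x1)) x"
      by (simp only: mchi chi_commute[of "S _"])
    also have "\<dots> = sw (\<lambda>x1 x2. sw (\<lambda>h1 h2. sw (\<lambda>a b. scale (chi (h2 * (b * S x2))) (h1 * a)) x1) h) x"
      unfolding mult.assoc[symmetric] by (intro sw_cong sw_mult) (simp add: sw_simps chil)
    also have "\<dots> = sw (\<lambda>h1 h2. sw (\<lambda>x1 x2. sw (\<lambda>a b. scale (chi (h2 * (b * S x2))) (h1 * a)) x1) x) h"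
      by (rule sw_swap)
    also have "\<dots> = sw (\<lambda>h1 h2. sw (\<lambda>a t. sw (\<lambda>b x2. scale (chi (h2 * (b * S x2))) (h1 * a)) t) x) h"
      by (intro sw_cong sw_coassoc) (simp add: sw_simps chil)
    also have "\<dots> = sw (\<lambda>h1 h2. sw (\<lambda>a t. scale (chi (h2 * scale (\<epsilon> t) 1)) (h1 * a)) x) h"
      by (intro sw_cong sw_antipode_right[of "\<lambda>z. scale (chi (_ * z)) (_ * _)"]) (simp add: sw_simps chil)
    also have "\<dots> = sw (\<lambda>h1 h2. sw (\<lambda>a t. scale (chi h2) (h1 * scale (\<epsilon> t) a)) x) h"
      by (simp add: lin_simps chil)
    also have "\<dots> = sw (\<lambda>h1 h2. scale (chi h2) (h1 * x)) h"
      by (intro sw_cong sw_counit_right) (simp add: sw_simps)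
    finally show ?thesis .
  qed
  have "of_nat dimension * chi h = tr (\<lambda>y. h * scale (of_nat dimension) y)"
    by (simp add: chi_def tr_scale lin_simps)
  also have "\<dots> = tr (\<lambda>y. \<Sum>c\<in>Bas. \<Sum>c'\<in>Bas. (h * \<alpha> c c' (\<beta> c' c y)))"
    by (simp only: sum_distrib_left flip: \<alpha>\<beta>)
  also have "\<dots> = (\<Sum>c\<in>Bas. \<Sum>c'\<in>Bas. tr (\<lambda>y. h * \<alpha> c c' (\<beta> c' c y)))"
    by (simp only: tr_sum)
  also have "\<dots> = (\<Sum>c\<in>Bas. \<Sum>c'\<in>Bas. tr (\<lambda>x. \<beta> c' c (h * \<alpha> c c' x)))"
  proof (intro sum.cong HOL.refl tr_commute[of "\<lambda>y. h * \<alpha> _ _ y"] \<beta>l)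
    show "endo (\<lambda>y. h * \<alpha> c c' y)" for c c'
      using \<alpha>l[of c c'] by (auto simp: endo_def lin_simps)
  qed
  also have "\<dots> = tr (\<lambda>x. sw (\<lambda>h1 h2. scale (chi h2) (h1 * x)) h)"
    by (simp only: \<beta>\<alpha> flip: tr_sum)
  also have "\<dots> = sw (\<lambda>h1 h2. chi h2 * chi h1) h"
    by (simp only: tr_sw_sum tr_scale chi_def)
  finally show ?thesis by (simp add: mult.commute)
qed

text \<open>The trace formula of the dual bases for \<open>\<lambda>\<^sub>0\<close>, in a form that avoids the inverse of \<open>S\<close>.\<close>

lemma tr_comp_S:
  assumes F: "endo F"
  shows "tr (\<lambda>x. F (S x)) = sw (\<lambda>x y. lam0 (x * F y)) Lam"
proof (rule tr_sw[where \<phi> = "\<lambda>x y h. lam0 (x * h)" and g = "\<lambda>x y. F y"])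
  fix h
  have "F (S h) = F (sw (\<lambda>x y. scale (lam0 (x * h)) y) Lam)" by (simp add: lam0_recover_S)
  also have "\<dots> = sw (\<lambda>x y. scale (lam0 (x * h)) (F y)) Lam"
    by (subst sw_comp) (simp_all add: additive_def endo_add[OF F] endo_scale[OF F])
  finally show "F (S h) = sw (\<lambda>x y. scale (lam0 (x * h)) (F y)) Lam" .
qed (auto simp: functional_def lin_simps lam0_simps)

lemma chi_Lam: "chi Lam = 1"
proof -
  have "tr (\<lambda>x. Lam * x) = (\<Sum>i\<in>{0::nat}. \<epsilon> Lam)"
    by (rule tr_expand[where \<phi> = "\<lambda>_. \<epsilon>"]) (simp_all add: right_Lam functional_eps)
  then show ?thesis by (simp add: chi_def eps_Lam)
qed

text \<open>\<open>T = S\<^sup>2\<close> is an involution with trace \<open>\<lambda>\<^sub>0 1 \<noteq> 0\<close>, and \<open>Q\<close> is an idempotent commuting with it such that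
\<open>tr (T Q) = tr T / dim H\<close>.  With the ranks \<open>p\<close>, \<open>q\<close> of the spectral projections of \<open>T\<close> and the ranks \<open>p'\<close>, \<open>q'\<close> of their
products with \<open>Q\<close> this reads \<open>p - q = (p' - q') (p + q)\<close>, which for
\<open>p \<noteq> q\<close> is only possible if \<open>p = 0\<close> or \<open>q = 0\<close>; and \<open>p \<noteq> 0\<close>, because \<open>T\<close> fixes \<open>1\<close>.\<close>

lemma S2_id: "S (S x) = x"
proof -
  define n where "n = dimension"
  have n0: "of_nat n \<noteq> (0 :: 'k)" using dimension_nonzero by (simp add: n_def)
  define T where "T x = S (S x)" for x
  have linT: "endo T" by (auto simp: endo_def T_def lin_simps)
  have TT: "T (T x) = x" for x by (simp add: T_def S4_id)
  define e where "e x = chi (S x) / of_nat n" for x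
  have fe: "functional e"
    by (auto simp: functional_def e_def lin_simps functional_simps[OF functional_chi] add_divide_distrib)
  note el = functional_simps[OF fe]
  have ee: "sw (\<lambda>a b. e a * e b) x = e x" for x
  proof -
    have "sw (\<lambda>a b. chi (S a) * chi (S b)) x = sw (\<lambda>a b. chi b * chi a) (S x)"
      by (rule sw_S[symmetric]) (simp add: sw_simps functional_simps[OF functional_chi])
    also have "\<dots> = of_nat n * chi (S x)"
      using chi_convolution[of "S x"] by (simp add: mult.commute n_def)
    finally have *: "sw (\<lambda>a b. chi (S a) * chi (S b)) x = of_nat n * chi (S x)" .
    have "sw (\<lambda>a b. e a * e b) x = inverse (of_nat n * of_nat n) * sw (\<lambda>a b. chi (S a) * chi (S b)) x"
      unfolding sw_mult_leftf[symmetric] by (simp add: e_def field_simps)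
    then show ?thesis using n0 by (simp add: * e_def field_simps)
  qed
  define Q where "Q x = sw (\<lambda>a b. scale (e a) b) x" for x
  have linQ: "endo Q" by (auto simp: endo_def Q_def sw_simps el) (simp flip: sw_scalef)
  have QQ: "Q (Q x) = Q x" for x
  proof -
    have "Q (Q x) = sw (\<lambda>a b. Q (scale (e a) b)) x"
      unfolding Q_def[of x] by (rule sw_comp) (simp add: additive_def endo_add[OF linQ])
    also have "\<dots> = sw (\<lambda>a t. sw (\<lambda>b c. scale (e a * e b) c) t) x"
      by (simp add: Q_def sw_simps el)
    also have "\<dots> = sw (\<lambda>t c. sw (\<lambda>a b. scale (e a * e b) c) t) x"
      by (rule sw_coassoc[symmetric]) (simp add: sw_simps el)
    also have "\<dots> = Q x" by (simp only: sw_scale_leftf ee Q_def)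
    finally show ?thesis .
  qed
  have TQ: "T (Q x) = Q (T x)" for x
  proof -
    have "Q (T x) = sw (\<lambda>a b. scale (e (S b)) (S a)) (S x)"
      unfolding Q_def T_def by (rule sw_S) (simp add: sw_simps el)
    also have "\<dots> = sw (\<lambda>a b. scale (e (S (S a))) (S (S b))) x"
      by (rule sw_S) (simp add: sw_simps el)
    also have "\<dots> = sw (\<lambda>a b. T (scale (e a) b)) x"
      by (simp add: e_def chi_S2 T_def S_scale)
    also have "\<dots> = T (Q x)"
      unfolding Q_def by (rule sw_comp[symmetric]) (simp add: additive_def endo_add[OF linT])
    finally show ?thesis by simp
  qed
  have trT: "tr T = lam0 1" by (simp add: T_def[abs_def] lam0_def)
  have trTQ: "tr (\<lambda>x. T (Q x)) = lam0 1 / of_nat n"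
  proof -
    \<comment> \<open>chosen such that \<open>F \<circ> S = T \<circ> Q\<close>\<close>
    define F where "F y = sw (\<lambda>a b. scale (chi b / of_nat n) (S a)) y" for y
    have "F (S x) = T (Q x)" for x
    proof -
      have "F (S x) = sw (\<lambda>a b. scale (e a) (S (S b))) x"
        unfolding F_def e_def
        by (rule sw_S) (simp add: sw_simps functional_simps[OF functional_chi] add_divide_distrib)
      also have "\<dots> = T (Q x)"
        unfolding Q_def by (subst sw_comp[of T]) (simp_all add: additive_def T_def lin_simps)
      finally show ?thesis .
    qed
    moreover have "endo F"
      by (auto simp: endo_def F_def sw_simps functional_simps[OF functional_chi] add_divide_distrib)
        (simp flip: sw_scalef)
    ultimately have "tr (\<lambda>x. T (Q x)) = sw (\<lambda>x y. lam0 (x * F y)) Lam"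
      using tr_comp_S[of F] by simp
    also have "\<dots> = sw (\<lambda>x y. sw (\<lambda>a b. lam0 (x * S a) * (chi b / of_nat n)) y) Lam"
    proof (rule sw_cong)
      show "lam0 (x * F y) = sw (\<lambda>a b. lam0 (x * S a) * (chi b / of_nat n)) y" for x y
        unfolding F_def by (subst sw_comp[of "\<lambda>z. lam0 (x * z)"]) (simp_all add: additive_def lin_simps lam0_simps)
    qed
    also have "\<dots> = sw (\<lambda>t b. sw (\<lambda>x a. lam0 (x * S a) * (chi b / of_nat n)) t) Lam"
      by (rule sw_coassoc[symmetric])
        (simp add: sw_simps lam0_simps functional_simps[OF functional_chi] add_divide_distrib)
    also have "\<dots> = sw (\<lambda>t b. lam0 (scale (\<epsilon> t) 1) * (chi b / of_nat n)) Lam"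
      by (intro sw_cong sw_antipode_right) (simp add: additive_def lam0_simps distrib_right add_divide_distrib)
    also have "\<dots> = sw (\<lambda>t b. lam0 1 / of_nat n * chi (scale (\<epsilon> t) b)) Lam"
      by (simp add: lam0_simps functional_scale[OF functional_chi] mult_ac)
    also have "\<dots> = lam0 1 / of_nat n * chi Lam"
      by (rule sw_counit_left) (simp add: additive_def functional_add[OF functional_chi] distrib_left add_divide_distrib)
    finally show ?thesis by (simp add: chi_Lam)
  qed
  define P where "P x = scale (1/2) (x + T x)" for x
  define P' where "P' x = scale (1/2) (x - T x)" for x
  have linP: "endo P" "endo P'"
    by (auto simp: endo_def P_def P'_def lin_simps endo_add[OF linT] endo_scale[OF linT]
        scale_right_diff_distrib algebra_simps)
  have TP: "T (P x) = P x" "T (P' x) = - P' x" for x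
    by (simp_all add: P_def P'_def endo_add[OF linT] endo_diff[OF linT] endo_scale[OF linT] TT add.commute
        flip: scale_minus_right)
  have half: "scale (1/2) (z + z) = z" for z
    by (simp add: scale_right_distrib flip: scale_left_distrib)
  have PP: "P (P x) = P x" "P' (P' x) = P' x" for x
  proof -
    show "P (P x) = P x" unfolding P_def[of "P x"] TP by (rule half)
    show "P' (P' x) = P' x" unfolding P'_def[of "P' x"] TP using half[of "P' x"] by simp
  qed
  have PQ: "P (Q x) = Q (P x)" "P' (Q x) = Q (P' x)" for x
    by (simp_all add: P_def P'_def TQ endo_add[OF linQ] endo_diff[OF linQ] endo_scale[OF linQ])
  have endo_comp: "endo (\<lambda>x. P (Q x))" "endo (\<lambda>x. P' (Q x))"
    using linP linQ by (auto simp: endo_def)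
  obtain p q p' q' where nat: "tr P = of_nat p" "tr P' = of_nat q"
      "tr (\<lambda>x. P (Q x)) = of_nat p'" "tr (\<lambda>x. P' (Q x)) = of_nat q'"
    using tr_idempotent[OF linP(1)] tr_idempotent[OF linP(2)] tr_idempotent[OF endo_comp(1)]
      tr_idempotent[OF endo_comp(2)] PP QQ PQ by metis
  have "of_nat p + of_nat q = (of_nat n :: 'k)"
  proof -
    have "x + T x + (x - T x) = x + x" for x by simp
    then have "P x + P' x = x" for x
      by (simp only: P_def P'_def half flip: scale_right_distrib)
    then have "tr (\<lambda>x. x) = tr P + tr P'" using tr_add[of P P'] by simp
    then show ?thesis by (simp add: nat tr_id n_def)
  qed
  moreover have "x + T x - (x - T x) = T x + T x" for x by simp
  then have diff: "P x - P' x = T x" for x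
    by (simp only: P_def P'_def half flip: scale_right_diff_distrib)
  then have D: "of_nat p - of_nat q = lam0 1"
    using tr_diff[of P P'] by (simp add: nat trT flip: T_def[abs_def])
  moreover have "of_nat p' - of_nat q' = lam0 1 / of_nat n"
    using tr_diff[of "\<lambda>x. P (Q x)" "\<lambda>x. P' (Q x)"] by (simp add: nat diff trTQ)
  ultimately have "of_nat p - of_nat q = (of_nat p' - of_nat q') * (of_nat p + of_nat q :: 'k)"
    using n0 by (simp add: field_simps)
  then have "(of_int (int p - int q) :: 'k) = of_int ((int p' - int q') * (int p + int q))"
    by simp
  then have eq: "int p - int q = (int p' - int q') * (int p + int q)"
    by (simp only: of_int_eq_iff)
  have "p \<noteq> q" using D lam0_one_nonzero by auto
  moreover have "p \<noteq> 0"
  proof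
    assume "p = 0"
    then have "P 1 = 0" using tr_idempotent_eq_0[OF linP(1) PP(1)] nat(1) by simp
    moreover have "P 1 = 1" by (simp only: P_def T_def S_one half)
    ultimately show False by simp
  qed
  ultimately have "q = 0"
  proof -
    consider "int p' - int q' = 0" | "int p' - int q' \<ge> 1" | "int p' - int q' \<le> -1" by linarith
    then show ?thesis
    proof cases
      case 1
      then show ?thesis using eq \<open>p \<noteq> q\<close> by simp
    next
      case 2
      then have "int p + int q \<le> (int p' - int q') * (int p + int q)"
        by (simp add: mult_le_cancel_right1)
      then show ?thesis using eq by simp
    next
      case 3
      then have "(int p' - int q') * (int p + int q) \<le> (-1) * (int p + int q)"
        by (intro mult_right_mono) auto
      then show ?thesis using eq \<open>p \<noteq> 0\<close> by simp
    qed
  qed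
  then have "P' x = 0" using tr_idempotent_eq_0[OF linP(2) PP(2)] nat(2) by simp
  then show ?thesis by (simp add: P'_def T_def)
qed

text \<open>With \<open>S\<^sup>2 = id\<close> the form \<open>\<lambda>\<^sub>0 h\<close> is the trace of right multiplication by \<open>h\<close>, which agrees with that of left
multiplication because every block is a full matrix algebra.\<close>

lemma lam0_eq_chi: "lam0 = chi"
proof
  fix h
  obtain J R E entry w where "matrix_units scale \<Delta> \<epsilon> S J R E entry w" using ex_matrix_units by blast
  then interpret matrix_units scale \<Delta> \<epsilon> S J R E entry w .
  show "lam0 h = chi h" by (simp add: lam0_def S2_id tr_mult_right)
qed

end

section \<open>The regular character\<close>

context matrix_units
begin

lemma entry_mult:
  assumes "(i, j) \<in> R"
  shows "entry i j (a * b) = (\<Sum>k\<in>R `` {i}. entry i k a * entry k j b)"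
proof -
  have "entry i j (a * b) = entry i j (a * (\<Sum>(k, l)\<in>R. scale (entry k l b) (E k l)))"
    by (simp only: entry_expand)
  also have "\<dots> = (\<Sum>(k, l)\<in>R. entry k l b * entry i j (a * E k l))"
    by (simp add: sum_distrib_left lin_simps functional_sum[OF functional_entry] entry_scale case_prod_unfold)
  also have "\<dots> = (\<Sum>z\<in>R. if snd z = j then entry i (fst z) a * entry (fst z) j b else 0)"
    using assms by (intro sum.cong HOL.refl) (auto simp: entry_mult_E_left)
  also have "\<dots> = (\<Sum>z\<in>(\<lambda>k. (k, j)) ` (R `` {i}). if snd z = j then entry i (fst z) a * entry (fst z) j b else 0)"
  proof (rule sum.mono_neutral_right[OF fin_R])
    have R: "(i, k) \<in> R \<longleftrightarrow> (k, j) \<in> R" for k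
      using assms R_trans[of i j k] R_trans[of k i j] R_sym[of i k] R_sym[of k j] by blast
    then show "(\<lambda>k. (k, j)) ` (R `` {i}) \<subseteq> R" by blast
    show "\<forall>z\<in>R - (\<lambda>k. (k, j)) ` (R `` {i}). (if snd z = j then entry i (fst z) a * entry (fst z) j b else 0) = 0"
      using R by auto
  qed
  also have "\<dots> = (\<Sum>k\<in>R `` {i}. entry i k a * entry k j b)"
    by (subst sum.reindex) (auto intro: inj_onI)
  finally show ?thesis .
qed

lemma entry_one: "(i, j) \<in> R \<Longrightarrow> entry i j 1 = (if i = j then 1 else 0)"
proof -
  assume ij: "(i, j) \<in> R"
  have "entry i j 1 = (\<Sum>k\<in>J. entry i j (E k k))"
    using functional_sum[OF functional_entry, of i j "\<lambda>k. E k k" J] by (simp add: E_sum)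
  also have "\<dots> = (\<Sum>k\<in>J. if k = i then (if i = j then 1 else 0) else 0)"
    using ij by (intro sum.cong HOL.refl) (auto simp: entry_E R_refl)
  finally show ?thesis using fin_J R_J[OF ij] by simp
qed

lemma E_corner:
  assumes "i \<in> J" "j \<in> J"
  shows "E i i * h * E j j = (if (i, j) \<in> R then scale (entry i j h) (E i j) else 0)"
proof -
  have "E i i * h * E j j = E i i * (\<Sum>(k, l)\<in>R. scale (entry k l h) (E k l)) * E j j"
    by (simp only: entry_expand)
  also have "\<dots> = (\<Sum>(k, l)\<in>R. scale (entry k l h) (E i i * E k l * E j j))"
    by (simp add: sum_distrib_left sum_distrib_right lin_simps case_prod_unfold)
  also have "\<dots> = (\<Sum>z\<in>R. if z = (i, j) then scale (entry i j h) (E i j) else 0)"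
  proof (intro sum.cong HOL.refl, clarify)
    fix k l assume kl: "(k, l) \<in> R"
    show "scale (entry k l h) (E i i * E k l * E j j) = (if (k, l) = (i, j) then scale (entry i j h) (E i j) else 0)"
      using kl assms R_refl by (cases "i = k") (auto simp: E_mult)
  qed
  finally show ?thesis using fin_R by simp
qed

definition class_character :: "'h set \<Rightarrow> 'h \<Rightarrow> 'k" where
  "class_character C h = (\<Sum>i\<in>C. entry i i h)"

text \<open>A block is a full matrix algebra, and its matrix units move any nonzero vector to multiples of all unit
vectors.\<close>

lemma class_rep:
  assumes C: "C \<in> J // R"
  shows "class_character C \<in> irreducible_characters scale"
proof -
  obtain i0 where i0: "i0 \<in> J" "C = R `` {i0}" using C by (auto elim: quotientE)
  have CJ: "C \<subseteq> J" using i0 R_J by auto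
  have fC: "finite C" using CJ fin_J finite_subset by blast
  have CR: "(i, j) \<in> R" if "i \<in> C" "j \<in> C" for i j
    using that i0 R_trans R_sym by blast
  have RC: "R `` {i} = C" if "i \<in> C" for i
    using that i0 R_trans R_sym by blast
  define d where "d = card C"
  obtain f where f: "bij_betw f {0..<d} C" unfolding d_def using ex_bij_betw_nat_finite[OF fC] by blast
  have fC': "f k \<in> C" if "k < d" for k using f that by (auto simp: bij_betw_def)
  have fR: "(f k, f l) \<in> R" if "k < d" "l < d" for k l using CR fC' that by blast
  have finj: "f k = f l \<longleftrightarrow> k = l" if "k < d" "l < d" for k l
    using f that by (auto simp: bij_betw_def inj_on_def)
  have d0: "d > 0" using fC i0 R_refl by (auto simp: d_def card_gt_0_iff)
  define \<rho> where "\<rho> h = mat d d (\<lambda>(k, l). entry (f k) (f l) h)" for h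
  have rep: "matrix_rep scale d \<rho>"
    unfolding matrix_rep_def
  proof (intro conjI allI)
    show "\<rho> a \<in> carrier_mat d d" for a by (simp add: \<rho>_def)
    show "\<rho> 1 = 1\<^sub>m d" by (rule eq_matI) (auto simp: \<rho>_def entry_one fR finj)
    show "\<rho> (a + b) = \<rho> a + \<rho> b" for a b by (rule eq_matI) (auto simp: \<rho>_def entry_add)
    show "\<rho> (scale r a) = r \<cdot>\<^sub>m \<rho> a" for r a by (rule eq_matI) (auto simp: \<rho>_def entry_scale)
    show "\<rho> (a * b) = \<rho> a * \<rho> b" for a b
    proof (rule eq_matI)
      fix k l assume "k < dim_row (\<rho> a * \<rho> b)" "l < dim_col (\<rho> a * \<rho> b)"
      then have kl: "k < d" "l < d" by (auto simp: \<rho>_def)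
      have "\<rho> (a * b) $$ (k, l) = (\<Sum>i\<in>C. entry (f k) i a * entry i (f l) b)"
        using kl by (simp add: \<rho>_def entry_mult[OF fR] RC[OF fC'])
      also have "\<dots> = (\<Sum>m\<in>{0..<d}. entry (f k) (f m) a * entry (f m) (f l) b)"
        by (rule sum.reindex_bij_betw[OF f, symmetric])
      finally show "\<rho> (a * b) $$ (k, l) = (\<rho> a * \<rho> b) $$ (k, l)"
        using kl by (simp add: \<rho>_def scalar_prod_def)
    qed (auto simp: \<rho>_def)
  qed
  have irr: "W = {0\<^sub>v d} \<or> W = carrier_vec d" if W: "invariant_subspace d \<rho> W" for W
  proof (cases "W \<subseteq> {0\<^sub>v d}")
    case True
    then show ?thesis using W by (auto simp: invariant_subspace_def)
  next
    case False
    then obtain v where v: "v \<in> W" "v \<noteq> 0\<^sub>v d" by blast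
    have vd: "v \<in> carrier_vec d" using v W by (auto simp: invariant_subspace_def)
    obtain k where k: "k < d" "v $ k \<noteq> 0" using v(2) vd by (metis eq_vecI carrier_vecD index_zero_vec)
    have unit: "unit_vec d l \<in> W" if l: "l < d" for l
    proof -
      have "\<rho> (E (f l) (f k)) *\<^sub>v v = (v $ k) \<cdot>\<^sub>v unit_vec d l"
      proof (rule eq_vecI)
        fix m assume "m < dim_vec ((v $ k) \<cdot>\<^sub>v unit_vec d l)"
        then have m: "m < d" by simp
        have "(\<rho> (E (f l) (f k)) *\<^sub>v v) $ m = (\<Sum>j\<in>{0..<d}. entry (f m) (f j) (E (f l) (f k)) * v $ j)"
          using m vd by (simp add: \<rho>_def scalar_prod_def)
        also have "\<dots> = (\<Sum>j\<in>{0..<d}. if j = k then (if m = l then v $ k else 0) else 0)"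
          using m l k by (intro sum.cong HOL.refl) (auto simp: entry_E fR finj)
        finally show "(\<rho> (E (f l) (f k)) *\<^sub>v v) $ m = ((v $ k) \<cdot>\<^sub>v unit_vec d l) $ m"
          using m l k by simp
      qed (simp add: \<rho>_def)
      moreover have "\<rho> (E (f l) (f k)) *\<^sub>v v \<in> W" using W v(1) by (simp add: invariant_subspace_def)
      ultimately have "inverse (v $ k) \<cdot>\<^sub>v ((v $ k) \<cdot>\<^sub>v unit_vec d l) \<in> W"
        using W by (simp add: invariant_subspace_def)
      then show ?thesis using k by (simp add: smult_smult_assoc)
    qed
    have "u \<in> W" if u: "u \<in> carrier_vec d" for u
    proof -
      have "vec d (\<lambda>i. if i < m then u $ i else 0) \<in> W" if "m \<le> d" for m
        using that
      proof (induction m)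
        case 0
        have "vec d (\<lambda>i. if i < 0 then u $ i else 0) = 0\<^sub>v d" by (rule eq_vecI) auto
        then show ?case using W by (simp add: invariant_subspace_def)
      next
        case (Suc m)
        have "vec d (\<lambda>i. if i < Suc m then u $ i else 0)
            = vec d (\<lambda>i. if i < m then u $ i else 0) + (u $ m) \<cdot>\<^sub>v unit_vec d m"
          using Suc.prems by (intro eq_vecI) (auto simp: less_Suc_eq)
        then show ?case using Suc W unit[of m] by (simp add: invariant_subspace_def)
      qed
      from this[of d] have "vec d (\<lambda>i. if i < d then u $ i else 0) \<in> W" by simp
      also have "vec d (\<lambda>i. if i < d then u $ i else 0) = u" using u by (intro eq_vecI) auto
      finally show ?thesis .
    qed
    then show ?thesis using W by (auto simp: invariant_subspace_def)
  qed
  have "class_character C = (\<lambda>h. \<Sum>i<d. \<rho> h $$ (i, i))"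
  proof
    fix h
    have "class_character C h = (\<Sum>m\<in>{0..<d}. entry (f m) (f m) h)"
      unfolding class_character_def by (rule sum.reindex_bij_betw[OF f, symmetric])
    then show "class_character C h = (\<Sum>i<d. \<rho> h $$ (i, i))"
      by (simp add: \<rho>_def atLeast0LessThan)
  qed
  then show ?thesis
    using d0 rep irr unfolding irreducible_characters_def irreducible_rep_def by blast
qed

text \<open>A character is a trace, so it vanishes on \<open>E i j\<close> for \<open>i \<noteq> j\<close> and is constant on the \<open>E i i\<close> of a block.  For an irreducible
representation some \<open>E j j\<close> acts as a nonzero operator; by \<open>E_corner\<close> this operator has rank one, so its
trace is \<open>1\<close>, and the \<open>E i i\<close> of the other blocks act as \<open>0\<close>.\<close>

lemma rep_character:
  assumes \<rho>: "irreducible_rep scale n \<rho>"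
  shows "(\<lambda>h. \<Sum>i<n. \<rho> h $$ (i, i)) \<in> class_character ` (J // R)"
proof -
  have n0: "n > 0" and rep: "matrix_rep scale n \<rho>"
    using \<rho> by (auto simp: irreducible_rep_def)
  have car: "\<rho> a \<in> carrier_mat n n" and one: "\<rho> 1 = 1\<^sub>m n" and mul: "\<rho> (a * b) = \<rho> a * \<rho> b"
    and add: "\<rho> (a + b) = \<rho> a + \<rho> b" and scl: "\<rho> (scale r a) = r \<cdot>\<^sub>m \<rho> a" for a b r
    using rep by (auto simp: matrix_rep_def)
  have dims [simp]: "dim_row (\<rho> a) = n" "dim_col (\<rho> a) = n" for a using car[of a] by auto
  define r where "r a b h = \<rho> h $$ (a, b)" for a b h
  have fr: "functional (r a b)" if "a < n" "b < n" for a b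
    using that by (auto simp: functional_def r_def add scl)
  have r_mul: "r a b (x * y) = (\<Sum>c<n. r a c x * r c b y)" if "a < n" "b < n" for a b x y
    using that by (simp add: r_def mul scalar_prod_def atLeast0LessThan)
  have r_one: "r a b 1 = (if a = b then 1 else 0)" if "a < n" "b < n" for a b
    using that by (simp add: r_def one)
  define \<tau> where "\<tau> h = (\<Sum>i<n. r i i h)" for h
  have f\<tau>: "functional \<tau>"
    unfolding functional_def \<tau>_def using functional_simps[OF fr]
    by (auto simp: sum.distrib sum_distrib_left)
  have \<tau>_comm: "\<tau> (x * y) = \<tau> (y * x)" for x y
    unfolding \<tau>_def by (simp add: r_mul) (subst sum.swap, simp add: mult.commute)
  \<comment> \<open>by irreducibility, the orbit of a nonzero vector is the whole space\<close>
  have generate: "\<exists>h. \<forall>a<n. (\<Sum>b<n. r a b h * v b) = u a" if v: "b0 < n" "v b0 \<noteq> 0" for v u :: "nat \<Rightarrow> 'k" and b0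
  proof -
    define vv where "vv = vec n v"
    define W where "W = range (\<lambda>h. \<rho> h *\<^sub>v vv)"
    have vvc: "vv \<in> carrier_vec n" by (simp add: vv_def)
    have "invariant_subspace n \<rho> W"
      unfolding invariant_subspace_def
    proof (intro conjI ballI allI)
      show "W \<subseteq> carrier_vec n" using mult_mat_vec_carrier[OF car vvc] by (auto simp: W_def)
      have "\<rho> (scale 0 0) = 0\<^sub>m n n" unfolding scl by (rule eq_matI) auto
      then have "\<rho> 0 = 0\<^sub>m n n" by simp
      then have "\<rho> 0 *\<^sub>v vv = 0\<^sub>v n" by (intro eq_vecI) (auto simp: vv_def scalar_prod_def)
      then show "0\<^sub>v n \<in> W" unfolding W_def by (metis rangeI)
    next
      fix x y assume "x \<in> W" "y \<in> W"
      then obtain a b where "x = \<rho> a *\<^sub>v vv" "y = \<rho> b *\<^sub>v vv" by (auto simp: W_def)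
      then have "x + y = \<rho> (a + b) *\<^sub>v vv"
        using car vvc by (simp add: add add_mult_distrib_mat_vec[OF car car vvc])
      then show "x + y \<in> W" by (auto simp: W_def)
    next
      fix s x assume "x \<in> W"
      then obtain a where "x = \<rho> a *\<^sub>v vv" by (auto simp: W_def)
      then have "s \<cdot>\<^sub>v x = \<rho> (scale s a) *\<^sub>v vv"
        by (intro eq_vecI) (auto simp: scl vv_def scalar_prod_def sum_distrib_left mult.assoc)
      then show "s \<cdot>\<^sub>v x \<in> W" by (auto simp: W_def)
    next
      fix h x assume "x \<in> W"
      then obtain a where "x = \<rho> a *\<^sub>v vv" by (auto simp: W_def)
      then have "\<rho> h *\<^sub>v x = \<rho> (h * a) *\<^sub>v vv"
        using car vvc by (simp add: mul assoc_mult_mat_vec[OF car car vvc])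
      then show "\<rho> h *\<^sub>v x \<in> W" by (auto simp: W_def)
    qed
    then have "W = {0\<^sub>v n} \<or> W = carrier_vec n" using \<rho> by (simp add: irreducible_rep_def)
    moreover have "vv \<in> W" unfolding W_def by (rule range_eqI[of _ _ 1]) (simp add: one vvc)
    moreover have "vv \<noteq> 0\<^sub>v n"
    proof
      assume "vv = 0\<^sub>v n"
      then have "vv $ b0 = 0\<^sub>v n $ b0" by simp
      then show False using v by (simp add: vv_def)
    qed
    ultimately have "vec n u \<in> W" by auto
    then obtain h where h: "vec n u = \<rho> h *\<^sub>v vv" by (auto simp: W_def)
    have "(\<Sum>b<n. r a b h * v b) = u a" if a: "a < n" for a
    proof -
      have "vec n u $ a = (\<rho> h *\<^sub>v vv) $ a" by (simp only: h)
      then show ?thesis using a by (simp add: vv_def scalar_prod_def r_def atLeast0LessThan)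
    qed
    then show ?thesis by blast
  qed
  have "\<exists>j\<in>J. \<exists>a<n. \<exists>b<n. r a b (E j j) \<noteq> 0"
  proof (rule ccontr)
    assume "\<not> ?thesis"
    then have "(\<Sum>j\<in>J. r 0 0 (E j j)) = 0" using n0 by simp
    then have "r 0 0 1 = 0" using functional_sum[OF fr[OF n0 n0], of "\<lambda>j. E j j" J] by (simp add: E_sum)
    then show False using r_one[OF n0 n0] by simp
  qed
  then obtain j a0 b0 where j: "j \<in> J" "a0 < n" "b0 < n" "r a0 b0 (E j j) \<noteq> 0" by blast
  define v where "v a = r a b0 (E j j)" for a
  have v0: "v a0 \<noteq> 0" using j by (simp add: v_def)
  have idem: "E j j * E j j = E j j" using R_refl[OF j(1)] by (simp add: E_mult)
  have Ev: "(\<Sum>b<n. r a b (E j j) * v b) = v a" if "a < n" for a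
    unfolding v_def using r_mul[OF that j(3), of "E j j" "E j j"] by (simp add: idem)
  \<comment> \<open>\<open>v\<close> absorbs \<open>E j j\<close>, so that products of the form \<open>E i i * h * E j j\<close> appear\<close>
  have act: "(\<Sum>b<n. r a b x * (\<Sum>c<n. r b c h * v c)) = (\<Sum>c<n. r a c (x * h * E j j) * v c)"
    if a: "a < n" for a x h
  proof -
    have "(\<Sum>c<n. r a c (x * h * E j j) * v c) = (\<Sum>c<n. \<Sum>d<n. r a d (x * h) * (r d c (E j j) * v c))"
      using a by (simp add: r_mul[of _ _ "x * h"] sum_distrib_right mult.assoc[where ?'a = 'k])
    also have "\<dots> = (\<Sum>d<n. r a d (x * h) * v d)"
      by (subst sum.swap) (simp add: Ev flip: sum_distrib_left)
    also have "\<dots> = (\<Sum>d<n. \<Sum>b<n. r a b x * (r b d h * v d))"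
      using a by (simp add: r_mul sum_distrib_right mult.assoc)
    finally show ?thesis by (subst (asm) sum.swap) (simp add: sum_distrib_left)
  qed
  have column: "\<exists>h. \<forall>a<n. \<forall>x. r a l x = (\<Sum>c<n. r a c (x * h * E j j) * v c)" if l: "l < n" for l
  proof -
    obtain h where h: "\<And>a. a < n \<Longrightarrow> (\<Sum>b<n. r a b h * v b) = (if a = l then 1 else 0)"
      using generate[of a0 v "\<lambda>a. if a = l then 1 else 0", OF j(2) v0] by blast
    have "r a l x = (\<Sum>c<n. r a c (x * h * E j j) * v c)" if a: "a < n" for a x
    proof -
      have "r a l x = (\<Sum>b<n. if b = l then r a b x else 0)" using l by simp
      also have "\<dots> = (\<Sum>b<n. r a b x * (\<Sum>c<n. r b c h * v c))"
        by (intro sum.cong HOL.refl) (simp add: h)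
      finally show ?thesis by (simp add: act[OF a])
    qed
    then show ?thesis by blast
  qed
  have \<tau>_other: "\<tau> (E i i) = 0" if i: "i \<in> J" "(i, j) \<notin> R" for i
  proof -
    have "r l l (E i i) = 0" if l: "l < n" for l
    proof -
      obtain h where "r l l (E i i) = (\<Sum>c<n. r l c (E i i * h * E j j) * v c)"
        using column[OF l] l by blast
      then show ?thesis using i E_corner[OF i(1) j(1)] functional_zero[OF fr] l by simp
    qed
    then show ?thesis by (simp add: \<tau>_def)
  qed
  have \<tau>_j: "\<tau> (E j j) = 1"
  proof -
    have "\<exists>c. \<forall>a<n. r a l (E j j) = c * v a" if l: "l < n" for l
    proof -
      obtain h where h: "\<And>a. a < n \<Longrightarrow> r a l (E j j) = (\<Sum>c<n. r a c (E j j * h * E j j) * v c)"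
        using column[OF l] by blast
      have "r a l (E j j) = entry j j h * v a" if a: "a < n" for a
      proof -
        have "r a l (E j j) = (\<Sum>c<n. entry j j h * (r a c (E j j) * v c))"
          unfolding h[OF a] E_corner[OF j(1) j(1)]
          using R_refl[OF j(1)] a by (intro sum.cong HOL.refl) (simp add: functional_scale[OF fr])
        then show ?thesis by (simp add: Ev[OF a] flip: sum_distrib_left)
      qed
      then show ?thesis by blast
    qed
    then obtain \<phi> where \<phi>: "\<And>l a. l < n \<Longrightarrow> a < n \<Longrightarrow> r a l (E j j) = \<phi> l * v a" by metis
    have "v a0 = (\<Sum>b<n. \<phi> b * v a0 * v b)" using Ev[OF j(2)] \<phi> j(2) by simp
    also have "\<dots> = v a0 * (\<Sum>b<n. \<phi> b * v b)" by (simp add: sum_distrib_left mult_ac)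
    finally have "(\<Sum>b<n. \<phi> b * v b) = 1" using v0 by simp
    then show ?thesis by (simp add: \<tau>_def \<phi>)
  qed
  have \<tau>_class: "\<tau> (E i i) = 1" if "(i, j) \<in> R" for i
  proof -
    have "\<tau> (E i i) = \<tau> (E i j * E j i)" using that R_sym by (simp add: E_mult)
    also have "\<dots> = \<tau> (E j i * E i j)" by (rule \<tau>_comm)
    also have "\<dots> = \<tau> (E j j)" using that R_sym[OF that] by (simp add: E_mult)
    finally show ?thesis by (simp add: \<tau>_j)
  qed
  have \<tau>_off: "\<tau> (E i k) = 0" if "(i, k) \<in> R" "i \<noteq> k" for i k
  proof -
    have "\<tau> (E i k) = \<tau> (E i i * E i k)" using that R_refl R_J by (simp add: E_mult)
    also have "\<dots> = \<tau> (E i k * E i i)" by (rule \<tau>_comm)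
    also have "\<dots> = 0" using that R_refl R_J functional_zero[OF f\<tau>] by (simp add: E_mult)
    finally show ?thesis .
  qed
  define C where "C = R `` {j}"
  have "\<tau> h = class_character C h" for h
  proof -
    have "\<tau> h = \<tau> (\<Sum>(i, k)\<in>R. scale (entry i k h) (E i k))" by (simp only: entry_expand)
    also have "\<dots> = (\<Sum>(i, k)\<in>R. entry i k h * \<tau> (E i k))"
      by (simp add: functional_sum[OF f\<tau>] functional_scale[OF f\<tau>] case_prod_unfold)
    also have "\<dots> = (\<Sum>z\<in>(\<lambda>i. (i, i)) ` C. entry (fst z) (snd z) h * \<tau> (E (fst z) (snd z)))"
      unfolding case_prod_unfold
    proof (rule sum.mono_neutral_right[OF fin_R])
      show "(\<lambda>i. (i, i)) ` C \<subseteq> R" using R_J R_refl by (auto simp: C_def)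
      show "\<forall>z\<in>R - (\<lambda>i. (i, i)) ` C. entry (fst z) (snd z) h * \<tau> (E (fst z) (snd z)) = 0"
      proof
        fix z assume z: "z \<in> R - (\<lambda>i. (i, i)) ` C"
        obtain i k where ik: "z = (i, k)" by (cases z)
        show "entry (fst z) (snd z) h * \<tau> (E (fst z) (snd z)) = 0"
        proof (cases "i = k")
          case True
          then have "(i, j) \<notin> R" using z ik R_sym by (auto simp: C_def)
          then show ?thesis using True z ik \<tau>_other R_J by auto
        next
          case False
          then show ?thesis using z ik \<tau>_off by auto
        qed
      qed
    qed
    also have "\<dots> = (\<Sum>i\<in>C. entry i i h * \<tau> (E i i))"
      by (subst sum.reindex) (auto intro: inj_onI)
    also have "\<dots> = class_character C h"
      unfolding class_character_def using R_sym by (intro sum.cong HOL.refl) (auto simp: C_def \<tau>_class)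
    finally show ?thesis .
  qed
  then have "(\<lambda>h. \<Sum>i<n. \<rho> h $$ (i, i)) = class_character C" by (simp add: \<tau>_def r_def fun_eq_iff)
  moreover have "C \<in> J // R" using j(1) by (auto simp: C_def quotientI)
  ultimately show ?thesis by blast
qed

lemma irreducible_characters_eq: "irreducible_characters scale = class_character ` (J // R)"
  using class_rep rep_character unfolding irreducible_characters_def by blast

text \<open>The irreducible characters correspond to the blocks, and the \<open>E i i\<close> separate them; a block of size \<open>d\<close> contributes \<open>d\<close> times its
character.\<close>

lemma regular_character_eq_chi: "regular_character scale h = chi h"
proof -
  have cls: "C \<subseteq> J" "C \<noteq> {}" "\<And>i j. i \<in> C \<Longrightarrow> (i, j) \<in> R \<longleftrightarrow> j \<in> C" if C: "C \<in> J // R" for C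
  proof -
    obtain i0 where i0: "i0 \<in> J" "C = R `` {i0}" using C by (auto elim: quotientE)
    show "C \<subseteq> J" using i0 R_J by auto
    show "C \<noteq> {}" using i0 R_refl by auto
    show "(i, j) \<in> R \<longleftrightarrow> j \<in> C" if "i \<in> C" for i j using i0 that R_trans R_sym by blast
  qed
  have at_E: "class_character C (E i i) = (if i \<in> C then 1 else 0)" if C: "C \<in> J // R" and i: "i \<in> J" for C i
  proof -
    have "class_character C (E i i) = (\<Sum>k\<in>C. if k = i then 1 else 0)"
      unfolding class_character_def using cls(1)[OF C] i by (intro sum.cong HOL.refl) (auto simp: entry_E R_refl)
    moreover have "finite C" using cls(1)[OF C] fin_J finite_subset by blast
    ultimately show ?thesis by simp
  qed
  have inj: "inj_on class_character (J // R)"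
  proof (rule inj_onI)
    fix C D assume CD: "C \<in> J // R" "D \<in> J // R" "class_character C = class_character D"
    have "i \<in> C \<longleftrightarrow> i \<in> D" if "i \<in> J" for i
      using at_E[OF CD(1) that] at_E[OF CD(2) that] CD(3) by (auto split: if_splits)
    then show "C = D" using cls(1)[OF CD(1)] cls(1)[OF CD(2)] by blast
  qed
  have "regular_character scale h = (\<Sum>C\<in>J // R. class_character C 1 * class_character C h)"
    unfolding regular_character_def irreducible_characters_eq by (simp add: sum.reindex[OF inj])
  also have "\<dots> = (\<Sum>C\<in>J // R. \<Sum>(i, j)\<in>C \<times> C. entry i i h)"
  proof (intro sum.cong HOL.refl)
    fix C assume C: "C \<in> J // R"
    have "entry i i 1 = 1" if "i \<in> C" for i using cls(1)[OF C] that R_refl entry_one by auto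
    then have "class_character C 1 = of_nat (card C)" by (simp add: class_character_def)
    then show "class_character C 1 * class_character C h = (\<Sum>(i, j)\<in>C \<times> C. entry i i h)"
      by (simp add: class_character_def sum_distrib_left flip: sum.cartesian_product)
  qed
  also have "\<dots> = (\<Sum>(i, j)\<in>R. entry i i h)"
    by (rule sum_equiv_classes[OF fin_J equiv_R, symmetric])
  finally show ?thesis by (simp add: chi_eq)
qed

end

context semisimple_hopf_algebra
begin

lemma regular_character_eq: "regular_character scale = chi"
proof
  fix h
  obtain J R E entry w where "matrix_units scale \<Delta> \<epsilon> S J R E entry w" using ex_matrix_units by blast
  then interpret matrix_units scale \<Delta> \<epsilon> S J R E entry w .
  show "regular_character scale h = chi h" by (rule regular_character_eq_chi)
qed

end

section \<open>Left coideal subalgebras\<close>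

context semisimple_hopf_algebra
begin

lemmas chi_add = functional_add[OF functional_chi] and chi_scale = functional_scale[OF functional_chi]

lemma chi_S: "chi (S h) = chi h"
  using lam0_S_eq by (simp add: lam0_eq_chi)

lemma chi_left_integral: "sw (\<lambda>x y. scale (chi y) x) h = scale (chi h) 1"
  using lam0_S_left_integral by (simp add: lam0_eq_chi chi_S)

text \<open>\<open>\<Sum> h\<^sub>1 \<chi> (a h\<^sub>2) = \<Sum> S a\<^sub>1 a\<^sub>2 h\<^sub>1 \<chi> (a\<^sub>3 h\<^sub>2)\<close>, where the left integral \<open>\<chi>\<close> absorbs \<open>a\<^sub>2 \<otimes> a\<^sub>3\<close> together with \<open>\<Delta> h\<close>.\<close>

lemma chi_exchange: "sw (\<lambda>x y. scale (chi (a * y)) x) h = sw (\<lambda>x y. scale (chi (y * h)) (S x)) a"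
proof -
  have "sw (\<lambda>x y. scale (chi (y * h)) (S x)) a = sw (\<lambda>x y. S x * sw (\<lambda>p q. scale (chi q) p) (y * h)) a"
    by (simp add: chi_left_integral lin_simps)
  also have "\<dots> = sw (\<lambda>x y. S x * sw (\<lambda>u v. sw (\<lambda>p q. scale (chi (v * q)) (u * p)) h) y) a"
    by (subst sw_mult) (simp_all add: sw_simps chi_add chi_scale)
  also have "\<dots> = sw (\<lambda>x y. sw (\<lambda>u v. sw (\<lambda>p q. scale (chi (v * q)) (S x * u * p)) h) y) a"
    by (simp only: scale_mult_right mult.assoc flip: sw_mult_leftf)
  also have "\<dots> = sw (\<lambda>t v. sw (\<lambda>x u. sw (\<lambda>p q. scale (chi (v * q)) (S x * u * p)) h) t) a"
    by (rule sw_coassoc[symmetric]) (simp add: sw_simps chi_add chi_scale)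
  also have "\<dots> = sw (\<lambda>t v. sw (\<lambda>p q. scale (chi (v * q)) (scale (\<epsilon> t) 1 * p)) h) a"
    by (intro sw_cong sw_antipode_left[of "\<lambda>z. sw (\<lambda>p q. scale (chi (_ * q)) (z * p)) h"])
      (simp add: sw_simps)
  also have "\<dots> = sw (\<lambda>t v. sw (\<lambda>p q. scale (chi (scale (\<epsilon> t) v * q)) p) h) a"
    by (simp add: lin_simps chi_scale)
  also have "\<dots> = sw (\<lambda>p q. scale (chi (a * q)) p) h"
    by (rule sw_counit_left) (simp add: sw_simps chi_add)
  finally show ?thesis by simp
qed

lemma sw_in_subspace:
  assumes "subspace V" "\<And>x y. f x y \<in> V"
  shows "sw f h \<in> V"
proof -
  have "(\<Sum>z\<leftarrow>zs. g z) \<in> V" if "\<And>z. g z \<in> V" for g :: "'h \<times> 'h \<Rightarrow> 'h" and zs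
    using assms(1) that by (induction zs) (auto simp: subspace_def)
  then show ?thesis using assms(2) by (simp add: sw_def case_prod_unfold)
qed

end

locale coideal_subalgebra = semisimple_hopf_algebra scale \<Delta> \<epsilon> S
  for scale :: "'k::{alg_closed_field, field_char_0} \<Rightarrow> 'h::ring_1 \<Rightarrow> 'h"
    and \<Delta> \<epsilon> S +
  fixes N :: "'h set"
  assumes coideal: "left_coideal_subalgebra scale \<Delta> N"
begin

lemma N_subspace: "subspace N" and N_one: "1 \<in> N" and N_mult: "x \<in> N \<Longrightarrow> y \<in> N \<Longrightarrow> x * y \<in> N"
  using coideal by (auto simp: left_coideal_subalgebra_def)

lemma N_scale: "x \<in> N \<Longrightarrow> scale r x \<in> N" and N_diff: "x \<in> N \<Longrightarrow> y \<in> N \<Longrightarrow> x - y \<in> N"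
  using N_subspace by (auto intro: subspace_scale subspace_diff)

lemma N_power: "x \<in> N \<Longrightarrow> x ^ n \<in> N"
  by (induction n) (auto intro: N_one N_mult)

text \<open>The second legs of \<open>\<Delta> n\<close> may be taken in \<open>N\<close>, although the chosen list \<open>\<Delta> n\<close> need not have this form.\<close>

lemma N_sw_cong:
  fixes f g :: "'h \<Rightarrow> 'h \<Rightarrow> 'b::ab_group_add"
  assumes "n \<in> N" "bal2 f" "bal2 g" "\<And>x y. y \<in> N \<Longrightarrow> f x y = g x y"
  shows "sw f n = sw g n"
proof -
  obtain t where t: "tensor2_eq scale (\<Delta> n) t" "snd ` set t \<subseteq> N"
    using coideal assms(1) by (auto simp: left_coideal_subalgebra_def)
  have "sw f n = (\<Sum>(x, y)\<leftarrow>t. f x y)"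
    unfolding sw_def by (rule tensor2_eval[OF t(1) assms(2)])
  also have "\<dots> = (\<Sum>(x, y)\<leftarrow>t. g x y)"
    using t(2) assms(4) by (intro arg_cong[of _ _ sum_list] map_cong) auto
  also have "\<dots> = sw g n"
    unfolding sw_def by (rule tensor2_eval[OF t(1) assms(3), symmetric])
  finally show ?thesis .
qed

lemma N_sw_in:
  assumes "n \<in> N" "bal2 f" "\<And>x y. y \<in> N \<Longrightarrow> f x y \<in> N"
  shows "sw f n \<in> N"
proof -
  obtain t where t: "tensor2_eq scale (\<Delta> n) t" "snd ` set t \<subseteq> N"
    using coideal assms(1) by (auto simp: left_coideal_subalgebra_def)
  have "sw f n = (\<Sum>(x, y)\<leftarrow>t. f x y)"
    unfolding sw_def by (rule tensor2_eval[OF t(1) assms(2)])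
  also have "\<dots> \<in> N"
    using t(2) assms(3) N_subspace by (induction t) (auto simp: subspace_def)
  finally show ?thesis .
qed

text \<open>The powers of \<open>r\<close> are linearly dependent, so \<open>r ^ a = r ^ Suc a * y\<close> for some polynomial \<open>y\<close> in \<open>r\<close>.  Iterating gives
\<open>r ^ b = r ^ (2 b) y ^ b\<close>, and then \<open>r ^ b y ^ b\<close> is idempotent.  It is not zero since \<open>\<epsilon> r \<noteq> 0\<close>.\<close>

lemma ex_idempotent_multiple:
  assumes r: "r \<in> N" "\<epsilon> r \<noteq> 0"
  obtains s where "s \<in> N" "(r * s) * (r * s) = r * s" "\<epsilon> (r * s) = 1"
proof -
  obtain n c where n: "r ^ n = (\<Sum>j<n. scale (c j) (r ^ j))"
    using sequence_dependent[of "\<lambda>i. r ^ i"] by blast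
  \<comment> \<open>the relation \<open>\<Sum> c' j r ^ j = 0\<close> is solved for its lowest term\<close>
  define c' where "c' j = (if j = n then - 1 else c j)" for j
  have rel: "(\<Sum>j\<le>n. scale (c' j) (r ^ j)) = 0"
    unfolding lessThan_Suc_atMost[symmetric] by (simp add: c'_def n)
  define a where "a = (LEAST j. c' j \<noteq> 0)"
  have "c' n \<noteq> 0" by (simp add: c'_def)
  then have a: "c' a \<noteq> 0" "a \<le> n" "\<And>j. j < a \<Longrightarrow> c' j = 0"
    unfolding a_def using LeastI[of "\<lambda>j. c' j \<noteq> 0" n] Least_le[of "\<lambda>j. c' j \<noteq> 0" n] not_less_Least
    by blast+
  define y where "y = (\<Sum>j\<in>{a<..n}. scale (- c' j / c' a) (r ^ (j - Suc a)))"
  have yN: "y \<in> N"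
    unfolding y_def using N_subspace r by (intro subspace_sum subspace_scale N_power)
  have ry: "r * y = y * r"
    by (simp add: y_def sum_distrib_left sum_distrib_right lin_simps power_commutes)
  have rpow: "r ^ a = r ^ Suc a * y"
  proof -
    have split: "{..n} = {..<a} \<union> insert a {a<..n}" using a(2) by auto
    have "(\<Sum>j\<le>n. scale (c' j) (r ^ j))
        = (\<Sum>j<a. scale (c' j) (r ^ j)) + (\<Sum>j\<in>insert a {a<..n}. scale (c' j) (r ^ j))"
      unfolding split by (rule sum.union_disjoint) auto
    then have "(\<Sum>j\<le>n. scale (c' j) (r ^ j))
        = (\<Sum>j<a. scale (c' j) (r ^ j)) + (scale (c' a) (r ^ a) + (\<Sum>j\<in>{a<..n}. scale (c' j) (r ^ j)))"
      by simp
    then have "scale (c' a) (r ^ a) = - (\<Sum>j\<in>{a<..n}. scale (c' j) (r ^ j))"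
      using rel a(3) by (simp add: add_eq_0_iff2)
    then have "scale (inverse (c' a)) (scale (c' a) (r ^ a))
        = scale (inverse (c' a)) (- (\<Sum>j\<in>{a<..n}. scale (c' j) (r ^ j)))"
      by simp
    then have "r ^ a = (\<Sum>j\<in>{a<..n}. scale (- c' j / c' a) (r ^ j))"
      using a(1) by (simp add: scale_sum_right sum_negf divide_inverse mult.commute)
    also have "\<dots> = r ^ Suc a * y"
      unfolding y_def sum_distrib_left
      by (intro sum.cong HOL.refl) (simp add: lin_simps del: power_Suc flip: power_add)
    finally show ?thesis .
  qed
  have ryp: "r ^ i * y ^ j = y ^ j * r ^ i" for i j
    using ry by (metis power_commuting_commutes)
  define b where "b = Suc a"
  have "r ^ b = r ^ (b + k) * y ^ k" for k
  proof (induction k)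
    case (Suc k)
    have "r ^ (b + Suc k) = r ^ Suc k * r ^ Suc a"
      unfolding power_add[symmetric] by (simp add: b_def add.commute)
    then have "r ^ (b + Suc k) * y ^ Suc k = r ^ Suc k * (r ^ Suc a * y) * y ^ k"
      by (simp only: power_Suc[of y] mult.assoc)
    also have "\<dots> = r ^ Suc k * r ^ a * y ^ k"
      by (simp only: rpow[symmetric])
    also have "r ^ Suc k * r ^ a = r ^ (b + k)"
      unfolding power_add[symmetric] by (simp add: b_def add.commute)
    finally show ?case using Suc by simp
  qed simp
  then have rb: "r ^ b = r ^ (b + b) * y ^ b" by blast
  define s where "s = r ^ a * y ^ b"
  have e: "r * s = r ^ b * y ^ b" by (simp add: s_def b_def mult.assoc)
  show ?thesis
  proof
    show "s \<in> N" unfolding s_def using r(1) yN by (intro N_mult N_power)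
    have "(r * s) * (r * s) = r ^ b * (y ^ b * r ^ b) * y ^ b" by (simp only: e mult.assoc)
    also have "\<dots> = (r ^ (b + b) * y ^ b) * y ^ b"
      unfolding ryp[symmetric] by (simp only: power_add mult.assoc)
    finally show "(r * s) * (r * s) = r * s" by (simp add: e flip: rb)
    have eps_pow: "\<epsilon> (x ^ i) = \<epsilon> x ^ i" for x i by (induction i) (auto simp: counit_mult counit_one)
    have "\<epsilon> r ^ b = \<epsilon> r ^ b * (\<epsilon> r ^ b * \<epsilon> y ^ b)"
      using arg_cong[OF rb, of \<epsilon>] by (simp add: counit_mult eps_pow power_add mult.assoc)
    then have "\<epsilon> r ^ b * \<epsilon> y ^ b = 1" using r(2) by simp
    then show "\<epsilon> (r * s) = 1" by (simp add: e counit_mult eps_pow)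
  qed
qed

text \<open>An element \<open>r\<close> of the radical has \<open>\<epsilon> r = 0\<close>, since otherwise \<open>r N\<close> would contain an idempotent with nonzero trace.
By \<open>chi_exchange\<close> the radical is also a left coideal, so \<open>\<Sum> p r\<^sub>1 r\<^sub>2\<close> lies in it for every functional \<open>p\<close>, and applying \<open>\<epsilon>\<close> gives
\<open>p r = 0\<close>.\<close>

lemma N_nondegenerate:
  assumes n: "n \<in> N" and 0: "\<And>m. m \<in> N \<Longrightarrow> chi (n * m) = 0"
  shows "n = 0"
proof -
  have rad: "\<epsilon> r = 0" if r: "r \<in> N" "\<And>m. m \<in> N \<Longrightarrow> chi (r * m) = 0" for r
  proof (rule ccontr)
    assume "\<epsilon> r \<noteq> 0"
    then obtain s where s: "s \<in> N" "(r * s) * (r * s) = r * s" "\<epsilon> (r * s) = 1"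
      using ex_idempotent_multiple r(1) by blast
    have "r * s = 0" using chi_idempotent[OF s(2)] r(2)[OF s(1)] by blast
    then show False using s(3) eps_zero by simp
  qed
  have 1: "sw (\<lambda>x y. scale (chi (y * m)) x) n = 0" if m: "m \<in> N" for m
  proof -
    have "S (sw (\<lambda>x y. scale (chi (y * m)) x) n) = sw (\<lambda>x y. scale (chi (y * m)) (S x)) n"
      by (subst sw_comp) (simp_all add: additive_def lin_simps)
    also have "\<dots> = sw (\<lambda>x y. scale (chi (n * y)) x) m"
      by (rule chi_exchange[symmetric])
    also have "\<dots> = sw (\<lambda>x y. 0) m"
      by (rule N_sw_cong[OF m]) (simp_all add: sw_simps chi_add chi_scale 0)
    finally show ?thesis by (simp add: sw_zero S_eq_0)
  qed
  have "p n = p 0" if p: "functional p" for p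
  proof -
    note pl = functional_simps[OF p]
    define r where "r = sw (\<lambda>x y. scale (p x) y) n"
    have "r \<in> N"
      unfolding r_def by (rule N_sw_in[OF n]) (auto simp: sw_simps pl N_scale)
    moreover have "chi (r * m) = 0" if m: "m \<in> N" for m
    proof -
      have "chi (r * m) = sw (\<lambda>x y. p x * chi (y * m)) n"
        unfolding r_def by (subst sw_comp[of "\<lambda>z. chi (z * m)"]) (simp_all add: additive_def lin_simps chi_add chi_scale)
      also have "\<dots> = p (sw (\<lambda>x y. scale (chi (y * m)) x) n)"
        by (subst sw_comp[of p]) (simp_all add: additive_def pl mult.commute)
      finally show ?thesis by (simp add: 1[OF m] functional_zero[OF p])
    qed
    ultimately have "\<epsilon> r = 0" by (rule rad)
    moreover have "\<epsilon> r = sw (\<lambda>x y. p (scale (\<epsilon> y) x)) n"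
      unfolding r_def by (subst sw_comp[of \<epsilon>]) (simp_all add: additive_def lin_simps pl mult.commute)
    moreover have "sw (\<lambda>x y. p (scale (\<epsilon> y) x)) n = p n"
      by (rule sw_counit_right) (simp add: additive_def pl)
    ultimately show ?thesis by (simp add: functional_zero[OF p])
  qed
  then show ?thesis by (rule functional_separate)
qed

text \<open>The map \<open>\<Psi>\<close> is the Gram matrix of the trace form, read as an endomorphism of \<open>N\<close> through a basis; it is injective by
nondegeneracy, hence onto.\<close>

lemma N_representation:
  assumes \<phi>: "\<And>x y. x \<in> N \<Longrightarrow> y \<in> N \<Longrightarrow> \<phi> (x + y) = \<phi> x + \<phi> y"
    "\<And>r x. x \<in> N \<Longrightarrow> \<phi> (scale r x) = r * \<phi> x"
  obtains m where "m \<in> N" "\<And>n. n \<in> N \<Longrightarrow> \<phi> n = chi (n * m)"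
proof -
  obtain B where B: "B \<subseteq> N" "independent B" "N \<subseteq> span B" "card B = dim N"
    using basis_exists[of N] by blast
  have fB: "finite B" using B(2) by (rule finiteI_independent)
  have spanB: "span B = N" using B N_subspace by (simp add: span_subspace)
  define \<Psi> where "\<Psi> m = (\<Sum>b\<in>B. scale (chi (b * m)) b)" for m
  have endo\<Psi>: "endo \<Psi>"
    by (auto simp: endo_def \<Psi>_def lin_simps chi_add chi_scale sum.distrib scale_sum_right)
  have coeffs: "u b = u' b" if "(\<Sum>b\<in>B. scale (u b) b) = (\<Sum>b\<in>B. scale (u' b) b)" "b \<in> B" for u u' :: "'h \<Rightarrow> 'k" and b
  proof -
    have "(\<Sum>b\<in>B. scale (u b - u' b) b) = 0"
      using that(1) by (simp add: scale_left_diff_distrib sum_subtractf)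
    then show ?thesis using independentD[OF B(2) fB subset_refl _ that(2)] by fastforce
  qed
  have extend: "\<phi> n = chi (n * m)"
    if that: "\<And>b. b \<in> B \<Longrightarrow> \<phi> b = chi (b * m)" "n \<in> N"
    and \<phi>: "\<And>x y. x \<in> N \<Longrightarrow> y \<in> N \<Longrightarrow> \<phi> (x + y) = \<phi> x + \<phi> y" "\<And>r x. x \<in> N \<Longrightarrow> \<phi> (scale r x) = r * \<phi> x"
    for m n and \<phi> :: "'h \<Rightarrow> 'k"
  proof -
    have "n \<in> span B" using that(2) B(3) by blast
    then have "n \<in> N \<and> \<phi> n = chi (n * m)"
    proof (induction rule: span_induct_alt)
      case base
      show ?case using \<phi>(2)[of 0 0] subspace_0[OF N_subspace] functional_zero[OF functional_chi] by simp
    next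
      case (step r x y)
      have "x \<in> N" "scale r x \<in> N" using step(1) B(1) by (auto intro: N_scale)
      then show ?case
        using step that(1)[OF step(1)] \<phi>(1)[of "scale r x" y] \<phi>(2)[of x r] subspace_add[OF N_subspace]
        by (simp add: lin_simps chi_add chi_scale)
    qed
    then show ?thesis ..
  qed
  have inj: "inj_on \<Psi> (span N)"
  proof (rule inj_onI)
    fix x y assume xy: "x \<in> span N" "y \<in> span N" "\<Psi> x = \<Psi> y"
    have "span N = N" using N_subspace by simp
    with xy have xyN: "x - y \<in> N" by (simp add: N_diff)
    have b0: "chi (b * (x - y)) = 0" if "b \<in> B" for b
      using coeffs[OF xy(3)[unfolded \<Psi>_def] that] by (simp add: right_diff_distrib functional_diff[OF functional_chi])
    have "chi (n * (x - y)) = 0" if "n \<in> N" for n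
      using extend[of "\<lambda>_. 0" "x - y" n] b0 that by simp
    then have "x - y = 0" using xyN by (intro N_nondegenerate) (auto simp: chi_commute)
    then show "x = y" by simp
  qed
  interpret pair: finite_dimensional_vector_space_pair_1 scale Bas scale ..
  have "dim (\<Psi> ` N) = dim N"
    using pair.dim_image_eq[OF _ inj] endo\<Psi> by (simp add: endo_iff_linear)
  moreover have "\<Psi> ` N \<subseteq> N"
    unfolding \<Psi>_def using B(1) N_subspace by (auto intro!: subspace_sum N_scale)
  moreover have "subspace (\<Psi> ` N)"
    using pair.linear_subspace_image[of \<Psi> N] endo\<Psi> N_subspace by (simp add: endo_iff_linear)
  ultimately have surj: "\<Psi> ` N = N" using N_subspace by (intro subspace_dim_equal) auto
  have "(\<Sum>b\<in>B. scale (\<phi> b) b) \<in> N"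
    using B(1) N_subspace by (auto intro!: subspace_sum N_scale)
  then obtain m where m: "m \<in> N" "(\<Sum>b\<in>B. scale (\<phi> b) b) = \<Psi> m" using surj by blast
  have "\<phi> b = chi (b * m)" if "b \<in> B" for b
    using coeffs[OF m(2)[unfolded \<Psi>_def] that] .
  then show ?thesis using extend[of \<phi> m] \<phi> m(1) that by blast
qed

text \<open>The element of \<open>N\<close> that represents \<open>\<epsilon>\<close>; a multiple of \<open>\<Lambda>\<^sub>N\<close>.\<close>

definition counit_rep :: 'h where
  "counit_rep = (SOME z. z \<in> N \<and> (\<forall>n\<in>N. \<epsilon> n = chi (n * z)))"

lemma counit_rep_N: "counit_rep \<in> N" and chi_counit_rep: "n \<in> N \<Longrightarrow> chi (n * counit_rep) = \<epsilon> n"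
proof -
  obtain m where "m \<in> N" "\<And>n. n \<in> N \<Longrightarrow> \<epsilon> n = chi (n * m)"
    using N_representation[of \<epsilon>] by (auto simp: lin_simps)
  then have "\<exists>z. z \<in> N \<and> (\<forall>n\<in>N. \<epsilon> n = chi (n * z))" by blast
  from someI_ex[OF this, folded counit_rep_def] show "counit_rep \<in> N" "n \<in> N \<Longrightarrow> chi (n * counit_rep) = \<epsilon> n" by auto
qed

lemma counit_rep_left: "n \<in> N \<Longrightarrow> n * counit_rep = scale (\<epsilon> n) counit_rep"
proof -
  assume n: "n \<in> N"
  have "n * counit_rep - scale (\<epsilon> n) counit_rep = 0"
  proof (rule N_nondegenerate)
    show "n * counit_rep - scale (\<epsilon> n) counit_rep \<in> N" using n counit_rep_N by (intro N_diff N_mult N_scale)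
    fix m assume m: "m \<in> N"
    have "chi (n * counit_rep * m) = chi (m * n * counit_rep)" using chi_commute[of "n * counit_rep" m] by (simp add: mult.assoc)
    moreover have "chi (counit_rep * m) = \<epsilon> m" using chi_counit_rep[OF m] by (simp add: chi_commute)
    ultimately show "chi ((n * counit_rep - scale (\<epsilon> n) counit_rep) * m) = 0"
      using chi_counit_rep[OF N_mult[OF m n]]
      by (simp add: left_diff_distrib functional_diff[OF functional_chi] lin_simps chi_scale)
  qed
  then show ?thesis by simp
qed

lemma counit_rep_right: "n \<in> N \<Longrightarrow> counit_rep * n = scale (\<epsilon> n) counit_rep"
proof -
  assume n: "n \<in> N"
  have "counit_rep * n - scale (\<epsilon> n) counit_rep = 0"
  proof (rule N_nondegenerate)
    show "counit_rep * n - scale (\<epsilon> n) counit_rep \<in> N" using n counit_rep_N by (intro N_diff N_mult N_scale)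
    fix m assume m: "m \<in> N"
    have "chi (counit_rep * n * m) = chi (n * m * counit_rep)" using chi_commute[of counit_rep "n * m"] by (simp add: mult.assoc)
    moreover have "chi (counit_rep * m) = \<epsilon> m" using chi_counit_rep[OF m] by (simp add: chi_commute)
    ultimately show "chi ((counit_rep * n - scale (\<epsilon> n) counit_rep) * m) = 0"
      using chi_counit_rep[OF N_mult[OF n m]]
      by (simp add: left_diff_distrib functional_diff[OF functional_chi] lin_simps chi_scale)
  qed
  then show ?thesis by simp
qed

text \<open>Up to a scalar, \<open>h \<mapsto> \<lambda>\<^sub>B \<rightharpoonup> h\<close>.\<close>

definition proj :: "'h \<Rightarrow> 'h" where
  "proj h = sw (\<lambda>x y. scale (chi (counit_rep * y)) x) h"

lemma endo_proj: "endo proj"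
  unfolding endo_def proj_def by (auto simp: sw_simps chi_add chi_scale) (simp flip: sw_scalef)

lemma proj_alt: "proj h = sw (\<lambda>x y. scale (chi (y * h)) (S x)) counit_rep"
  unfolding proj_def by (rule chi_exchange)

lemma proj_id: "n \<in> N \<Longrightarrow> proj n = n"
proof -
  assume n: "n \<in> N"
  have "proj n = sw (\<lambda>x y. scale (\<epsilon> y) x) n"
    unfolding proj_def using chi_counit_rep
    by (intro N_sw_cong[OF n]) (simp_all add: sw_simps chi_add chi_scale chi_commute[of counit_rep])
  also have "\<dots> = n" using sw_counit_right[of "\<lambda>x. x"] by (simp add: additive_def)
  finally show ?thesis .
qed

text \<open>In \<open>proj_alt\<close> the element \<open>h\<close> enters only through the functional \<open>n \<mapsto> \<chi> (n h)\<close> on \<open>N\<close>, so it may be replaced by an element of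
\<open>N\<close>, which \<open>proj\<close> fixes.\<close>

lemma proj_N: "proj h \<in> N"
proof -
  obtain m where m: "m \<in> N" "\<And>n. n \<in> N \<Longrightarrow> chi (n * h) = chi (n * m)"
    using N_representation[of "\<lambda>n. chi (n * h)"] by (auto simp: lin_simps chi_add chi_scale)
  have "proj h = proj m"
    unfolding proj_alt using m(2) by (intro N_sw_cong[OF counit_rep_N]) (simp_all add: sw_simps chi_add chi_scale)
  then show ?thesis using proj_id[OF m(1)] m(1) by simp
qed

text \<open>The trace of the projection \<open>proj\<close> is \<open>\<epsilon> counit_rep dim H\<close> by \<open>S\<^sup>2 = id\<close>, and it is not zero.\<close>

lemma eps_counit_rep_nonzero: "\<epsilon> counit_rep \<noteq> 0"
proof
  assume "\<epsilon> counit_rep = 0"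
  have "tr proj = sw (\<lambda>x y. chi (y * S x)) counit_rep"
    by (rule tr_sw[where \<phi> = "\<lambda>x y h. chi (y * h)" and g = "\<lambda>x y. S x"])
      (auto simp: proj_alt functional_def lin_simps chi_add chi_scale)
  also have "\<dots> = sw (\<lambda>x y. chi (S (x * S y))) counit_rep"
    by (simp add: S_mult S2_id)
  also have "\<dots> = chi (S (scale (\<epsilon> counit_rep) 1))"
    by (rule sw_antipode_right) (simp add: additive_def lin_simps chi_add)
  finally have "tr proj = 0" using \<open>\<epsilon> counit_rep = 0\<close> functional_zero[OF functional_chi] by (simp add: S_zero)
  then have "proj 1 = 0" using endo_proj proj_id[OF proj_N] by (intro tr_idempotent_eq_0) auto
  then show False using proj_id[OF N_one] by simp
qed

lemma integral_of_N: "integral_of scale \<epsilon> N = scale (inverse (\<epsilon> counit_rep)) counit_rep"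
  unfolding integral_of_def
proof (rule the_equality)
  show "scale (inverse (\<epsilon> counit_rep)) counit_rep \<in> N \<and>
    (\<forall>n\<in>N. n * scale (inverse (\<epsilon> counit_rep)) counit_rep = scale (\<epsilon> n) (scale (inverse (\<epsilon> counit_rep)) counit_rep) \<and>
      scale (inverse (\<epsilon> counit_rep)) counit_rep * n = scale (\<epsilon> n) (scale (inverse (\<epsilon> counit_rep)) counit_rep)) \<and>
    \<epsilon> (scale (inverse (\<epsilon> counit_rep)) counit_rep) = 1"
    using counit_rep_N eps_counit_rep_nonzero by (auto simp: N_scale lin_simps counit_rep_left counit_rep_right)
  fix L assume L: "L \<in> N \<and> (\<forall>n\<in>N. n * L = scale (\<epsilon> n) L \<and> L * n = scale (\<epsilon> n) L) \<and> \<epsilon> L = 1"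
  then have "L * counit_rep = counit_rep" "L * counit_rep = scale (\<epsilon> counit_rep) L" using counit_rep_left[of L] counit_rep_N by auto
  then have "scale (inverse (\<epsilon> counit_rep)) counit_rep = scale (inverse (\<epsilon> counit_rep)) (scale (\<epsilon> counit_rep) L)" by simp
  then show "L = scale (inverse (\<epsilon> counit_rep)) counit_rep" using eps_counit_rep_nonzero by simp
qed

lemma S_counit_rep: "S counit_rep = counit_rep"
proof -
  have "counit_rep = proj counit_rep" using proj_id[OF counit_rep_N] by simp
  also have "\<dots> = sw (\<lambda>x y. S (scale (\<epsilon> y) x)) counit_rep"
    unfolding proj_alt using chi_counit_rep
    by (intro N_sw_cong[OF counit_rep_N]) (simp_all add: sw_simps chi_add chi_scale)
  also have "\<dots> = S counit_rep" by (rule sw_counit_right) (simp add: additive_def lin_simps)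
  finally show ?thesis by simp
qed

lemma chi_counit_rep_S: "chi (counit_rep * S h) = chi (counit_rep * h)"
proof -
  have "chi (counit_rep * S h) = chi (S (h * counit_rep))" by (simp add: S_mult S_counit_rep)
  then show ?thesis by (simp add: chi_S chi_commute)
qed

lemma proj_S: "proj (S h) = sw (\<lambda>u v. scale (chi (counit_rep * u)) (S v)) h"
proof -
  have "proj (S h) = sw (\<lambda>u v. scale (chi (counit_rep * S u)) (S v)) h"
    unfolding proj_def by (rule sw_S) (simp add: sw_simps chi_add chi_scale)
  then show ?thesis by (simp only: chi_counit_rep_S)
qed

lemma functional_comp: "functional x \<Longrightarrow> endo F \<Longrightarrow> functional (\<lambda>h. x (F h))"
  by (auto simp: functional_def endo_def)

text \<open>By \<open>proj_S\<close> and coassociativity, \<open>\<Sum> h\<^sub>1 x (proj (S h\<^sub>2)) = \<Sum> proj h\<^sub>1 x (S h\<^sub>2)\<close>.\<close>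

lemma antipode_hit_proj:
  assumes x: "functional x"
  shows "hit scale \<Delta> (dual_antipode S (\<lambda>h. x (proj h))) h \<in> N"
proof -
  note xl = functional_simps[OF x]
  have "hit scale \<Delta> (dual_antipode S (\<lambda>h. x (proj h))) h
      = sw (\<lambda>a b. sw (\<lambda>u v. scale (chi (counit_rep * u) * x (S v)) a) b) h"
  proof -
    have "x (proj (S b)) = sw (\<lambda>u v. chi (counit_rep * u) * x (S v)) b" for b
      unfolding proj_S by (subst sw_comp) (simp_all add: additive_def xl)
    then show ?thesis by (simp add: hit_eq dual_antipode_def sw_scale_leftf)
  qed
  also have "\<dots> = sw (\<lambda>t v. sw (\<lambda>a u. scale (chi (counit_rep * u) * x (S v)) a) t) h"
    by (rule sw_coassoc[symmetric]) (simp add: sw_simps xl chi_add chi_scale)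
  also have "\<dots> = sw (\<lambda>t v. scale (x (S v)) (proj t)) h"
    by (simp only: proj_def scale_scale mult.commute flip: sw_scalef)
  also have "\<dots> \<in> N" by (intro sw_in_subspace N_subspace N_scale proj_N)
  finally show ?thesis .
qed

text \<open>The element \<open>\<Sum> h\<^sub>1 x (S h\<^sub>2)\<close> of \<open>N\<close> is fixed by \<open>proj\<close>; the counit of both sides gives \<open>x (proj (S h)) = x (S h)\<close>.\<close>

lemma proj_of_antipode_hit:
  assumes x: "functional x" and hit: "\<And>h. hit scale \<Delta> (dual_antipode S x) h \<in> N"
  shows "x (proj h) = x h"
proof -
  note xl = functional_simps[OF x]
  obtain h' where h': "h = S h'" using surj_S by blast
  define K where "K = sw (\<lambda>a b. scale (x (S b)) a) h'"
  have "K \<in> N" using hit[of h'] by (simp add: K_def hit_eq dual_antipode_def)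
  then have "proj K = K" by (rule proj_id)
  have eps_proj: "\<epsilon> (proj a) = chi (counit_rep * a)" for a
  proof -
    have "\<epsilon> (proj a) = sw (\<lambda>u v. chi (counit_rep * scale (\<epsilon> u) v)) a"
      unfolding proj_def by (subst sw_comp) (simp_all add: additive_def lin_simps chi_scale chi_add)
    also have "\<dots> = chi (counit_rep * a)" by (rule sw_counit_left) (simp add: additive_def lin_simps chi_add)
    finally show ?thesis .
  qed
  have "x (proj h) = sw (\<lambda>a b. chi (counit_rep * a) * x (S b)) h'"
    unfolding h' proj_S by (subst sw_comp) (simp_all add: additive_def xl)
  also have "\<dots> = \<epsilon> (proj K)"
    unfolding K_def
    by (subst sw_comp[of "\<lambda>k. \<epsilon> (proj k)"])
      (simp_all add: additive_def endo_add[OF endo_proj] endo_scale[OF endo_proj] lin_simps eps_proj chi_add chi_scale)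
  also have "\<dots> = \<epsilon> K" by (simp add: \<open>proj K = K\<close>)
  also have "\<dots> = sw (\<lambda>a b. x (S (scale (\<epsilon> a) b))) h'"
    unfolding K_def by (subst sw_comp) (simp_all add: additive_def lin_simps xl)
  also have "\<dots> = x (S h')" by (rule sw_counit_left) (simp add: additive_def lin_simps xl)
  finally show ?thesis by (simp add: h')
qed

end

section \<open>The left ideal generated by the integral of the invariants\<close>

theorem proposition2p4:
  fixes scale :: "'k::{alg_closed_field, field_char_0} \<Rightarrow> 'h::ring_1 \<Rightarrow> 'h"
    and \<Delta> :: "'h \<Rightarrow> ('h \<times> 'h) list"
    and \<epsilon> :: "'h \<Rightarrow> 'k"
    and S :: "'h \<Rightarrow> 'h"
    and N :: "'h set"
    and B :: "('h \<Rightarrow> 'k) set"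
    and lam_B :: "'h \<Rightarrow> 'k"
    and \<gamma> :: "('h \<Rightarrow> 'k) \<Rightarrow> 'h \<Rightarrow> 'k"
  assumes "hopf_algebra scale \<Delta> \<epsilon> S"
    and "semisimple_ring TYPE('h)"
    and "left_coideal_subalgebra scale \<Delta> N"
    and "B = dual_invariants scale \<epsilon> N"
    and "lam_B = hit_dual (integral_of scale \<epsilon> N) (regular_character scale)"
    and "\<And>p h. p \<in> subspace_dual scale N \<Longrightarrow> \<gamma> p h = p (hit scale \<Delta> lam_B h)"
  shows "\<gamma> ` subspace_dual scale N = {dual_mult \<Delta> x lam_B | x. x \<in> dual scale}
    \<and> {dual_mult \<Delta> x lam_B | x. x \<in> dual scale}
        = {x \<in> dual scale. \<forall>h. hit scale \<Delta> (dual_antipode S x) h \<in> N}"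
proof -
  interpret hopf_algebra scale \<Delta> \<epsilon> S by (rule assms(1))
  interpret semisimple_hopf_algebra scale \<Delta> \<epsilon> S by unfold_locales (rule assms(2))
  interpret coideal_subalgebra scale \<Delta> \<epsilon> S N by unfold_locales (rule assms(3))
  define c where "c = inverse (\<epsilon> counit_rep)"
  have c: "c * \<epsilon> counit_rep = 1" "\<epsilon> counit_rep * c = 1" "c \<noteq> 0" using eps_counit_rep_nonzero by (auto simp: c_def)
  have lam_B: "lam_B h = c * chi (counit_rep * h)" for h
    unfolding assms(5) hit_dual_def integral_of_N regular_character_eq
    by (simp add: lin_simps chi_scale chi_commute[of h] c_def)
  have G: "hit scale \<Delta> lam_B h = scale c (proj h)" for h
    unfolding hit_eq proj_def lam_B by (simp only: sw_scalef flip: scale_scale)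
  have G_N: "scale c (proj h) \<in> N" for h by (intro N_scale proj_N)
  have \<gamma>: "\<gamma> p = (\<lambda>h. p (scale c (proj h)))" if "p \<in> subspace_dual scale N" for p
    using assms(6)[OF that] by (simp add: G fun_eq_iff)
  have mult: "dual_mult \<Delta> x lam_B = (\<lambda>h. x (scale c (proj h)))" if x: "functional x" for x
  proof
    fix h
    have "x (hit scale \<Delta> lam_B h) = sw (\<lambda>a b. x a * lam_B b) h"
      unfolding hit_eq by (subst sw_comp) (simp_all add: additive_def functional_simps[OF x] mult.commute)
    then show "dual_mult \<Delta> x lam_B h = x (scale c (proj h))"
      by (simp add: G dual_mult_def sw_def)
  qed
  have dual: "dual scale = {x. functional x}" by (rule dual_eq)
  have "\<gamma> ` subspace_dual scale N = {dual_mult \<Delta> x lam_B | x. x \<in> dual scale}"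
  proof (intro equalityI subsetI)
    fix q assume "q \<in> \<gamma> ` subspace_dual scale N"
    then obtain p where p: "p \<in> subspace_dual scale N" "q = \<gamma> p" by blast
    have pl: "x \<in> N \<Longrightarrow> y \<in> N \<Longrightarrow> p (x + y) = p x + p y" "x \<in> N \<Longrightarrow> p (scale r x) = r * p x" for x y r
      using p(1) by (auto simp: subspace_dual_def)
    have x: "functional (\<lambda>h. p (proj h))"
      unfolding functional_def by (simp add: endo_add[OF endo_proj] endo_scale[OF endo_proj] pl proj_N)
    have "q = dual_mult \<Delta> (\<lambda>h. p (proj h)) lam_B"
      unfolding p(2) \<gamma>[OF p(1)] mult[OF x] by (simp add: proj_id G_N)
    then show "q \<in> {dual_mult \<Delta> x lam_B | x. x \<in> dual scale}" using x dual by blast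
  next
    fix q assume "q \<in> {dual_mult \<Delta> x lam_B | x. x \<in> dual scale}"
    then obtain x where x: "functional x" "q = dual_mult \<Delta> x lam_B" using dual by blast
    have p: "restrict x N \<in> subspace_dual scale N"
      using functional_simps[OF x(1)] subspace_add[OF N_subspace] N_scale
      by (auto simp: subspace_dual_def)
    have "q = \<gamma> (restrict x N)"
      unfolding x(2) \<gamma>[OF p] mult[OF x(1)] by (simp add: G_N)
    then show "q \<in> \<gamma> ` subspace_dual scale N" using p by blast
  qed
  moreover have "{dual_mult \<Delta> x lam_B | x. x \<in> dual scale}
      = {x \<in> dual scale. \<forall>h. hit scale \<Delta> (dual_antipode S x) h \<in> N}"
  proof (intro equalityI subsetI)
    fix q assume "q \<in> {dual_mult \<Delta> x lam_B | x. x \<in> dual scale}"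
    then obtain x where x: "functional x" "q = dual_mult \<Delta> x lam_B" using dual by blast
    have cx: "functional (\<lambda>h. x (scale c h))"
      using x(1) by (auto simp: functional_def scale_right_distrib distrib_left[where ?'a = 'k] mult.left_commute)
    have q: "q = (\<lambda>h. (\<lambda>h. x (scale c h)) (proj h))" unfolding x(2) mult[OF x(1)] ..
    have "functional q" unfolding q using functional_comp[OF cx endo_proj] .
    moreover have "hit scale \<Delta> (dual_antipode S q) h \<in> N" for h
      unfolding q by (rule antipode_hit_proj[OF cx])
    ultimately show "q \<in> {x \<in> dual scale. \<forall>h. hit scale \<Delta> (dual_antipode S x) h \<in> N}"
      using dual by blast
  next
    fix x assume "x \<in> {x \<in> dual scale. \<forall>h. hit scale \<Delta> (dual_antipode S x) h \<in> N}"
    then have x: "functional x" "\<And>h. hit scale \<Delta> (dual_antipode S x) h \<in> N" using dual by auto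
    have y: "functional (\<lambda>h. \<epsilon> counit_rep * x h)"
      using x(1) by (auto simp: functional_def distrib_left[where ?'a = 'k] mult.left_commute)
    have "dual_mult \<Delta> (\<lambda>h. \<epsilon> counit_rep * x h) lam_B = x"
      unfolding mult[OF y]
      by (simp add: functional_scale[OF x(1)] proj_of_antipode_hit[OF x] c flip: mult.assoc)
    then show "x \<in> {dual_mult \<Delta> x lam_B | x. x \<in> dual scale}" using y dual by force
  qed
  ultimately show ?thesis ..
qed

end
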